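(* Let $m\ge 1$ and $r\ge 2$ be integers, $B\subset\mathbb C^m$ the open Euclidean unit ball, $V$ a complex vector space of dimension $r$, and $F=B\times V\to B$ the trivial vector bundle. There are a positively curved metric $k$ on $O_{\mathbb P F}(1)$ and positive numbers $\rho<\rho'<1$ such that (a) for any $\mathrm{GL}(\mathbb C^r)$-equivariant map $\Psi:\mathsf K_{\mathbb C^r}\to\mathsf H_{\mathbb C^r}$ the metric $\Psi k$ on $F|\rho B$ fails to have semipositive curvature; (b) over $B\setminus\rho' B$, $k$ is of the form $k_h$, with $h$ a smooth metric on $F|(B\setminus\rho' B)$.
   Context: **Metrics and curvature.** A hermitian metric on a finite dimensional complex vector space $V$ is a function $\mathsf h:V\to\mathbb R$ of the form $\mathsf h(v)=\hat h(v,v)$, with $\hat h$ a positive definite hermitian form on $V$. A (hermitian) metric on a holomorphic vector bundle $E\to S$ is a function $h:E\to\mathbb R$ on the total space whose restriction to each fiber is a hermitian metric in this sense (no continuity is required a priori); it is smooth if $h$ is $C^\infty$. The metric $h$ is seminegatively curved if $h$ is plurisubharmonic on the total space $E$; it is negatively curved if $h$ is smooth and strongly plurisubharmonic ($i\partial\bar\partial h>0$) on $E$ away from the zero section. The metric $h$ is (semi)positively curved if the dual metric $h^*$ on the dual bundle $E^*$ is (semi)negatively curved. **The bundle $O_{\mathbb P E}(1)$.** For a holomorphic vector bundle $E\to S$, $\mathbb P E=\coprod_{s\in S}\mathbb P E_s$ is the set of hyperplanes (linear subspaces of codimension one) $P\subset E_s$ in the fibers of $E$, with its natural complex manifold structure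 and projection $\pi:\mathbb P E\to S$. Then $O_{\mathbb P E}(1)\to \mathbb P E$ is the holomorphic line bundle $(\pi^*E)/H$, where $H\subset\pi^*E$ is the tautological subbundle whose fiber over $P\in\mathbb P E_s$ is $P$; so its fiber over $P\in\mathbb P E_s$ is $E_s/P$. For a vector space $V$ (the case when $S$ is a point) this gives $O_{\mathbb P V}(1)\to\mathbb P V$. "Over $U$", for $U\subset S$, refers to the part of $O_{\mathbb P E}(1)$ lying above $U$ under $O_{\mathbb P E}(1)\to\mathbb P E\to S$, i.e. to $O_{\mathbb P(E|U)}(1)$. **The metric $k_h$.** If $h$ is a smooth hermitian metric on $E$, the metric $k_h$ on $O_{\mathbb P E}(1)$ is defined by $k_h(v+P)=\min_{v+P}h$ for $P\in\mathbb P E_s$, $v\in E_s$, where the element $v+P$ of the fiber $E_s/P$ is regarded as a translate of $P$ in $E_s$. **Equivariant maps.** $\mathsf H_V$ denotes the set of hermitian metrics on the vector space $V$, and $\mathsf K_V$ the set of positively curved metrics on $O_{\mathbb P V}(1)$. An isomorphism $\phi:V'\to V$ induces $\phi_{\mathsf H}:\mathsf H_V\to\mathsf H_{V'}$, $\phi_{\mathsf H}\mathsf h=\mathsf h\circ\phi$. It also induces $\phi_{\mathsf K}:\mathsf K_V\to\mathsf K_{V'}$: the isomorphisms $V'/P\to V/\phi(P)$, $P\in\mathbb P V'$, induced by $\phi$ together define an isomorphism $O_{\mathbb P V'}(1)\to O_{\mathbb P V}(1)$, and $\phi_{\mathsf K}\mathsf k$ is the pullback of $\mathsf k$ along it. A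 map $\Psi:\mathsf K_{\mathbb C^r}\to\mathsf H_{\mathbb C^r}$ is $\mathrm{GL}(\mathbb C^r)$-equivariant if $\phi_{\mathsf H}\circ\Psi=\Psi\circ\phi_{\mathsf K}$ for all $\phi\in\mathrm{GL}(\mathbb C^r)$. Such a $\Psi$ determines, for every $r$-dimensional complex vector space $V$, a map $\Psi_V=\psi_{\mathsf H}^{-1}\circ\Psi\circ\psi_{\mathsf K}:\mathsf K_V\to\mathsf H_V$, where $\psi:\mathbb C^r\to V$ is any isomorphism (the result does not depend on the choice of $\psi$). If $E\to S$ is a holomorphic vector bundle of rank $r$ and $k$ is a metric on $O_{\mathbb P E}(1)$ whose restriction to $O_{\mathbb P E_s}(1)$ is positively curved for every $s\in S$, the metric $\Psi k$ on $E$ is defined by $(\Psi k)|E_s=\Psi_{E_s}\big(k|O_{\mathbb P E_s}(1)\big)$, $s\in S$. For $\rho>0$, $\rho B=\{s\in\mathbb C^m:\|s\|<\rho\}$, with $\|\ \|$ the Euclidean norm. *)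

theory Defs
  imports "HOL-Analysis.Analysis"
begin

section \<open>Smooth and plurisubharmonic functions\<close>

primrec Ck_on :: "nat \<Rightarrow> 'a::real_normed_vector set \<Rightarrow> ('a \<Rightarrow> 'b::real_normed_vector) \<Rightarrow> bool" where
  "Ck_on 0 U f \<longleftrightarrow> continuous_on U f"
| "Ck_on (Suc n) U f \<longleftrightarrow> (\<forall>x\<in>U. f differentiable (at x)) \<and>
     (\<forall>v. Ck_on n U (\<lambda>x. frechet_derivative f (at x) v))"

text \<open>For a set that need not be open, smoothness means that the function extends, locally around
  each point of the set, to a \<open>C\<^sup>\<infinity>\<close> function on an open set. For open sets this is the usual notion.\<close>

definition smooth_on :: "'a::real_normed_vector set \<Rightarrow> ('a \<Rightarrow> 'b::real_normed_vector) \<Rightarrow> bool" where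
  "smooth_on A f \<longleftrightarrow> (\<forall>x\<in>A. \<exists>U g. open U \<and> x \<in> U \<and> (\<forall>n. Ck_on n U g) \<and> (\<forall>y\<in>A \<inter> U. g y = f y))"

text \<open>Below \<open>sc\<close> is the multiplication by complex scalars on the ambient real normed space.\<close>

definition prod_scale ::
  "(complex \<Rightarrow> 'a \<Rightarrow> 'a) \<Rightarrow> (complex \<Rightarrow> 'b \<Rightarrow> 'b) \<Rightarrow> complex \<Rightarrow> 'a \<times> 'b \<Rightarrow> 'a \<times> 'b" where
  "prod_scale sc1 sc2 c z = (sc1 c (fst z), sc2 c (snd z))"

definition second_derivative :: "('a::real_normed_vector \<Rightarrow> real) \<Rightarrow> 'a \<Rightarrow> 'a \<Rightarrow> real" where
  "second_derivative f a w =
     frechet_derivative (\<lambda>x. frechet_derivative f (at x) w) (at a) w"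

text \<open>A quarter of the Laplacian at \<open>\<zeta> = 0\<close> of \<open>\<zeta> \<mapsto> f (a + \<zeta> w)\<close>, that is, the mixed derivative of this
  function with respect to \<open>\<zeta>\<close> and its conjugate. Positivity of the (1,1)-form \<open>i\<partial>\<close>-\<open>\<partial>\<close>-bar of \<open>f\<close> at \<open>a\<close>
  means that it is positive for all \<open>w \<noteq> 0\<close>.\<close>

definition levi_form ::
  "(complex \<Rightarrow> 'a \<Rightarrow> 'a) \<Rightarrow> ('a::real_normed_vector \<Rightarrow> real) \<Rightarrow> 'a \<Rightarrow> 'a \<Rightarrow> real" where
  "levi_form sc f a w = (second_derivative f a w + second_derivative f a (sc \<i> w)) / 4"

definition strongly_psh_on ::
  "(complex \<Rightarrow> 'a \<Rightarrow> 'a) \<Rightarrow> 'a::real_normed_vector set \<Rightarrow> ('a \<Rightarrow> real) \<Rightarrow> bool" where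
  "strongly_psh_on sc U f \<longleftrightarrow> (\<forall>a\<in>U. \<forall>w. w \<noteq> 0 \<longrightarrow> levi_form sc f a w > 0)"

definition usc_on :: "'a::topological_space set \<Rightarrow> ('a \<Rightarrow> real) \<Rightarrow> bool" where
  "usc_on U f \<longleftrightarrow> (\<forall>x\<in>U. \<forall>c. f x < c \<longrightarrow> eventually (\<lambda>y. f y < c) (at x within U))"

text \<open>Upper semicontinuity and the submean value property on all closed discs in complex lines.
  An upper semicontinuous function is bounded above on a circle, so its mean over the circle exists
  in \<open>[-\<infinity>, \<infinity>)\<close>; as \<open>f\<close> is real valued the submean inequality forces it to be finite, which is the
  integrability condition.\<close>

definition psh_on ::
  "(complex \<Rightarrow> 'a \<Rightarrow> 'a) \<Rightarrow> 'a::real_normed_vector set \<Rightarrow> ('a \<Rightarrow> real) \<Rightarrow> bool" where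
  "psh_on sc U f \<longleftrightarrow> usc_on U f \<and>
     (\<forall>a w. (\<forall>\<zeta>. cmod \<zeta> \<le> 1 \<longrightarrow> a + sc \<zeta> w \<in> U) \<longrightarrow>
        (\<lambda>\<theta>. f (a + sc (cis \<theta>) w)) absolutely_integrable_on {0..2*pi} \<and>
        f a \<le> integral {0..2*pi} (\<lambda>\<theta>. f (a + sc (cis \<theta>) w)) / (2*pi))"


section \<open>Linear algebra\<close>

text \<open>A complex vector space \<open>V\<close> is a type \<open>'v\<close> with scalar multiplication \<open>smul\<close>.\<close>

definition lin_isos ::
  "(complex \<Rightarrow> 'u::ab_group_add \<Rightarrow> 'u) \<Rightarrow> (complex \<Rightarrow> 'v::ab_group_add \<Rightarrow> 'v) \<Rightarrow> ('u \<Rightarrow> 'v) set" where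
  "lin_isos smul1 smul2 = {\<phi>. Vector_Spaces.linear smul1 smul2 \<phi> \<and> bij \<phi>}"

definition hermitian_form ::
  "(complex \<Rightarrow> 'v::ab_group_add \<Rightarrow> 'v) \<Rightarrow> ('v \<Rightarrow> 'v \<Rightarrow> complex) \<Rightarrow> bool" where
  "hermitian_form smul g \<longleftrightarrow>
     (\<forall>u v w. g (u + v) w = g u w + g v w) \<and>
     (\<forall>c u v. g (smul c u) v = c * g u v) \<and>
     (\<forall>u v. g v u = cnj (g u v))"

definition hermitian_metric ::
  "(complex \<Rightarrow> 'v::ab_group_add \<Rightarrow> 'v) \<Rightarrow> ('v \<Rightarrow> real) \<Rightarrow> bool" where
  "hermitian_metric smul h \<longleftrightarrow>
     (\<exists>g. hermitian_form smul g \<and> (\<forall>v. v \<noteq> 0 \<longrightarrow> Re (g v v) > 0) \<and> (\<forall>v. h v = Re (g v v)))"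

definition dual_metric :: "('v::zero \<Rightarrow> real) \<Rightarrow> ('v \<Rightarrow> complex) \<Rightarrow> real" where
  "dual_metric h \<xi> = (SUP v\<in>-{0}. (cmod (\<xi> v))\<^sup>2 / h v)"

text \<open>The linear form on \<open>V\<close> whose coordinates, in the basis of \<open>V\<^sup>*\<close> dual to the basis of \<open>V\<close> given by
  the isomorphism \<open>\<psi>\<close>, are \<open>x\<close>.\<close>

definition dual_vec :: "(complex ^ 'r::finite \<Rightarrow> 'v) \<Rightarrow> complex ^ 'r \<Rightarrow> 'v \<Rightarrow> complex" where
  "dual_vec \<psi> x v = (\<Sum>i\<in>UNIV. x $ i * inv \<psi> v $ i)"


section \<open>The line bundle \<open>O(1)\<close> over the space of hyperplanes\<close>

definition hyperplanes :: "(complex \<Rightarrow> 'v::ab_group_add \<Rightarrow> 'v) \<Rightarrow> 'v set set" where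
  "hyperplanes smul =
     {P. module.subspace smul P \<and> vector_space.dim smul P + 1 = vector_space.dim smul UNIV}"

text \<open>The total space of \<open>O(1)\<close> over the projective space of \<open>V\<close>. A coset \<open>v + P\<close> determines \<open>P\<close>, so the
  disjoint union of the fibers \<open>V/P\<close> is the set of all these cosets.\<close>

definition O1 :: "(complex \<Rightarrow> 'v::ab_group_add \<Rightarrow> 'v) \<Rightarrow> 'v set set" where
  "O1 smul = {(+) v ` P |v P. P \<in> hyperplanes smul}"

text \<open>On each fiber \<open>V/P\<close> the metric comes from a positive definite hermitian form \<open>g\<close> on \<open>V/P\<close>. The vector
  space operations on \<open>V/P\<close> are those making \<open>v \<mapsto> v + P\<close> linear, hence \<open>g\<close> is hermitian
  if and only if its pullback to \<open>V\<close> is.\<close>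

definition O1_metric :: "(complex \<Rightarrow> 'v::ab_group_add \<Rightarrow> 'v) \<Rightarrow> ('v set \<Rightarrow> real) \<Rightarrow> bool" where
  "O1_metric smul k \<longleftrightarrow> (\<forall>P\<in>hyperplanes smul. \<exists>g.
     hermitian_form smul (\<lambda>u v. g ((+) u ` P) ((+) v ` P)) \<and>
     (\<forall>v. (+) v ` P \<noteq> P \<longrightarrow> Re (g ((+) v ` P) ((+) v ` P)) > 0) \<and>
     (\<forall>v. k ((+) v ` P) = Re (g ((+) v ` P) ((+) v ` P))))"

text \<open>The metric dual to \<open>k\<close>. A linear form on the fiber \<open>V/P\<close> is represented by a linear form \<open>\<xi>\<close> on
  \<open>V\<close> that vanishes on \<open>P\<close>.\<close>

definition O1_dual_metric :: "('v::ab_group_add set \<Rightarrow> real) \<Rightarrow> 'v set \<Rightarrow> ('v \<Rightarrow> complex) \<Rightarrow> real" where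
  "O1_dual_metric k P \<xi> = (SUP v\<in>-P. (cmod (\<xi> v))\<^sup>2 / k ((+) v ` P))"

text \<open>The complex structure of the total space of the dual of \<open>O(1)\<close>: with \<open>x \<noteq> 0\<close> the coordinates of a
  linear form \<open>\<xi>\<close> on \<open>V\<close>, the map \<open>(x, t) \<mapsto> (ker \<xi>, t\<xi>)\<close> is a surjective holomorphic submersion onto
  the total space, so a function on the total space is smooth if and only if its pullback
  by this map is; and \<open>x \<mapsto> (ker \<xi>, \<xi>)\<close> is a biholomorphism onto the complement of the
  zero section. The next function is the pullback of the dual metric.\<close>

definition O1_dual_coord ::
  "(complex ^ 'r::finite \<Rightarrow> 'v::ab_group_add) \<Rightarrow> ('v set \<Rightarrow> real) \<Rightarrow> complex ^ 'r \<Rightarrow> complex \<Rightarrow> real" where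
  "O1_dual_coord \<psi> k x t =
     O1_dual_metric k {v. dual_vec \<psi> x v = 0} (\<lambda>v. t * dual_vec \<psi> x v)"

text \<open>The positively curved metrics on \<open>O(1)\<close> over the projective space of \<open>V\<close>, where \<open>V\<close> has dimension
  \<open>CARD('r)\<close>. The metrics are functions on the total space, hence extensional.\<close>

definition K_metrics ::
  "'r::finite itself \<Rightarrow> (complex \<Rightarrow> 'v::ab_group_add \<Rightarrow> 'v) \<Rightarrow> ('v set \<Rightarrow> real) set" where
  "K_metrics (_ :: 'r itself) smul = {k \<in> extensional (O1 smul). O1_metric smul k \<and>
     (\<forall>\<psi> \<in> lin_isos ((*s) :: complex \<Rightarrow> complex ^ 'r \<Rightarrow> complex ^ 'r) smul.
        smooth_on ((-{0}) \<times> UNIV) (\<lambda>(x, t). O1_dual_coord \<psi> k x t) \<and>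
        strongly_psh_on (*s) (-{0}) (\<lambda>x. O1_dual_coord \<psi> k x 1))}"

text \<open>Positively curved metrics on \<open>O(1)\<close> for the trivial bundle \<open>S \<times> V\<close>, \<open>S\<close> open in \<open>\<complex>\<^sup>m\<close>; the
  value of the metric on the element \<open>v + P\<close> of the fiber over \<open>(s, P)\<close> is \<open>k s (v + P)\<close>.\<close>

definition O1_positively_curved ::
  "'r::finite itself \<Rightarrow> (complex \<Rightarrow> 'v::ab_group_add \<Rightarrow> 'v) \<Rightarrow> (complex ^ 'm::finite) set \<Rightarrow>
     (complex ^ 'm \<Rightarrow> 'v set \<Rightarrow> real) \<Rightarrow> bool" where
  "O1_positively_curved (_ :: 'r itself) smul S k \<longleftrightarrow> (\<forall>s\<in>S. O1_metric smul (k s)) \<and>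
     (\<forall>\<psi> \<in> lin_isos ((*s) :: complex \<Rightarrow> complex ^ 'r \<Rightarrow> complex ^ 'r) smul.
        smooth_on (S \<times> (-{0}) \<times> UNIV) (\<lambda>(s, x, t). O1_dual_coord \<psi> (k s) x t) \<and>
        strongly_psh_on (prod_scale (*s) (*s)) (S \<times> (-{0}))
          (\<lambda>(s, x). O1_dual_coord \<psi> (k s) x 1))"


section \<open>Metrics on trivial bundles\<close>

text \<open>A metric on the trivial bundle \<open>S \<times> V\<close> is a function \<open>h\<close> such that \<open>h s\<close> is a hermitian metric on \<open>V\<close>
  for \<open>s \<in> S\<close>. Smoothness and plurisubharmonicity on \<open>S \<times> V\<close> and \<open>S \<times> V\<^sup>*\<close> are expressed in linear
  coordinates.\<close>

definition smooth_metric ::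
  "'r::finite itself \<Rightarrow> (complex \<Rightarrow> 'v::ab_group_add \<Rightarrow> 'v) \<Rightarrow> (complex ^ 'm::finite) set \<Rightarrow>
     (complex ^ 'm \<Rightarrow> 'v \<Rightarrow> real) \<Rightarrow> bool" where
  "smooth_metric (_ :: 'r itself) smul S h \<longleftrightarrow> (\<forall>s\<in>S. hermitian_metric smul (h s)) \<and>
     (\<forall>\<psi> \<in> lin_isos ((*s) :: complex \<Rightarrow> complex ^ 'r \<Rightarrow> complex ^ 'r) smul.
        smooth_on (S \<times> UNIV) (\<lambda>(s, x). h s (\<psi> x)))"

definition semipositively_curved ::
  "'r::finite itself \<Rightarrow> (complex \<Rightarrow> 'v::ab_group_add \<Rightarrow> 'v) \<Rightarrow> (complex ^ 'm::finite) set \<Rightarrow>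
     (complex ^ 'm \<Rightarrow> 'v \<Rightarrow> real) \<Rightarrow> bool" where
  "semipositively_curved (_ :: 'r itself) smul S h \<longleftrightarrow>
     (\<forall>\<psi> \<in> lin_isos ((*s) :: complex \<Rightarrow> complex ^ 'r \<Rightarrow> complex ^ 'r) smul.
        psh_on (prod_scale (*s) (*s)) (S \<times> UNIV) (\<lambda>(s, x). dual_metric (h s) (dual_vec \<psi> x)))"

definition k_of :: "('v \<Rightarrow> real) \<Rightarrow> 'v set \<Rightarrow> real" where
  "k_of h C = (LEAST y. y \<in> h ` C)"


section \<open>Equivariant maps\<close>

definition K_pullback ::
  "(complex \<Rightarrow> 'u::ab_group_add \<Rightarrow> 'u) \<Rightarrow> ('u \<Rightarrow> 'v) \<Rightarrow> ('v set \<Rightarrow> real) \<Rightarrow> 'u set \<Rightarrow> real" where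
  "K_pullback smul \<phi> k = restrict (\<lambda>C. k (\<phi> ` C)) (O1 smul)"

definition equivariant ::
  "(((complex ^ 'r::finite) set \<Rightarrow> real) \<Rightarrow> (complex ^ 'r \<Rightarrow> real)) \<Rightarrow> bool" where
  "equivariant \<Psi> \<longleftrightarrow>
     \<Psi> \<in> K_metrics TYPE('r) (*s) \<rightarrow> Collect (hermitian_metric (*s)) \<and>
     (\<forall>\<phi> \<in> lin_isos (*s) (*s). \<forall>k \<in> K_metrics TYPE('r) (*s).
        \<Psi> k \<circ> \<phi> = \<Psi> (K_pullback (*s) \<phi> k))"

text \<open>For equivariant \<open>\<Psi>\<close> the result does not depend on the choice of \<open>\<psi>\<close>.\<close>

definition Psi_V ::
  "(((complex ^ 'r::finite) set \<Rightarrow> real) \<Rightarrow> (complex ^ 'r \<Rightarrow> real)) \<Rightarrow>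
     (complex \<Rightarrow> 'v::ab_group_add \<Rightarrow> 'v) \<Rightarrow> ('v set \<Rightarrow> real) \<Rightarrow> 'v \<Rightarrow> real" where
  "Psi_V \<Psi> smul k =
     (let \<psi> = (SOME \<psi>. \<psi> \<in> lin_isos (*s) smul) in \<Psi> (K_pullback (*s) \<psi> k) \<circ> inv \<psi>)"

definition Psi_metric ::
  "(((complex ^ 'r::finite) set \<Rightarrow> real) \<Rightarrow> (complex ^ 'r \<Rightarrow> real)) \<Rightarrow>
     (complex \<Rightarrow> 'v::ab_group_add \<Rightarrow> 'v) \<Rightarrow> ('b \<Rightarrow> 'v set \<Rightarrow> real) \<Rightarrow> 'b \<Rightarrow> 'v \<Rightarrow> real" where
  "Psi_metric \<Psi> smul k s = Psi_V \<Psi> smul (restrict (k s) (O1 smul))"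

end

theory Submission
  imports Defs
begin

text \<open>A metric on \<open>O(1)\<close> is given by its dual, a function \<open>K s x\<close> that is positive and homogeneous,
  \<open>K s (c x) = |c|\<^sup>2 K s x\<close>; it is positively curved if and only if \<open>K\<close> is smooth and strongly
  plurisubharmonic for \<open>x \<noteq> 0\<close>. Take \<open>K s x = |x|\<^sup>2 + \<epsilon> P \<epsilon> s x\<close>. Since \<open>|x|\<^sup>2\<close> is strongly
  plurisubharmonic in \<open>x\<close>, for small \<open>\<epsilon>\<close> it suffices that for fixed \<open>x\<close> the function \<open>P 0 s x\<close> is
  strongly plurisubharmonic in \<open>s\<close>.

  For small \<open>s\<close> let \<open>K s x = K 0 (A(s) x)\<close>, where \<open>K 0\<close> is invariant under sign changes of two
  coordinates \<open>p\<close>, \<open>q\<close> and under their interchange, and \<open>A(s)\<close> is a diagonal matrix followed by a rotation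
  in the \<open>p\<close>, \<open>q\<close> plane by the angle \<open>Im s\<^sub>j\<close>. Equivariance then forces the dual of \<open>\<Psi> k\<close> to be a constant
  multiple of \<open>|A(s) x|\<^sup>2\<close> for \<open>x\<close> in that plane. The diagonal weight \<open>a\<close> of the coordinate \<open>q\<close> satisfies
  \<open>a\<^sup>2 < 1\<close> on small circles around \<open>0\<close> in the \<open>s\<^sub>j\<close> axis while \<open>a = 1\<close> at \<open>0\<close>, so this dual is not
  plurisubharmonic. Nevertheless \<open>P 0 s x\<close> is, because rotating the non-quadratic part of \<open>K 0\<close>
  contributes a positive Laplacian near the \<open>q\<close> axis. Away from \<open>s = 0\<close> the non-quadratic part is cut
  off, and a term \<open>W |s|\<^sup>4\<close> in the weights, invisible to second order at \<open>0\<close>, absorbs the error.\<close>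

section \<open>Calculus of \<open>C\<^sup>k\<close> functions\<close>

lemma has_derivative_frechet:
  "f differentiable (at x) \<Longrightarrow> (f has_derivative frechet_derivative f (at x)) (at x)"
  by (simp add: frechet_derivative_works)

lemma Ck_on_cong:
  fixes f g :: "'a::real_normed_vector \<Rightarrow> 'b::real_normed_vector"
  assumes "open U" "\<And>x. x \<in> U \<Longrightarrow> f x = g x" "Ck_on n U f"
  shows "Ck_on n U g"
  using assms(2,3)
proof (induction n arbitrary: f g)
  case 0
  then show ?case by (metis Ck_on.simps(1) continuous_on_cong)
next
  case (Suc n)
  have D: "(g has_derivative frechet_derivative f (at x)) (at x)" if "x \<in> U" for x
    using Suc.prems that assms(1)
    by (metis (no_types, lifting) Ck_on.simps(2) has_derivative_frechet has_derivative_transform_within_open)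
  have "frechet_derivative f (at x) = frechet_derivative g (at x)" if "x \<in> U" for x
    using frechet_derivative_at[OF D[OF that]] .
  then have "Ck_on n U (\<lambda>x. frechet_derivative g (at x) v)" for v
    using Suc.IH[of "\<lambda>x. frechet_derivative f (at x) v"] Suc.prems(2) by simp
  then show ?case using D by (auto simp: differentiable_def)
qed

lemma Ck_on_SucI:
  assumes "open U" "\<And>x. x \<in> U \<Longrightarrow> (f has_derivative f' x) (at x)"
    and "\<And>v. Ck_on n U (\<lambda>x. f' x v)"
  shows "Ck_on (Suc n) U f"
proof -
  have "f' x = frechet_derivative f (at x)" if "x \<in> U" for x
    using frechet_derivative_at[OF assms(2)[OF that]] .
  then have "Ck_on n U (\<lambda>x. frechet_derivative f (at x) v)" for v
    using Ck_on_cong[OF assms(1) _ assms(3)] by simp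
  then show ?thesis using assms(2) by (auto simp: differentiable_def)
qed

lemma Ck_on_subset: "Ck_on n U f \<Longrightarrow> V \<subseteq> U \<Longrightarrow> Ck_on n V f"
  by (induction n arbitrary: f) (auto intro: continuous_on_subset)

lemma Ck_on_Suc_imp: "Ck_on (Suc n) U f \<Longrightarrow> Ck_on n U f"
proof (induction n arbitrary: f)
  case 0
  then show ?case
    by (auto intro!: continuous_at_imp_continuous_on differentiable_imp_continuous_within)
next
  case (Suc n)
  then show ?case by (metis Ck_on.simps(2))
qed

lemma Ck_on_has_derivative:
  "Ck_on (Suc n) U f \<Longrightarrow> x \<in> U \<Longrightarrow> (f has_derivative frechet_derivative f (at x)) (at x)"
  by (auto intro: has_derivative_frechet)

lemma Ck_on_frechet: "Ck_on (Suc n) U f \<Longrightarrow> Ck_on n U (\<lambda>x. frechet_derivative f (at x) v)"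
  by simp

lemma Ck_on_imp_continuous_on: "Ck_on n U f \<Longrightarrow> continuous_on U f"
  by (induction n) (auto dest: Ck_on_Suc_imp simp del: Ck_on.simps(2))

lemma Ck_on_const: "open U \<Longrightarrow> Ck_on n U (\<lambda>x. c)"
proof (induction n arbitrary: c)
  case (Suc n)
  then show ?case by (intro Ck_on_SucI[where f' = "\<lambda>x v. 0"]) auto
qed auto

lemma Ck_on_bounded_linear:
  assumes "open U" "bounded_linear f" shows "Ck_on n U f"
proof (cases n)
  case 0
  then show ?thesis by (simp add: assms linear_continuous_on)
next
  case (Suc k)
  then show ?thesis using assms
    by (auto intro!: Ck_on_SucI[where f' = "\<lambda>x. f"] bounded_linear_imp_has_derivative Ck_on_const
        simp del: Ck_on.simps)
qed

lemma Ck_on_add: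
  assumes "open U"
  shows "Ck_on n U f \<Longrightarrow> Ck_on n U g \<Longrightarrow> Ck_on n U (\<lambda>x. f x + g x)"
proof (induction n arbitrary: f g)
  case 0
  then show ?case by (auto intro: continuous_on_add)
next
  case (Suc n)
  show ?case
    by (rule Ck_on_SucI[where f' = "\<lambda>x v. frechet_derivative f (at x) v + frechet_derivative g (at x) v"])
      (use Suc assms in \<open>auto intro!: has_derivative_add Ck_on_has_derivative[of n U] simp del: Ck_on.simps(2)
         dest: Ck_on_frechet\<close>)
qed

lemma Ck_on_sum:
  assumes "open U" "\<And>i. i \<in> I \<Longrightarrow> Ck_on n U (f i)"
  shows "Ck_on n U (\<lambda>x. \<Sum>i\<in>I. f i x)"
  using assms(2)
  by (induction I rule: infinite_finite_induct) (auto intro!: Ck_on_add Ck_on_const assms(1))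

lemma Ck_on_bounded_bilinear:
  assumes "open U" "bounded_bilinear B"
  shows "Ck_on n U f \<Longrightarrow> Ck_on n U g \<Longrightarrow> Ck_on n U (\<lambda>x. B (f x) (g x))"
proof (induction n arbitrary: f g)
  case 0
  then show ?case by (auto intro: bounded_bilinear.continuous_on[OF assms(2)])
next
  case (Suc n)
  show ?case
  proof (rule Ck_on_SucI[OF assms(1)])
    show "((\<lambda>x. B (f x) (g x)) has_derivative
      (\<lambda>v. B (f x) (frechet_derivative g (at x) v) + B (frechet_derivative f (at x) v) (g x))) (at x)"
      if "x \<in> U" for x
      by (intro bounded_bilinear.FDERIV[OF assms(2)] Ck_on_has_derivative[OF Suc.prems(1) that]
          Ck_on_has_derivative[OF Suc.prems(2) that])
    show "Ck_on n U (\<lambda>x. B (f x) (frechet_derivative g (at x) v) +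
        B (frechet_derivative f (at x) v) (g x))" for v
      by (intro Ck_on_add assms(1) Suc.IH Ck_on_Suc_imp[OF Suc.prems(1)] Ck_on_Suc_imp[OF Suc.prems(2)]
          Ck_on_frechet[OF Suc.prems(1)] Ck_on_frechet[OF Suc.prems(2)])
  qed
qed

lemmas Ck_on_mult = Ck_on_bounded_bilinear[OF _ bounded_bilinear_mult]
lemmas Ck_on_inner = Ck_on_bounded_bilinear[OF _ bounded_bilinear_inner]

lemma Ck_on_diff:
  fixes f g :: "'a::real_normed_vector \<Rightarrow> real"
  assumes "open U" "Ck_on n U f" "Ck_on n U g"
  shows "Ck_on n U (\<lambda>x. f x - g x)"
  using Ck_on_add[OF assms(1,2) Ck_on_mult[OF assms(1) Ck_on_const[OF assms(1), of n "-1"] assms(3)]] by simp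

lemma Ck_on_power:
  fixes f :: "'a::real_normed_vector \<Rightarrow> real"
  assumes "open U" "Ck_on n U f"
  shows "Ck_on n U (\<lambda>x. f x ^ k)"
  by (induction k) (auto intro!: Ck_on_mult Ck_on_const assms simp del: Ck_on.simps)

lemma Ck_on_affine_compose:
  assumes "bounded_linear L" "open U" "open V" "\<And>x. x \<in> V \<Longrightarrow> b + L x \<in> U"
  shows "Ck_on n U f \<Longrightarrow> Ck_on n V (\<lambda>x. f (b + L x))"
proof (induction n arbitrary: f)
  case 0
  have "continuous_on V (\<lambda>x. b + L x)"
    by (intro continuous_intros linear_continuous_on assms(1))
  then show ?case
    using 0 assms(4) continuous_on_compose2[of U f V "\<lambda>x. b + L x"] by auto
next
  case (Suc n)
  show ?case
  proof (rule Ck_on_SucI[OF assms(3)])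
    show "((\<lambda>x. f (b + L x)) has_derivative (\<lambda>v. frechet_derivative f (at (b + L x)) (L v))) (at x)"
      if "x \<in> V" for x
    proof -
      have "((\<lambda>x. b + L x) has_derivative L) (at x)"
        using has_derivative_add[OF has_derivative_const bounded_linear_imp_has_derivative[OF assms(1)]] by simp
      from has_derivative_compose[OF this Ck_on_has_derivative[OF Suc.prems assms(4)[OF that]]]
      show ?thesis .
    qed
    show "Ck_on n V (\<lambda>x. frechet_derivative f (at (b + L x)) (L v))" for v
      using Suc.IH[OF Ck_on_frechet[OF Suc.prems]] .
  qed
qed

text \<open>Taking for \<open>F\<close> a sequence of successive derivatives makes the induction
  close: differentiating \<open>F i (g x)\<close> gives \<open>F (Suc i) (g x)\<close> times a
  derivative of \<open>g\<close>, which is again of this form.\<close>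

lemma Ck_on_real_compose:
  fixes F :: "nat \<Rightarrow> real \<Rightarrow> real" and g :: "'a::real_normed_vector \<Rightarrow> real"
  assumes "open U" "\<And>i y. y \<in> g ` U \<Longrightarrow> (F i has_real_derivative F (Suc i) y) (at y)"
    and "\<And>n. Ck_on n U g"
  shows "Ck_on n U (\<lambda>x. F i (g x))"
proof (induction n arbitrary: i)
  case 0
  have "continuous_on (g ` U) (F i)"
    by (rule DERIV_continuous_on[OF has_field_derivative_at_within[OF assms(2)]])
  then show ?case using assms(3)[of 0] continuous_on_compose2[of "g ` U" "F i" U g] by simp
next
  case (Suc n)
  show ?case
  proof (rule Ck_on_SucI[OF assms(1)])
    show "((\<lambda>x. F i (g x)) has_derivative (\<lambda>v. F (Suc i) (g x) * frechet_derivative g (at x) v)) (at x)"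
      if "x \<in> U" for x
      using has_derivative_compose[OF Ck_on_has_derivative[OF assms(3) that]
          has_field_derivative_imp_has_derivative[OF assms(2)[OF imageI[OF that]]]] .
    show "Ck_on n U (\<lambda>x. F (Suc i) (g x) * frechet_derivative g (at x) v)" for v
      by (intro Ck_on_mult assms(1) Suc.IH Ck_on_frechet[OF assms(3)])
  qed
qed

lemma Ck_on_inverse:
  fixes g :: "'a::real_normed_vector \<Rightarrow> real"
  assumes "open U" "\<And>x. x \<in> U \<Longrightarrow> g x \<noteq> 0" "\<And>n. Ck_on n U g"
  shows "Ck_on n U (\<lambda>x. inverse (g x))"
proof -
  \<comment> \<open>\<open>F i\<close> is the i-th derivative of 1/y.\<close>
  define F :: "nat \<Rightarrow> real \<Rightarrow> real" where "F i y = (-1)^i * fact i * inverse y ^ (Suc i)" for i y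
  have "(F i has_real_derivative F (Suc i) y) (at y)" if "y \<noteq> 0" for i y
    unfolding F_def
    by (rule DERIV_cong[OF DERIV_cmult[OF DERIV_power[OF DERIV_inverse[OF that]]]]) simp
  then have "Ck_on n U (\<lambda>x. F 0 (g x))"
    by (intro Ck_on_real_compose[where F=F] assms) (use assms(2) in auto)
  then show ?thesis by (simp add: F_def)
qed

lemma Ck_on_sin_cos:
  fixes g :: "'a::real_normed_vector \<Rightarrow> real"
  assumes "open U" "\<And>n. Ck_on n U g"
  shows "Ck_on n U (\<lambda>x. sin (g x))" "Ck_on n U (\<lambda>x. cos (g x))"
proof -
  \<comment> \<open>Each differentiation shifts the argument of the sine by a quarter period;
    \<open>F 1\<close> is the cosine.\<close>
  define F :: "nat \<Rightarrow> real \<Rightarrow> real" where "F i y = sin (y + real i * (pi/2))" for i y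
  have "F (Suc i) y = cos (y + real i * (pi/2))" for i y
    using sin_add[of "y + real i * (pi/2)" "pi/2"] by (simp add: F_def algebra_simps add_divide_distrib)
  moreover have "(F i has_real_derivative cos (y + real i * (pi/2))) (at y)" for i y
    unfolding F_def by (auto intro!: derivative_eq_intros)
  ultimately have "(F i has_real_derivative F (Suc i) y) (at y)" for i y
    by simp
  then have *: "Ck_on n U (\<lambda>x. F i (g x))" for i
    by (intro Ck_on_real_compose[where F=F] assms)
  show "Ck_on n U (\<lambda>x. sin (g x))" using *[of 0] by (simp add: F_def)
  show "Ck_on n U (\<lambda>x. cos (g x))" using *[of 1] by (simp add: F_def sin_add)
qed

section \<open>A smooth cutoff function\<close>

text \<open>The functions t^(-n) exp(-1/t), extended by zero. All powers are included because the
  span of the family is then closed under differentiation.\<close>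

definition flat :: "nat \<Rightarrow> real \<Rightarrow> real" where
  "flat n t = (if t > 0 then inverse t ^ n * exp (- inverse t) else 0)"

lemma flat_tendsto_0: "((\<lambda>t. flat n t) \<longlongrightarrow> 0) (at_right 0)"
proof -
  have "((\<lambda>y::real. y ^ n / exp y) \<longlongrightarrow> 0) at_top" by (rule tendsto_power_div_exp_0)
  then have "((\<lambda>t::real. inverse t ^ n / exp (inverse t)) \<longlongrightarrow> 0) (at_right 0)"
    by (rule filterlim_compose[OF _ filterlim_inverse_at_top_right])
  then show ?thesis
    by (rule Lim_transform_eventually)
      (auto simp: flat_def exp_minus divide_inverse eventually_at_right_less intro!: eventually_at_rightI[of 0 1])
qed

text \<open>The delicate point is t = 0: there the difference quotient from the right is
  \<open>flat (n+1)\<close>, which tends to 0, and the one from the left vanishes.\<close>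

lemma flat_deriv: "(flat n has_real_derivative flat (n+2) t - real n * flat (n+1) t) (at t)"
proof -
  consider "t > 0" | "t < 0" | "t = 0" by linarith
  then show ?thesis
  proof cases
    case 1
    have "((\<lambda>t. inverse t ^ n * exp (- inverse t)) has_real_derivative
       flat (n+2) t - real n * flat (n+1) t) (at t)"
    proof (cases n)
      case 0
      then show ?thesis using 1
        by (auto intro!: derivative_eq_intros simp: flat_def power2_eq_square)
    next
      case (Suc k)
      have "((\<lambda>t. inverse t ^ Suc k * exp (- inverse t)) has_real_derivative
          real (Suc k) * (- (inverse t ^ Suc (Suc 0)) * inverse t ^ k) * exp (- inverse t) +
          exp (- inverse t) * inverse t ^ Suc (Suc 0) * inverse t ^ Suc k) (at t)"
        using 1 by (intro DERIV_mult' DERIV_cong[OF DERIV_mult'] DERIV_power[OF DERIV_inverse, THEN DERIV_cong])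
          (auto intro!: derivative_eq_intros simp: power2_eq_square)
      then show ?thesis using 1 Suc
        by (auto elim!: DERIV_cong simp: flat_def algebra_simps)
    qed
    then show ?thesis
      by (rule has_field_derivative_transform_within_open[where S="{0<..}"]) (use 1 in \<open>auto simp: flat_def\<close>)
  next
    case 2
    have "((\<lambda>t. 0) has_real_derivative flat (n+2) t - real n * flat (n+1) t) (at t)"
      using 2 by (auto simp: flat_def)
    then show ?thesis
      by (rule has_field_derivative_transform_within_open[where S="{..<0}"]) (use 2 in \<open>auto simp: flat_def\<close>)
  next
    case 3
    have r: "((\<lambda>h. (flat n h - flat n 0) / h) \<longlongrightarrow> 0) (at_right 0)"
      by (rule Lim_transform_eventually[OF flat_tendsto_0[of "n+1"]])
        (auto simp: flat_def field_simps intro!: eventually_at_rightI[of 0 1])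
    have l: "((\<lambda>h. (flat n h - flat n 0) / h) \<longlongrightarrow> 0) (at_left 0)"
      by (rule Lim_transform_eventually[OF tendsto_const])
        (auto simp: flat_def intro!: eventually_at_leftI[of "-1"])
    have "(flat n has_real_derivative 0) (at 0)"
      unfolding DERIV_def using filterlim_split_at_real[OF l r] by simp
    then show ?thesis using 3 by (simp add: flat_def)
  qed
qed

lemma Ck_on_flat_UNIV: "Ck_on k UNIV (flat n)"
proof (induction k arbitrary: n)
  case 0
  show ?case using flat_deriv by (auto intro!: continuous_at_imp_continuous_on DERIV_isCont)
next
  case (Suc k)
  have "Ck_on k UNIV (\<lambda>x. v * (flat (n+2) x - real n * flat (n+1) x))" for v
    by (intro Ck_on_mult Ck_on_diff Suc.IH Ck_on_const) auto
  then show ?case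
    by (intro Ck_on_SucI[where f' = "\<lambda>x v. v * (flat (n+2) x - real n * flat (n+1) x)"])
      (use flat_deriv in \<open>auto simp: has_field_derivative_def mult.commute[of "_ - _"] mult_commute_abs simp del: Ck_on.simps\<close>)
qed

text \<open>The iterated derivatives of \<open>f\<close> provide the sequence for
  \<open>Ck_on_real_compose\<close>; they are smooth because the directional derivative in direction
  1 is the ordinary derivative.\<close>

lemma Ck_on_compose_UNIV:
  fixes f :: "real \<Rightarrow> real" and g :: "'a::real_normed_vector \<Rightarrow> real"
  assumes "open U" "\<And>n. Ck_on n UNIV f" "\<And>n. Ck_on n U g"
  shows "Ck_on n U (\<lambda>x. f (g x))"
proof -
  define F where "F i = (deriv ^^ i) f" for i
  have F: "Ck_on n UNIV (F i)" for n i
  proof (induction i arbitrary: n)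
    case (Suc i)
    have "frechet_derivative (F i) (at x) 1 = F (Suc i) x" for x
    proof -
      have "F i differentiable (at x)" using Suc.IH[of 1] by simp
      then obtain D where D: "(F i has_real_derivative D) (at x)"
        using real_differentiable_def by blast
      have "frechet_derivative (F i) (at x) = (*) D"
        using frechet_derivative_at D unfolding has_field_derivative_def by metis
      then show ?thesis using DERIV_imp_deriv[OF D] by (simp add: F_def)
    qed
    then show ?case using Ck_on_frechet[OF Suc.IH[of "Suc n"], of 1] by simp
  qed (simp add: F_def assms(2))
  have "(F i has_real_derivative F (Suc i) y) (at y)" for i y
  proof -
    have "F i differentiable (at y)" using F[of 1] by simp
    then show ?thesis using DERIV_imp_deriv real_differentiable_def by (fastforce simp: F_def)
  qed
  then have "Ck_on n U (\<lambda>x. F 0 (g x))" by (intro Ck_on_real_compose[where F=F] assms)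
  then show ?thesis by (simp add: F_def)
qed

lemma smooth_cutoff:
  obtains \<eta> :: "real \<Rightarrow> real" where "\<And>n. Ck_on n UNIV \<eta>"
    "\<And>u. u \<le> 1/4 \<Longrightarrow> \<eta> u = 1/4" "\<And>u. u \<ge> 1/2 \<Longrightarrow> \<eta> u = 0"
proof
  \<comment> \<open>Here \<open>c = flat 0 (1/4)\<close>. The inner function vanishes for
    \<open>u \<le> 1/4\<close> and is at least \<open>c\<close> for \<open>u \<ge> 1/2\<close>, so
    the argument of the outer one falls from \<open>c\<close> to nonpositive values. The prefactor
    makes the plateau equal to 1/4.\<close>
  define c where "c = exp (-4::real)"
  define \<eta> where "\<eta> u = inverse (4 * flat 0 c) * flat 0 (c - flat 0 (u - 1/4))" for u
  have c: "c > 0" "flat 0 c > 0" by (auto simp: c_def flat_def)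
  show "Ck_on n UNIV \<eta>" for n
    unfolding \<eta>_def
    by (intro Ck_on_mult Ck_on_const Ck_on_compose_UNIV[OF _ Ck_on_flat_UNIV] Ck_on_diff
        Ck_on_bounded_linear bounded_linear_ident open_UNIV)
  show "\<eta> u = 1/4" if "u \<le> 1/4" for u
    using that c by (simp add: \<eta>_def flat_def[of 0 "u-1/4"])
  show "\<eta> u = 0" if "u \<ge> 1/2" for u
  proof -
    have "inverse (u - 1/4) \<le> 4" using that by (simp add: field_simps)
    then have "flat 0 (u - 1/4) \<ge> c" using that by (simp add: flat_def c_def)
    then show ?thesis by (simp add: \<eta>_def flat_def)
  qed
qed

section \<open>Second derivatives along lines\<close>

lemma line_derivative:
  fixes f :: "'a::real_normed_vector \<Rightarrow> real"
  assumes "(f has_derivative f') (at (a + t *\<^sub>R w))"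
  shows "((\<lambda>t. f (a + t *\<^sub>R w)) has_real_derivative f' w) (at t)"
proof -
  have "((\<lambda>t. a + t *\<^sub>R w) has_derivative (\<lambda>h. h *\<^sub>R w)) (at t)"
    by (auto intro!: derivative_eq_intros)
  from has_derivative_compose[OF this assms]
  have "((\<lambda>t. f (a + t *\<^sub>R w)) has_derivative (\<lambda>h. f' (h *\<^sub>R w))) (at t)" .
  moreover have "f' (h *\<^sub>R w) = f' w * h" for h
    using linear_simps(5)[OF has_derivative_bounded_linear[OF assms]] by simp
  ultimately show ?thesis by (simp add: has_field_derivative_def mult_commute_abs)
qed

lemma second_derivative_line:
  fixes f :: "'a::real_normed_vector \<Rightarrow> real"
  assumes "open U" "a \<in> U" "\<And>n. Ck_on n U f"
  shows "second_derivative f a w = deriv (deriv (\<lambda>t. f (a + t *\<^sub>R w))) 0"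
proof -
  define g where "g = (\<lambda>t. frechet_derivative f (at (a + t *\<^sub>R w)) w)"
  have "continuous_on UNIV (\<lambda>t::real. a + t *\<^sub>R w)" by (intro continuous_intros)
  then have "open ((\<lambda>t::real. a + t *\<^sub>R w) -` U)" using assms(1) open_vimage by blast
  moreover have "0 \<in> (\<lambda>t::real. a + t *\<^sub>R w) -` U" using assms(2) by simp
  ultimately have "\<forall>\<^sub>F t in nhds (0::real). a + t *\<^sub>R w \<in> U"
    using eventually_nhds_in_open by fastforce
  then have g: "\<forall>\<^sub>F t in nhds 0. ((\<lambda>t. f (a + t *\<^sub>R w)) has_real_derivative g t) (at t)"
    unfolding g_def
    by eventually_elim (rule line_derivative[OF Ck_on_has_derivative[OF assms(3)[of "Suc 0"]]])
  then have ev: "\<forall>\<^sub>F t in nhds 0. deriv (\<lambda>t. f (a + t *\<^sub>R w)) t = g t"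
    by eventually_elim (rule DERIV_imp_deriv)
  have "((\<lambda>x. frechet_derivative f (at x) w) has_derivative
      frechet_derivative (\<lambda>x. frechet_derivative f (at x) w) (at a)) (at (a + 0 *\<^sub>R w))"
    using Ck_on_has_derivative[OF Ck_on_frechet[OF assms(3)[of "Suc (Suc 0)"]] assms(2)] by simp
  from line_derivative[OF this]
  have "(g has_real_derivative second_derivative f a w) (at 0)"
    by (simp add: second_derivative_def g_def)
  then have "deriv g 0 = second_derivative f a w" by (rule DERIV_imp_deriv)
  then show ?thesis using deriv_cong_ev[OF ev refl] by simp
qed

lemma second_derivative_eqI:
  fixes f :: "'a::real_normed_vector \<Rightarrow> real"
  assumes "open U" "a \<in> U" "\<And>n. Ck_on n U f"
    and "\<forall>\<^sub>F t in nhds 0. ((\<lambda>t. f (a + t *\<^sub>R w)) has_real_derivative g t) (at t)"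
    and "(g has_real_derivative D) (at 0)"
  shows "second_derivative f a w = D"
proof -
  have "\<forall>\<^sub>F t in nhds 0. deriv (\<lambda>t. f (a + t *\<^sub>R w)) t = g t"
    using assms(4) by eventually_elim (rule DERIV_imp_deriv)
  then show ?thesis
    using second_derivative_line[OF assms(1-3)] deriv_cong_ev[OF _ refl] DERIV_imp_deriv[OF assms(5)]
    by metis
qed

lemma second_derivative_scaleR:
  fixes f :: "'a::real_normed_vector \<Rightarrow> real"
  assumes "open U" "a \<in> U" "\<And>n. Ck_on n U f"
  shows "second_derivative f a (c *\<^sub>R w) = c\<^sup>2 * second_derivative f a w"
proof -
  let ?D = "\<lambda>x. frechet_derivative f (at x) w"
  have D: "(?D has_derivative frechet_derivative ?D (at a)) (at a)"
    using Ck_on_has_derivative[OF Ck_on_frechet[OF assms(3)[of "Suc (Suc 0)"]] assms(2)] .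
  have "((\<lambda>x. c * ?D x) has_derivative (\<lambda>v. c * frechet_derivative ?D (at a) v)) (at a)"
    by (intro has_derivative_mult_right D)
  moreover have "c * ?D x = frechet_derivative f (at x) (c *\<^sub>R w)" if "x \<in> U" for x
    using linear_simps(5)[OF has_derivative_bounded_linear[OF Ck_on_has_derivative[OF assms(3)[of "Suc 0"] that]]]
    by simp
  ultimately have "((\<lambda>x. frechet_derivative f (at x) (c *\<^sub>R w)) has_derivative
      (\<lambda>v. c * frechet_derivative ?D (at a) v)) (at a)"
    using has_derivative_transform_within_open[OF _ assms(1,2)] by (metis (no_types, lifting))
  from fun_cong[OF frechet_derivative_at[OF this], of "c *\<^sub>R w"] show ?thesis
    using linear_simps(5)[OF has_derivative_bounded_linear[OF D]]
    by (simp add: second_derivative_def power2_eq_square)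
qed

lemma second_derivative_cong:
  fixes f g :: "'a::real_normed_vector \<Rightarrow> real"
  assumes "open U" "a \<in> U" "\<And>x. x \<in> U \<Longrightarrow> f x = g x"
  shows "second_derivative f a w = second_derivative g a w"
proof -
  have *: "frechet_derivative f (at x) = frechet_derivative g (at x)"
    if "x \<in> U" "\<And>x. x \<in> U \<Longrightarrow> f x = g x" for f g :: "'a \<Rightarrow> real" and x
  proof -
    have "(f has_derivative D) (at x) \<longleftrightarrow> (g has_derivative D) (at x)" for D
      using has_derivative_transform_within_open[OF _ assms(1) that(1)] that(2)
      by (metis (no_types, lifting))
    then show ?thesis by (simp add: frechet_derivative_def)
  qed
  show ?thesis
    unfolding second_derivative_def by (subst *[OF assms(2)]) (auto simp: *[OF _ assms(3)])
qed

text \<open>Agreement on the lines is enough, and the functions may live on different spaces. This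
  serves to pull back along affine maps and to compare functions of (e, s, x) that agree only for
  the given value of e.\<close>

lemma second_derivative_same_line:
  fixes f :: "'a::real_normed_vector \<Rightarrow> real" and g :: "'b::real_normed_vector \<Rightarrow> real"
  assumes "open U" "a \<in> U" "\<And>n. Ck_on n U f" "open V" "b \<in> V" "\<And>n. Ck_on n V g"
    and "\<And>t. f (a + t *\<^sub>R w) = g (b + t *\<^sub>R v)"
  shows "second_derivative f a w = second_derivative g b v"
  by (simp add: second_derivative_line[OF assms(1-3)] second_derivative_line[OF assms(4-6)] assms(7))

lemma second_derivative_add_cmult:
  fixes f g :: "'a::real_normed_vector \<Rightarrow> real"
  assumes "open U" "a \<in> U" "\<And>n. Ck_on n U f" "\<And>n. Ck_on n U g"
  shows "second_derivative (\<lambda>x. f x + c * g x) a w = second_derivative f a w + c * second_derivative g a w"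
proof -
  let ?Df = "\<lambda>x. frechet_derivative f (at x) w" and ?Dg = "\<lambda>x. frechet_derivative g (at x) w"
  have eq: "?Df x + c * ?Dg x = frechet_derivative (\<lambda>x. f x + c * g x) (at x) w" if "x \<in> U" for x
  proof -
    have "((\<lambda>x. f x + c * g x) has_derivative
      (\<lambda>v. frechet_derivative f (at x) v + c * frechet_derivative g (at x) v)) (at x)"
      by (intro has_derivative_add has_derivative_mult_right
          Ck_on_has_derivative[OF assms(3)[of "Suc 0"] that] Ck_on_has_derivative[OF assms(4)[of "Suc 0"] that])
    from fun_cong[OF frechet_derivative_at[OF this], of w] show ?thesis .
  qed
  have "((\<lambda>x. ?Df x + c * ?Dg x) has_derivative
      (\<lambda>v. frechet_derivative ?Df (at a) v + c * frechet_derivative ?Dg (at a) v)) (at a)"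
    by (intro has_derivative_add has_derivative_mult_right
          Ck_on_has_derivative[OF Ck_on_frechet[OF assms(3)[of "Suc (Suc 0)"]] assms(2)]
          Ck_on_has_derivative[OF Ck_on_frechet[OF assms(4)[of "Suc (Suc 0)"]] assms(2)])
  then have "((\<lambda>x. frechet_derivative (\<lambda>x. f x + c * g x) (at x) w) has_derivative
      (\<lambda>v. frechet_derivative ?Df (at a) v + c * frechet_derivative ?Dg (at a) v)) (at a)"
    by (rule has_derivative_transform_within_open[OF _ assms(1,2)]) (rule eq)
  from fun_cong[OF frechet_derivative_at[OF this], of w] show ?thesis
    by (simp add: second_derivative_def)
qed

lemma second_derivative_cmult:
  fixes f :: "'a::real_normed_vector \<Rightarrow> real"
  assumes "open U" "a \<in> U" "\<And>n. Ck_on n U f"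
  shows "second_derivative (\<lambda>x. c * f x) a w = c * second_derivative f a w"
  using second_derivative_add_cmult[OF assms(1,2) Ck_on_const[OF assms(1), of _ 0] assms(3)]
  by (simp add: second_derivative_def)

text \<open>In a basis this is a quadratic form in \<open>w\<close> whose coefficients are second
  partial derivatives, continuous in \<open>a\<close>. The compactness arguments rely on continuity
  in both variables jointly.\<close>

lemma continuous_on_second_derivative:
  fixes f :: "'a::euclidean_space \<Rightarrow> real"
  assumes "open U" "\<And>n. Ck_on n U f"
  shows "continuous_on (U \<times> UNIV) (\<lambda>(a, w). second_derivative f a w)"
proof -
  let ?D = "\<lambda>c x. frechet_derivative f (at x) c"
  have expand: "second_derivative f a w =
      (\<Sum>c\<in>Basis. \<Sum>b\<in>Basis. (w \<bullet> c) * ((w \<bullet> b) * frechet_derivative (?D c) (at a) b))"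
    if "a \<in> U" for a w
  proof -
    have lin: "?D w x = (\<Sum>c\<in>Basis. (w \<bullet> c) * ?D c x)" if "x \<in> U" for x
    proof -
      have "linear (frechet_derivative f (at x))"
        using Ck_on_has_derivative[OF assms(2)[of "Suc 0"] that] has_derivative_linear by blast
      from Linear_Algebra.linear_componentwise[OF this, where x=w and j=1] show ?thesis by simp
    qed
    have D2: "(?D c has_derivative frechet_derivative (?D c) (at a)) (at a)" for c
      using Ck_on_has_derivative[OF Ck_on_frechet[OF assms(2)[of "Suc (Suc 0)"]] that] .
    have "((\<lambda>x. \<Sum>c\<in>Basis. (w \<bullet> c) * ?D c x) has_derivative
        (\<lambda>v. \<Sum>c\<in>Basis. (w \<bullet> c) * frechet_derivative (?D c) (at a) v)) (at a)"
      by (intro has_derivative_sum has_derivative_mult_right D2)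
    then have "(?D w has_derivative
        (\<lambda>v. \<Sum>c\<in>Basis. (w \<bullet> c) * frechet_derivative (?D c) (at a) v)) (at a)"
      by (rule has_derivative_transform_within_open[OF _ assms(1) that]) (simp add: lin)
    from fun_cong[OF frechet_derivative_at[OF this], of w]
    have "second_derivative f a w = (\<Sum>c\<in>Basis. (w \<bullet> c) * frechet_derivative (?D c) (at a) w)"
      by (simp add: second_derivative_def)
    moreover have "frechet_derivative (?D c) (at a) w =
        (\<Sum>b\<in>Basis. (w \<bullet> b) * frechet_derivative (?D c) (at a) b)" for c
      using Linear_Algebra.linear_componentwise[OF has_derivative_linear[OF D2], where x=w and j=1] by simp
    ultimately show ?thesis by (simp add: sum_distrib_left)
  qed
  have c: "continuous_on (U \<times> (UNIV::'a set)) (\<lambda>z. frechet_derivative (?D c) (at (fst z)) b)" for c b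
    using Ck_on_imp_continuous_on[OF Ck_on_frechet[OF Ck_on_frechet[OF assms(2)[of "Suc (Suc 0)"]]], of c b]
    by (rule continuous_on_compose2) (auto intro!: continuous_intros)
  have "continuous_on (U \<times> UNIV) (\<lambda>z. \<Sum>c\<in>Basis. \<Sum>b\<in>Basis.
      (snd z \<bullet> c) * ((snd z \<bullet> b) * frechet_derivative (?D c) (at (fst z)) b))"
    by (intro continuous_intros c)
  then show ?thesis
    by (rule continuous_on_cong[THEN iffD1, rotated -1]) (auto simp: expand)
qed

text \<open>On the compact set where \<open>F \<le> 0\<close> the penalty \<open>w\<close> has a
  positive minimum \<open>m\<close>, so a large multiple of it outweighs the lower bound of
  \<open>F\<close>; elsewhere \<open>F\<close> itself is positive. The penalty is |s|^2 in the
  choice of \<open>W\<close>, and e + |\<xi>|^2 in the choice of \<open>e\<close>.\<close>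

lemma compact_penalty:
  fixes F w :: "'a::t2_space \<Rightarrow> real"
  assumes C: "compact C" and F: "continuous_on C F" and w: "continuous_on C w"
    and "\<And>c. c \<in> C \<Longrightarrow> w c \<ge> 0" "\<And>c. c \<in> C \<Longrightarrow> w c = 0 \<Longrightarrow> F c > 0"
  obtains M \<eta> where "M \<ge> 0" "\<eta> > 0" "\<And>c. c \<in> C \<Longrightarrow> F c + M * w c \<ge> \<eta>"
proof -
  define N where "N = C \<inter> F -` {..0}"
  have pos: "\<exists>m>0. \<forall>c\<in>A. f c \<ge> m" if "compact A" "continuous_on A f" "\<And>c. c \<in> A \<Longrightarrow> f c > 0"
    for A and f :: "'a \<Rightarrow> real"
  proof (cases "A = {}")
    case True
    then show ?thesis using zero_less_one by blast
  next
    case False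
    from continuous_attains_inf[OF that(1) this that(2)] that(3) show ?thesis by blast
  qed
  have "compact (F ` C)" using compact_continuous_image F C by blast
  then obtain L where L: "\<And>c. c \<in> C \<Longrightarrow> \<bar>F c\<bar> \<le> L"
    using compact_imp_bounded bounded_iff by (metis image_eqI real_norm_def)
  have "compact N"
    using continuous_closed_preimage[OF F compact_imp_closed[OF C] closed_atMost]
      compact_Int_closed[OF C] by (metis N_def inf.left_idem)
  moreover have "continuous_on N w" using w continuous_on_subset N_def by blast
  moreover have "w c > 0" if "c \<in> N" for c
    using assms(4,5)[of c] that unfolding N_def by force
  ultimately obtain m where m: "m > 0" "\<And>c. c \<in> N \<Longrightarrow> w c \<ge> m"
    using pos[of N w] by blast
  define M where "M = (\<bar>L\<bar> + 1) / m"
  have M: "M \<ge> 0" using m by (simp add: M_def)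
  have "F c + M * w c > 0" if "c \<in> C" for c
  proof (cases "c \<in> N")
    case True
    have "M * w c \<ge> M * m" using m(2)[OF True] M by (intro mult_left_mono)
    moreover have "M * m = \<bar>L\<bar> + 1" using m by (simp add: M_def)
    ultimately show ?thesis using L[OF that] by linarith
  next
    case False
    then have "F c > 0" using that by (auto simp: N_def)
    then show ?thesis using M assms(4)[OF that] by (simp add: add_pos_nonneg)
  qed
  moreover have "continuous_on C (\<lambda>c. F c + M * w c)" by (intro continuous_intros F w)
  ultimately obtain \<eta> where "\<eta> > 0" "\<forall>c\<in>C. F c + M * w c \<ge> \<eta>" using pos[OF C, of "\<lambda>c. F c + M * w c"] by blast
  with M that show ?thesis by blast
qed

section \<open>The family of dual metrics\<close>

text \<open>The cutoff \<open>\<eta>\<close> is evaluated at |s|^2. It is constant for |s| \<le>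
  1/2, where all fibers are to lie in one orbit of the linear group, and zero for |s|^2 \<ge> 1/2,
  in particular for |s| \<ge> 3/4, where the dual metric is to be hermitian.\<close>

locale twisted_family =
  fixes j :: "'m::finite" and p q :: "'r::finite" and \<eta> :: "real \<Rightarrow> real"
  assumes pq: "p \<noteq> q"
    and smooth_\<eta>: "\<And>n. Ck_on n UNIV \<eta>"
    and plateau: "\<And>u. u \<le> 1/4 \<Longrightarrow> \<eta> u = 1/4"
    and vanish: "\<And>u. u \<ge> 1/2 \<Longrightarrow> \<eta> u = 0"
begin

text \<open>The constant \<open>11/10\<close> makes \<open>mu W q\<close> slightly concave in the direction of \<open>s $ j\<close>, which is what
  destroys semipositivity; \<open>origin_poly_pos\<close> is the inequality that allows it.\<close>

definition mu :: "real \<Rightarrow> 'r \<Rightarrow> complex ^ 'm \<Rightarrow> real" where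
  "mu W i s = s \<bullet> s + W * (s \<bullet> s)\<^sup>2 - (if i = q then 11/10 else 0) * (s $ j \<bullet> s $ j)"

definition wt :: "real \<Rightarrow> real \<Rightarrow> 'r \<Rightarrow> complex ^ 'm \<Rightarrow> real" where
  "wt W e i s = 1 + e * mu W i s"

definition herm :: "real \<Rightarrow> real \<Rightarrow> complex ^ 'm \<Rightarrow> complex ^ 'r \<Rightarrow> real" where
  "herm W e s x = (\<Sum>i\<in>UNIV. (wt W e i s)\<^sup>2 * (x $ i \<bullet> x $ i))"

text \<open>With \<open>y\<close> the vector with coordinates \<open>wt W e i s *\<^sub>R x $ i\<close>, rotated by the angle \<open>Im (s $ j)\<close> in the
  \<open>p\<close>, \<open>q\<close> plane, this is \<open>|y\<^sub>p|\<^sup>2 - |y\<^sub>q|\<^sup>2\<close>.\<close>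

definition twist :: "real \<Rightarrow> real \<Rightarrow> complex ^ 'm \<Rightarrow> complex ^ 'r \<Rightarrow> real" where
  "twist W e s x = cos (2 * Im (s $ j)) * ((wt W e p s)\<^sup>2 * (x $ p \<bullet> x $ p) - (wt W e q s)\<^sup>2 * (x $ q \<bullet> x $ q))
     - sin (2 * Im (s $ j)) * (2 * (wt W e p s * wt W e q s * (x $ p \<bullet> x $ q)))"

text \<open>The quotient of \<open>dualfn W e s x\<close> - |x|^2 by e, expanded so that it makes
  sense at e = 0 too, where it is the derivative of \<open>dualfn\<close> in e.\<close>

definition pert :: "real \<Rightarrow> real \<Rightarrow> complex ^ 'm \<Rightarrow> complex ^ 'r \<Rightarrow> real" where
  "pert W e s x = (\<Sum>i\<in>UNIV. (2 * mu W i s + e * (mu W i s)\<^sup>2) * (x $ i \<bullet> x $ i))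
     - \<eta> (s \<bullet> s) * ((twist W e s x)\<^sup>2 * inverse (herm W e s x))"

text \<open>While \<open>herm\<close> alone would be a hermitian dual metric, the correction has the
  same homogeneity in x without being quadratic.\<close>

definition dualfn :: "real \<Rightarrow> real \<Rightarrow> complex ^ 'm \<Rightarrow> complex ^ 'r \<Rightarrow> real" where
  "dualfn W e s x = herm W e s x - e * (\<eta> (s \<bullet> s) * ((twist W e s x)\<^sup>2 * inverse (herm W e s x)))"

lemma dualfn_eq_pert: "dualfn W e s x = x \<bullet> x + e * pert W e s x"
proof -
  have "(wt W e i s)\<^sup>2 * (x $ i \<bullet> x $ i) =
     x $ i \<bullet> x $ i + e * ((2 * mu W i s + e * (mu W i s)\<^sup>2) * (x $ i \<bullet> x $ i))" for i
    by (simp add: wt_def power2_eq_square algebra_simps)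
  then show ?thesis
    by (simp add: dualfn_def pert_def herm_def sum.distrib sum_distrib_left inner_vec_def right_diff_distrib)
qed

text \<open>On the closed unit ball \<open>mu\<close> is at least -1, so \<open>e \<le> 1/2\<close>
  keeps the weights at least 1/2.\<close>

lemma wt_pos:
  assumes "W \<ge> 0" "0 \<le> e" "e \<le> 1/2" "norm s \<le> 1"
  shows "wt W e i s > 0"
proof -
  have "norm (s $ j) \<le> norm s" by (rule Finite_Cartesian_Product.norm_nth_le)
  then have j: "s $ j \<bullet> s $ j \<le> s \<bullet> s" by (simp add: norm_le)
  have s: "s \<bullet> s \<le> 1" using assms(4) by (simp add: norm_le_square[of _ 1, simplified] dot_square_norm power_le_one)
  have "(if i = q then 11/10 else 0) * (s $ j \<bullet> s $ j) \<le> 11/10 * (s $ j \<bullet> s $ j)" by simp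
  moreover have "W * (s \<bullet> s)\<^sup>2 \<ge> 0" using assms(1) by simp
  ultimately have "mu W i s \<ge> - 1" using j s unfolding mu_def by linarith
  then have "e * mu W i s \<ge> e * (-1)" using assms(2) by (intro mult_left_mono)
  then show ?thesis using assms(3) by (simp add: wt_def)
qed

lemma herm_pos:
  assumes "\<And>i. wt W e i s \<noteq> 0" "x \<noteq> 0" shows "herm W e s x > 0"
proof -
  obtain k where "x $ k \<noteq> 0" using assms(2) by (metis vec_eq_iff zero_index)
  then have "(wt W e k s)\<^sup>2 * (x $ k \<bullet> x $ k) > 0" using assms(1)[of k] by simp
  also have "(wt W e k s)\<^sup>2 * (x $ k \<bullet> x $ k) \<le> herm W e s x"
    unfolding herm_def by (rule member_le_sum) auto
  finally show ?thesis .
qed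

section \<open>Smoothness jointly in (e, s, x)\<close>

lemma Ck_on_s: "Ck_on n UNIV (\<lambda>z::real \<times> (complex ^ 'm) \<times> (complex ^ 'r). fst (snd z))"
  by (intro Ck_on_bounded_linear open_UNIV bounded_linear_compose[OF bounded_linear_fst bounded_linear_snd])

lemma Ck_on_sj: "Ck_on n UNIV (\<lambda>z::real \<times> (complex ^ 'm) \<times> (complex ^ 'r). fst (snd z) $ i)"
  by (intro Ck_on_bounded_linear open_UNIV bounded_linear_compose[OF bounded_linear_vec_nth]
      bounded_linear_compose[OF bounded_linear_fst bounded_linear_snd])

lemma Ck_on_xi: "Ck_on n UNIV (\<lambda>z::real \<times> (complex ^ 'm) \<times> (complex ^ 'r). snd (snd z) $ i)"
  by (intro Ck_on_bounded_linear open_UNIV bounded_linear_compose[OF bounded_linear_vec_nth]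
      bounded_linear_compose[OF bounded_linear_snd bounded_linear_snd])

lemma Ck_on_e: "Ck_on n UNIV (\<lambda>z::real \<times> (complex ^ 'm) \<times> (complex ^ 'r). fst z)"
  by (intro Ck_on_bounded_linear open_UNIV bounded_linear_fst)

lemma Ck_on_mu: "Ck_on n UNIV (\<lambda>z::real \<times> (complex ^ 'm) \<times> (complex ^ 'r). mu W i (fst (snd z)))"
  unfolding mu_def
  by (intro Ck_on_add Ck_on_diff Ck_on_mult Ck_on_power Ck_on_const Ck_on_inner Ck_on_s Ck_on_sj open_UNIV)

lemma Ck_on_wt: "Ck_on n UNIV (\<lambda>z::real \<times> (complex ^ 'm) \<times> (complex ^ 'r). wt W (fst z) i (fst (snd z)))"
  unfolding wt_def by (intro Ck_on_add Ck_on_mult Ck_on_const Ck_on_mu Ck_on_e open_UNIV)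

lemma Ck_on_herm: "Ck_on n UNIV (\<lambda>z. herm W (fst z) (fst (snd z)) (snd (snd z)))"
  unfolding herm_def
  by (intro Ck_on_sum Ck_on_mult Ck_on_power Ck_on_inner Ck_on_wt Ck_on_xi open_UNIV)

lemma Ck_on_twist: "Ck_on n UNIV (\<lambda>z. twist W (fst z) (fst (snd z)) (snd (snd z)))"
proof -
  have Im: "Ck_on n UNIV (\<lambda>z::real \<times> (complex ^ 'm) \<times> (complex ^ 'r). 2 * Im (fst (snd z) $ j))" for n
    by (intro Ck_on_mult Ck_on_const Ck_on_bounded_linear open_UNIV bounded_linear_compose[OF bounded_linear_Im]
       bounded_linear_compose[OF bounded_linear_vec_nth]
      bounded_linear_compose[OF bounded_linear_fst bounded_linear_snd])
  show ?thesis
    unfolding twist_def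
    by (intro Ck_on_diff Ck_on_mult Ck_on_power Ck_on_inner Ck_on_wt Ck_on_xi Ck_on_const
        Ck_on_sin_cos Im open_UNIV)
qed

text \<open>The parameter e is one of the variables, and its value 0 is an interior one. This makes
  Levi forms continuous down to e = 0, so that positivity there carries over to small positive
  e.\<close>

definition dom :: "real \<Rightarrow> (real \<times> (complex ^ 'm) \<times> (complex ^ 'r)) set" where
  "dom W = {z. herm W (fst z) (fst (snd z)) (snd (snd z)) > 0}"

lemma open_dom: "open (dom W)"
  unfolding dom_def
  by (intro open_Collect_less continuous_on_const Ck_on_imp_continuous_on[OF Ck_on_herm])

lemma Ck_on_pert: "Ck_on n (dom W) (\<lambda>z. pert W (fst z) (fst (snd z)) (snd (snd z)))"
proof -
  have sub: "Ck_on n UNIV f \<Longrightarrow> Ck_on n (dom W) f" for n and f :: "real \<times> (complex ^ 'm) \<times> (complex ^ 'r) \<Rightarrow> real"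
    by (erule Ck_on_subset) simp
  have \<eta>: "Ck_on n UNIV (\<lambda>z::real \<times> (complex ^ 'm) \<times> (complex ^ 'r). \<eta> (fst (snd z) \<bullet> fst (snd z)))"
    by (rule Ck_on_compose_UNIV[OF open_UNIV smooth_\<eta>]) (intro Ck_on_inner Ck_on_s open_UNIV)
  have S: "Ck_on n UNIV (\<lambda>z::real \<times> (complex ^ 'm) \<times> (complex ^ 'r). \<Sum>i\<in>UNIV. (2 * mu W i (fst (snd z)) +
      fst z * (mu W i (fst (snd z)))\<^sup>2) * (snd (snd z) $ i \<bullet> snd (snd z) $ i))"
    by (intro Ck_on_sum Ck_on_mult Ck_on_add Ck_on_power Ck_on_inner Ck_on_mu Ck_on_xi Ck_on_e Ck_on_const open_UNIV)
  have I: "Ck_on n (dom W) (\<lambda>z. inverse (herm W (fst z) (fst (snd z)) (snd (snd z))))"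
    by (intro Ck_on_inverse open_dom sub Ck_on_herm) (auto simp: dom_def)
  show ?thesis
    unfolding pert_def
    by (intro Ck_on_diff Ck_on_mult open_dom sub[OF S] sub[OF \<eta>] I Ck_on_power sub[OF Ck_on_twist])
qed

lemma dom_memI:
  assumes "W \<ge> 0" "0 \<le> e" "e \<le> 1/2" "norm s \<le> 1" "x \<noteq> 0" shows "(e, s, x) \<in> dom W"
  using herm_pos wt_pos[OF assms(1-4)] assms(5) by (simp add: dom_def less_imp_neq[symmetric])

section \<open>The Levi form of the perturbation\<close>

definition pertT :: "real \<Rightarrow> real \<times> (complex ^ 'm) \<times> (complex ^ 'r) \<Rightarrow> real" where
  "pertT W = (\<lambda>z. pert W (fst z) (fst (snd z)) (snd (snd z)))"

lemma Ck_on_pertT: "Ck_on n (dom W) (pertT W)"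
  unfolding pertT_def by (rule Ck_on_pert)

text \<open>The Levi form in the complex variables (s, x), with e frozen: directions have first
  component 0.\<close>

definition levi_pert ::
  "real \<Rightarrow> real \<times> (complex ^ 'm) \<times> (complex ^ 'r) \<Rightarrow> complex ^ 'm \<Rightarrow> complex ^ 'r \<Rightarrow> real" where
  "levi_pert W z \<sigma> \<xi> = (second_derivative (pertT W) z (0, \<sigma>, \<xi>) +
     second_derivative (pertT W) z (0, \<i> *s \<sigma>, \<i> *s \<xi>)) / 4"

text \<open>For e = 0 all weights are 1, so \<open>herm\<close> is |x|^2 = 1, and along t\<sigma>
  the twist is cos(2bt) z - sin(2bt) X. The last summand is the contribution of rotating the
  non-quadratic part; near the q axis it is the positive term that compensates for the coefficient
  11/10.\<close>

lemma second_derivative_pert_origin: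
  assumes "norm x = 1"
  shows "second_derivative (pertT 0) (0, 0, x) (0, \<sigma>, 0) =
    4 * (\<sigma> \<bullet> \<sigma> - 11/10 * (\<sigma> $ j \<bullet> \<sigma> $ j) * (x $ q \<bullet> x $ q)) +
    2 * (Im (\<sigma> $ j))\<^sup>2 * ((x $ p \<bullet> x $ p - x $ q \<bullet> x $ q)\<^sup>2 - (2 * (x $ p \<bullet> x $ q))\<^sup>2)"
proof (rule second_derivative_eqI[OF open_dom _ Ck_on_pertT])
  have xx: "x \<bullet> x = 1" using assms by (simp add: dot_square_norm)
  show "(0, 0, x) \<in> dom 0" using assms by (intro dom_memI) auto
  define b where "b = Im (\<sigma> $ j)"
  define z where "z = x $ p \<bullet> x $ p - x $ q \<bullet> x $ q"
  define X where "X = 2 * (x $ p \<bullet> x $ q)"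
  define S where "S = \<sigma> \<bullet> \<sigma> - 11/10 * (\<sigma> $ j \<bullet> \<sigma> $ j) * (x $ q \<bullet> x $ q)"
  define g where "g t = 4 * t * S - (cos (2*b*t) * z - sin (2*b*t) * X) / 2
     * (- 2 * b * sin (2*b*t) * z - 2 * b * cos (2*b*t) * X)" for t
  have eq: "pertT 0 ((0, 0, x) + t *\<^sub>R (0, \<sigma>, 0)) =
      2 * t\<^sup>2 * S - 1/4 * (cos (2*b*t) * z - sin (2*b*t) * X)\<^sup>2" if "t\<^sup>2 * (\<sigma> \<bullet> \<sigma>) \<le> 1/4" for t
  proof -
    have h: "herm 0 0 (t *\<^sub>R \<sigma>) x = 1" using xx by (simp add: herm_def wt_def inner_vec_def)
    have tw: "twist 0 0 (t *\<^sub>R \<sigma>) x = cos (2*b*t) * z - sin (2*b*t) * X"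
      by (simp add: twist_def wt_def z_def X_def b_def mult_ac)
    have "(\<Sum>i\<in>UNIV. 2 * mu 0 i (t *\<^sub>R \<sigma>) * (x $ i \<bullet> x $ i)) =
       (\<Sum>i\<in>UNIV. 2 * t\<^sup>2 * (\<sigma> \<bullet> \<sigma>) * (x $ i \<bullet> x $ i)) -
       (\<Sum>i\<in>UNIV. if i = q then 2 * t\<^sup>2 * (11/10 * (\<sigma> $ j \<bullet> \<sigma> $ j)) * (x $ i \<bullet> x $ i) else 0)"
      unfolding sum_subtractf[symmetric]
      by (intro sum.cong) (auto simp: mu_def power2_eq_square algebra_simps)
    also have "\<dots> = 2 * t\<^sup>2 * S"
      using xx by (simp add: S_def inner_vec_def[of x x] sum_distrib_left[symmetric] right_diff_distrib)
    finally have S: "(\<Sum>i\<in>UNIV. 2 * mu 0 i (t *\<^sub>R \<sigma>) * (x $ i \<bullet> x $ i)) = 2 * t\<^sup>2 * S" .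
    have "\<eta> ((t *\<^sub>R \<sigma>) \<bullet> (t *\<^sub>R \<sigma>)) = 1/4"
      using that by (intro plateau) (simp add: power2_eq_square mult.assoc)
    then show ?thesis by (simp add: pertT_def pert_def h tw S del: inner_scaleR_left inner_scaleR_right)
  qed
  have "((\<lambda>t. t\<^sup>2 * (\<sigma> \<bullet> \<sigma>)) \<longlongrightarrow> 0\<^sup>2 * (\<sigma> \<bullet> \<sigma>)) (nhds (0::real))"
    by (intro tendsto_intros filterlim_ident)
  then have "\<forall>\<^sub>F t in nhds (0::real). t\<^sup>2 * (\<sigma> \<bullet> \<sigma>) < 1/4"
    by (rule order_tendstoD) simp
  \<comment> \<open>The derivative at t can be transferred only if the formula holds in a
    neighbourhood of t, hence the nested filter.\<close>
  then have "\<forall>\<^sub>F t in nhds (0::real). \<forall>\<^sub>F t in nhds t. t\<^sup>2 * (\<sigma> \<bullet> \<sigma>) < 1/4"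
    by (simp add: eventually_eventually)
  then show "\<forall>\<^sub>F t in nhds 0. ((\<lambda>t. pertT 0 ((0, 0, x) + t *\<^sub>R (0, \<sigma>, 0))) has_real_derivative g t) (at t)"
  proof eventually_elim
    case (elim t)
    then have ev: "\<forall>\<^sub>F t in nhds t. pertT 0 ((0, 0, x) + t *\<^sub>R (0, \<sigma>, 0)) =
      2 * t\<^sup>2 * S - 1/4 * (cos (2*b*t) * z - sin (2*b*t) * X)\<^sup>2"
      by eventually_elim (rule eq, simp)
    have "((\<lambda>t. 2 * t\<^sup>2 * S - 1/4 * (cos (2*b*t) * z - sin (2*b*t) * X)\<^sup>2) has_real_derivative g t) (at t)"
      unfolding g_def by (auto intro!: derivative_eq_intros simp: field_simps power2_eq_square)
    then show ?case using DERIV_cong_ev[OF refl ev refl] by simp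
  qed
  show "(g has_real_derivative 4 * (\<sigma> \<bullet> \<sigma> - 11/10 * (\<sigma> $ j \<bullet> \<sigma> $ j) * (x $ q \<bullet> x $ q)) +
    2 * (Im (\<sigma> $ j))\<^sup>2 * ((x $ p \<bullet> x $ p - x $ q \<bullet> x $ q)\<^sup>2 - (2 * (x $ p \<bullet> x $ q))\<^sup>2)) (at 0)"
    unfolding g_def S_def[symmetric] b_def[symmetric] z_def[symmetric] X_def[symmetric]
    by (auto intro!: derivative_eq_intros simp: field_simps power2_eq_square)
qed


text \<open>Here u and v stand for |x_p|^2 and |x_q|^2. For small v completing the square in u
  suffices; for \<open>v > 1/4\<close> the expression is at least its value at the end point u = 1 -
  v.\<close>

lemma origin_poly_pos:
  fixes u v :: real
  assumes "u \<ge> 0" "v \<ge> 0" "u + v \<le> 1"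
  shows "2 - 11/5 * v + (u\<^sup>2 - 6 * u * v + v\<^sup>2) / 2 > 0"
proof (cases "v \<le> 1/4")
  case True
  have "(u - 3 * v)\<^sup>2 \<ge> 0" by simp
  then have "u\<^sup>2 - 6 * u * v + v\<^sup>2 \<ge> - 8 * v\<^sup>2" by (simp add: power2_eq_square algebra_simps)
  moreover have "v\<^sup>2 \<le> (1/4)\<^sup>2" using True assms by (intro power_mono)
  then have "v\<^sup>2 \<le> 1/16" by (simp add: power2_eq_square)
  moreover define w where "w = u\<^sup>2 - 6 * u * v + v\<^sup>2"
  ultimately have "w \<ge> - (1/2)" by simp
  then show ?thesis unfolding w_def[symmetric] using True by simp
next
  case False
  \<comment> \<open>This product is the value at u minus the value at 1 - v. The latter is a
    quadratic in v with minimum 39/400, attained at v = 31/40.\<close>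
  have "((1 - v) - u) * (3 * v - (u + 1 - v) / 2) \<ge> 0"
    using assms False by (intro mult_nonneg_nonneg) auto
  moreover have "2 - 11/5 * v + (u\<^sup>2 - 6 * u * v + v\<^sup>2) / 2 =
     ((1 - v) - u) * (3 * v - (u + 1 - v) / 2) + 4 * (v - 31/40)\<^sup>2 + 39/400"
    by (simp add: power2_eq_square field_simps)
  moreover have "(v - 31/40)\<^sup>2 \<ge> 0" by simp
  ultimately show ?thesis by linarith
qed

lemma inner_i_smult: "(\<i> *s v) \<bullet> (\<i> *s v) = v \<bullet> (v :: complex ^ 'k::finite)"
  by (simp add: inner_vec_def inner_complex_def add.commute)

text \<open>Adding the directions \<sigma> and i\<sigma> turns the square of Im \<sigma>_j into N =
  |\<sigma>_j|^2. What remains is 2(|\<sigma>|^2 - N) plus N times a factor which, by Cauchy-Schwarz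
  for X, is bounded below by the polynomial of \<open>origin_poly_pos\<close>. One of the two terms
  is positive.\<close>

lemma levi_pert_origin_pos:
  assumes "norm x = 1" "\<sigma> \<noteq> 0"
  shows "levi_pert 0 (0, 0, x) \<sigma> 0 > 0"
proof -
  define u v X N where "u = x $ p \<bullet> x $ p" and "v = x $ q \<bullet> x $ q" and "X = 2 * (x $ p \<bullet> x $ q)"
    and "N = \<sigma> $ j \<bullet> \<sigma> $ j"
  have N: "N \<le> \<sigma> \<bullet> \<sigma>" "N \<ge> 0"
    using Finite_Cartesian_Product.norm_nth_le[of \<sigma> j] by (auto simp: N_def norm_le)
  have "u + v = (\<Sum>i\<in>{p, q}. x $ i \<bullet> x $ i)" using pq by (simp add: u_def v_def)
  also have "\<dots> \<le> x \<bullet> x" unfolding inner_vec_def by (rule sum_mono2) auto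
  finally have uv: "u + v \<le> 1" using assms by (simp add: dot_square_norm)
  have X: "X\<^sup>2 \<le> 4 * (u * v)"
    using Cauchy_Schwarz_ineq[of "x $ p" "x $ q"] by (simp add: X_def u_def v_def power_mult_distrib)
  have "levi_pert 0 (0, 0, x) \<sigma> 0 = 2 * (\<sigma> \<bullet> \<sigma> - 11/10 * N * v) +
      ((Im (\<sigma> $ j))\<^sup>2 + (Re (\<sigma> $ j))\<^sup>2) * ((u - v)\<^sup>2 - X\<^sup>2) / 2"
    by (simp add: levi_pert_def second_derivative_pert_origin[OF assms(1)] inner_i_smult
        u_def[symmetric] v_def[symmetric] X_def[symmetric])
      (simp add: N_def inner_complex_def field_simps)
  also have "(Im (\<sigma> $ j))\<^sup>2 + (Re (\<sigma> $ j))\<^sup>2 = N" by (simp add: N_def inner_complex_def power2_eq_square)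
  finally have L: "levi_pert 0 (0, 0, x) \<sigma> 0 =
      2 * (\<sigma> \<bullet> \<sigma> - N) + N * (2 - 11/5 * v + ((u - v)\<^sup>2 - X\<^sup>2) / 2)"
    by (simp add: field_simps)
  have "u\<^sup>2 - 6 * u * v + v\<^sup>2 \<le> (u - v)\<^sup>2 - X\<^sup>2"
    using X by (simp add: power2_eq_square algebra_simps)
  then have pos: "2 - 11/5 * v + ((u - v)\<^sup>2 - X\<^sup>2) / 2 > 0"
    using origin_poly_pos[OF _ _ uv] divide_right_mono[of _ _ "2::real"]
    by (fastforce simp: u_def v_def intro: less_le_trans add_left_mono)
  show ?thesis
  proof (cases "N = 0")
    case True
    then show ?thesis using L assms(2) by simp
  next
    case False
    then have "N * (2 - 11/5 * v + ((u - v)\<^sup>2 - X\<^sup>2) / 2) > 0" using N pos by simp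
    then show ?thesis unfolding L using N by (intro add_nonneg_pos) auto
  qed
qed

lemma continuous_on_levi_pert:
  "continuous_on (dom W \<times> UNIV \<times> UNIV) (\<lambda>(z, \<sigma>, \<xi>). levi_pert W z \<sigma> \<xi>)"
proof -
  let ?D = "dom W \<times> (UNIV :: ((complex ^ 'm) \<times> (complex ^ 'r)) set)"
  have c: "continuous_on (dom W \<times> UNIV) (\<lambda>y. second_derivative (pertT W) (fst y) (snd y))"
    using continuous_on_second_derivative[OF open_dom[of W] Ck_on_pertT] by (simp add: case_prod_unfold)
  have sc: "continuous_on ?D (\<lambda>y. \<i> *s f y)" if "continuous_on ?D f"
    for f :: "(real \<times> (complex ^ 'm) \<times> (complex ^ 'r)) \<times> (complex ^ 'm) \<times> (complex ^ 'r) \<Rightarrow> complex ^ 'k::finite"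
    unfolding vector_scalar_mult_def using that by (intro continuous_intros)
  have "continuous_on ?D (\<lambda>y. (fst y, (0::real, fst (snd y), snd (snd y))))"
    by (intro continuous_intros)
  from continuous_on_compose2[OF c this image_subsetI]
  have 1: "continuous_on ?D (\<lambda>y. second_derivative (pertT W) (fst y) (0, fst (snd y), snd (snd y)))"
    unfolding fst_conv snd_conv mem_Times_iff by (simp only: UNIV_I simp_thms)
  have "continuous_on ?D (\<lambda>y. (fst y, (0::real, \<i> *s fst (snd y), \<i> *s snd (snd y))))"
    by (intro continuous_intros sc)
  from continuous_on_compose2[OF c this image_subsetI]
  have 2: "continuous_on ?D (\<lambda>y. second_derivative (pertT W) (fst y) (0, \<i> *s fst (snd y), \<i> *s snd (snd y)))"
    unfolding fst_conv snd_conv mem_Times_iff by (simp only: UNIV_I simp_thms)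
  show ?thesis
    unfolding levi_pert_def case_prod_unfold UNIV_Times_UNIV by (intro continuous_intros 1 2) simp
qed

text \<open>At e = 0 the term W |s|^4 in \<open>mu\<close> adds 2W |s|^4 |x|^2 to
  \<open>pert\<close>. The Levi form of this is 4W |s|^2 |\<sigma>|^2 plus nonnegative squares,
  which are dropped.\<close>

lemma levi_pert_weight:
  assumes "W \<ge> 0" "norm s \<le> 1" "norm x = 1"
  shows "levi_pert W (0, s, x) \<sigma> 0 \<ge> levi_pert 0 (0, s, x) \<sigma> 0 + 4 * W * (s \<bullet> s) * (\<sigma> \<bullet> \<sigma>)"
proof -
  have xx: "x \<bullet> x = 1" and x0: "x \<noteq> 0" using assms(3) by (auto simp: dot_square_norm)
  define G :: "real \<times> (complex ^ 'm) \<times> (complex ^ 'r) \<Rightarrow> real"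
    where "G = (\<lambda>z. 2 * (fst (snd z) \<bullet> fst (snd z))\<^sup>2 * (\<Sum>i\<in>UNIV. snd (snd z) $ i \<bullet> snd (snd z) $ i))"
  have CG: "Ck_on n (dom 0) G" for n
    unfolding G_def
    by (rule Ck_on_subset[of _ UNIV])
      (intro Ck_on_mult Ck_on_power Ck_on_sum Ck_on_const Ck_on_inner Ck_on_s Ck_on_xi open_UNIV, simp)
  have d0: "(0, s, x) \<in> dom 0" and dW: "(0, s, x) \<in> dom W"
    using assms x0 by (auto intro!: dom_memI)
  have sd: "second_derivative (pertT W) (0, s, x) (0, \<tau>, 0) = second_derivative (pertT 0) (0, s, x) (0, \<tau>, 0)
      + W * (16 * (s \<bullet> \<tau>)\<^sup>2 + 8 * (s \<bullet> s) * (\<tau> \<bullet> \<tau>))" for \<tau>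
  proof -
    \<comment> \<open>The two sides need not agree where e is nonzero, so they are compared on this
      line only.\<close>
    have "pertT W ((0, s, x) + t *\<^sub>R (0, \<tau>, 0)) = pertT 0 ((0, s, x) + t *\<^sub>R (0, \<tau>, 0)) +
       W * G ((0, s, x) + t *\<^sub>R (0, \<tau>, 0))" for t
      by (simp add: pertT_def pert_def G_def herm_def twist_def wt_def mu_def sum_distrib_left
          sum.distrib[symmetric] algebra_simps)
    then have "second_derivative (pertT W) (0, s, x) (0, \<tau>, 0) =
        second_derivative (\<lambda>z. pertT 0 z + W * G z) (0, s, x) (0, \<tau>, 0)"
      by (intro second_derivative_same_line[OF open_dom dW Ck_on_pertT open_dom d0])
        (intro Ck_on_add Ck_on_mult Ck_on_const Ck_on_pertT CG open_dom)
    also have "\<dots> = second_derivative (pertT 0) (0, s, x) (0, \<tau>, 0) + W * second_derivative G (0, s, x) (0, \<tau>, 0)"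
      by (rule second_derivative_add_cmult[OF open_dom d0 Ck_on_pertT CG])
    also have "second_derivative G (0, s, x) (0, \<tau>, 0) = 16 * (s \<bullet> \<tau>)\<^sup>2 + 8 * (s \<bullet> s) * (\<tau> \<bullet> \<tau>)"
    proof (rule second_derivative_eqI[OF open_dom d0 CG])
      let ?Q = "\<lambda>t. s \<bullet> s + 2 * t * (s \<bullet> \<tau>) + t\<^sup>2 * (\<tau> \<bullet> \<tau>)"
      let ?Q' = "\<lambda>t. 2 * (s \<bullet> \<tau>) + 2 * t * (\<tau> \<bullet> \<tau>)"
      have "G ((0, s, x) + t *\<^sub>R (0, \<tau>, 0)) = 2 * (?Q t)\<^sup>2" for t
        using xx by (simp add: G_def inner_vec_def[of x x] inner_commute[of \<tau> s] inner_add_left inner_add_right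
            power2_eq_square algebra_simps)
      moreover have "((\<lambda>t. 2 * (?Q t)\<^sup>2) has_real_derivative 4 * ?Q t * ?Q' t) (at t)" for t
        by (auto intro!: derivative_eq_intros simp: algebra_simps)
      ultimately show "\<forall>\<^sub>F t in nhds 0. ((\<lambda>t. G ((0, s, x) + t *\<^sub>R (0, \<tau>, 0))) has_real_derivative
          4 * ?Q t * ?Q' t) (at t)" by simp
      show "((\<lambda>t. 4 * ?Q t * ?Q' t) has_real_derivative 16 * (s \<bullet> \<tau>)\<^sup>2 + 8 * (s \<bullet> s) * (\<tau> \<bullet> \<tau>)) (at 0)"
        by (auto intro!: derivative_eq_intros simp: power2_eq_square algebra_simps)
    qed
    finally show ?thesis .
  qed
  have "levi_pert W (0, s, x) \<sigma> 0 = levi_pert 0 (0, s, x) \<sigma> 0 + 4 * W * (s \<bullet> s) * (\<sigma> \<bullet> \<sigma>) +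
      4 * W * ((s \<bullet> \<sigma>)\<^sup>2 + (s \<bullet> (\<i> *s \<sigma>))\<^sup>2)"
    by (simp add: levi_pert_def sd inner_i_smult algebra_simps add_divide_distrib)
  moreover have "4 * W * ((s \<bullet> \<sigma>)\<^sup>2 + (s \<bullet> (\<i> *s \<sigma>))\<^sup>2) \<ge> 0" using assms(1) by simp
  ultimately show ?thesis by linarith
qed

text \<open>Positivity is known at s = 0, exactly where the penalty |s|^2 vanishes, and by
  \<open>levi_pert_weight\<close> raising W adds a multiple of this penalty.\<close>

lemma exists_weight:
  obtains W where "W \<ge> 0"
    "\<And>s x \<sigma>. norm s \<le> 1 \<Longrightarrow> norm x = 1 \<Longrightarrow> norm \<sigma> = 1 \<Longrightarrow> levi_pert W (0, s, x) \<sigma> 0 > 0"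
proof -
  define C where "C = cball (0::complex^'m) 1 \<times> sphere (0::complex^'r) 1 \<times> sphere (0::complex^'m) 1"
  define F where "F = (\<lambda>(s, x, \<sigma>). levi_pert 0 (0, s, x) \<sigma> 0)"
  have "compact C" unfolding C_def by (intro compact_Times compact_cball compact_sphere)
  moreover have "continuous_on C F"
  proof -
    have "continuous_on C (\<lambda>y. ((0, fst y, fst (snd y)), snd (snd y), 0) ::
        (real \<times> (complex ^ 'm) \<times> (complex ^ 'r)) \<times> (complex ^ 'm) \<times> (complex ^ 'r))"
      by (intro continuous_intros)
    from continuous_on_compose2[OF continuous_on_levi_pert[of 0] this] show ?thesis
      unfolding F_def case_prod_unfold by (force simp: C_def intro!: dom_memI)
  qed
  moreover have "continuous_on C (\<lambda>y. fst y \<bullet> fst y)" by (intro continuous_intros)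
  ultimately obtain M \<eta>' where M: "M \<ge> 0" "\<eta>' > 0" "\<And>c. c \<in> C \<Longrightarrow> F c + M * (fst c \<bullet> fst c) \<ge> \<eta>'"
    by (rule compact_penalty) (auto simp: F_def C_def intro!: levi_pert_origin_pos)
  show ?thesis
  proof (rule that[OF M(1)])
    fix s x \<sigma> assume *: "norm (s::complex^'m) \<le> 1" "norm (x::complex^'r) = 1" "norm (\<sigma>::complex^'m) = 1"
    have "F (s, x, \<sigma>) + M * (s \<bullet> s) \<ge> \<eta>'" using M(3)[of "(s, x, \<sigma>)"] * by (simp add: C_def)
    moreover have "M * (s \<bullet> s) \<le> 4 * M * (s \<bullet> s) * (\<sigma> \<bullet> \<sigma>)"
      using * M(1) by (simp add: dot_square_norm)
    ultimately show "levi_pert M (0, s, x) \<sigma> 0 > 0"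
      using levi_pert_weight[OF M(1) *(1,2), of \<sigma>] M(2) by (simp add: F_def)
  qed
qed


text \<open>The compact set includes the parameter e in [0, 1/2], so the constants \<open>M\<close>
  and \<open>\<eta>'\<close> are found before e is chosen. The penalty e + |\<xi>|^2 vanishes only
  for e = 0 and \<xi> = 0, the case of the hypothesis. Afterwards the part with |\<xi>|^2 is
  absorbed by the Levi form of |x|^2, and the part with e by \<open>\<eta>'\<close>.\<close>

lemma exists_eps:
  assumes "W \<ge> 0"
    and pos: "\<And>s x \<sigma>. norm s \<le> 1 \<Longrightarrow> norm x = 1 \<Longrightarrow> norm \<sigma> = 1 \<Longrightarrow> levi_pert W (0, s, x) \<sigma> 0 > 0"
  obtains e where "0 < e" "e \<le> 1/2"
    "\<And>s x. norm s \<le> 1 \<Longrightarrow> norm x = 1 \<Longrightarrow> dualfn W e s x > 0"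
    "\<And>s x \<sigma> \<xi>. norm s \<le> 1 \<Longrightarrow> norm x = 1 \<Longrightarrow> norm (\<sigma>, \<xi>) = 1 \<Longrightarrow> \<xi> \<bullet> \<xi> + e * levi_pert W (e, s, x) \<sigma> \<xi> > 0"
proof -
  define C0 where "C0 = {0..1/2::real} \<times> cball (0::complex^'m) 1 \<times> sphere (0::complex^'r) 1"
  define C where "C = C0 \<times> sphere (0::(complex^'m) \<times> (complex^'r)) 1"
  define F where "F = (\<lambda>(z, \<sigma>, \<xi>). levi_pert W z \<sigma> \<xi>)"
  have C0: "compact C0" unfolding C0_def by (intro compact_Times compact_Icc compact_cball compact_sphere)
  then have "compact C" unfolding C_def by (intro compact_Times compact_sphere)
  have sub: "C0 \<subseteq> dom W" using assms(1) by (auto simp: C0_def intro!: dom_memI)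
  have "continuous_on C F" unfolding F_def
    by (rule continuous_on_subset[OF continuous_on_levi_pert]) (use sub in \<open>auto simp: C_def\<close>)
  moreover have "continuous_on C (\<lambda>y. fst (fst y) + snd (snd y) \<bullet> snd (snd y))"
    by (intro continuous_intros)
  moreover have "fst (fst c) + snd (snd c) \<bullet> snd (snd c) \<ge> 0" if "c \<in> C" for c
    using that by (auto simp: C_def C0_def)
  moreover have "F c > 0" if "c \<in> C" "fst (fst c) + snd (snd c) \<bullet> snd (snd c) = 0" for c
  proof -
    obtain e s x \<sigma> \<xi> where c: "c = ((e, s, x), \<sigma>, \<xi>)" by (metis prod.collapse)
    have e: "e \<ge> 0" "norm s \<le> 1" "norm x = 1" "norm (\<sigma>, \<xi>) = 1" using that(1) by (auto simp: c C_def C0_def)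
    then have "e = 0" "\<xi> = 0" using that(2) inner_ge_zero[of \<xi>] unfolding c
      by (auto simp: add_nonneg_eq_0_iff)
    then show ?thesis using pos[of s x \<sigma>] e by (simp add: c F_def norm_Pair)
  qed
  ultimately obtain M \<eta>' where M: "M \<ge> 0" "\<eta>' > 0"
    "\<And>c. c \<in> C \<Longrightarrow> F c + M * (fst (fst c) + snd (snd c) \<bullet> snd (snd c)) \<ge> \<eta>'"
    using compact_penalty[OF \<open>compact C\<close>] by (metis (no_types, lifting))
  have "compact (pertT W ` C0)"
    using compact_continuous_image[OF continuous_on_subset[OF Ck_on_imp_continuous_on[OF Ck_on_pertT] sub] C0] .
  then obtain L where L: "\<And>z. z \<in> C0 \<Longrightarrow> \<bar>pertT W z\<bar> \<le> L"
    using compact_imp_bounded bounded_iff by (metis image_eqI real_norm_def)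
  \<comment> \<open>In turn the entries ensure the range of e, \<open>M * e < \<eta>'\<close>,
    \<open>e * M \<le> 1\<close>, and that e times the bound \<open>L\<close> of \<open>pert\<close>
    stays below |x|^2 = 1.\<close>
  define e where "e = Min {1/2, \<eta>' / (2 * (M + 1)), 1 / (M + 1), 1 / (2 * (\<bar>L\<bar> + 1))}"
  have e: "0 < e" "e \<le> 1/2" "e \<le> \<eta>' / (2 * (M + 1))" "e \<le> 1 / (M + 1)" "e \<le> 1 / (2 * (\<bar>L\<bar> + 1))"
  proof -
    show "0 < e" using M unfolding e_def by (subst Min_gr_iff) auto
  qed (unfold e_def, (rule Min.coboundedI; simp)+)
  have eM: "e * M \<le> 1" and eL: "e * \<bar>L\<bar> < 1" and eMe: "M * e < \<eta>'"
  proof -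
    have "e * (M + 1) \<le> 1" using e(4) M(1) by (simp add: field_simps)
    then show "e * M \<le> 1" using e(1) by (simp add: algebra_simps)
    have "2 * (e * (\<bar>L\<bar> + 1)) \<le> 1" using e(5) by (simp add: field_simps)
    then show "e * \<bar>L\<bar> < 1" using e(1) by (simp add: algebra_simps)
    have "2 * (e * (M + 1)) \<le> \<eta>'" using e(3) M(1) by (simp add: field_simps)
    moreover have "e * M \<ge> 0" using e(1) M(1) by simp
    ultimately show "M * e < \<eta>'" using e(1) by (simp add: algebra_simps)
  qed
  show ?thesis
  proof (rule that[OF e(1,2)])
    fix s x assume *: "norm (s::complex^'m) \<le> 1" "norm (x::complex^'r) = 1"
    then have "\<bar>pert W e s x\<bar> \<le> L" using L[of "(e, s, x)"] e by (simp add: C0_def pertT_def)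
    then have "e * \<bar>pert W e s x\<bar> \<le> e * \<bar>L\<bar>" using e(1) by (intro mult_left_mono) auto
    moreover have "\<bar>e * pert W e s x\<bar> = e * \<bar>pert W e s x\<bar>" using e(1) by (simp add: abs_mult)
    ultimately show "dualfn W e s x > 0" using eL * by (simp add: dualfn_eq_pert dot_square_norm)
  next
    fix s x \<sigma> \<xi> assume *: "norm (s::complex^'m) \<le> 1" "norm (x::complex^'r) = 1" "norm (\<sigma>::complex^'m, \<xi>::complex^'r) = 1"
    have "levi_pert W (e, s, x) \<sigma> \<xi> + M * (e + \<xi> \<bullet> \<xi>) \<ge> \<eta>'"
      using M(3)[of "((e, s, x), \<sigma>, \<xi>)"] * e by (simp add: C_def C0_def F_def)
    then have "levi_pert W (e, s, x) \<sigma> \<xi> > - (M * (\<xi> \<bullet> \<xi>))" using eMe by (simp add: algebra_simps)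
    then have "e * levi_pert W (e, s, x) \<sigma> \<xi> > e * - (M * (\<xi> \<bullet> \<xi>))"
      by (rule mult_strict_left_mono[OF _ e(1)])
    moreover have "e * M * (\<xi> \<bullet> \<xi>) \<le> 1 * (\<xi> \<bullet> \<xi>)" using eM by (intro mult_right_mono) auto
    ultimately show "\<xi> \<bullet> \<xi> + e * levi_pert W (e, s, x) \<sigma> \<xi> > 0" by (simp add: mult.assoc)
  qed
qed

end

lemma scaleR_eq_smult: "r *\<^sub>R x = complex_of_real r *s (x :: complex ^ 'k::finite)"
  unfolding vec_eq_iff vector_scaleR_component vector_smult_component by (simp add: scaleR_conv_of_real)

lemma i_smult_scaleR: "\<i> *s (c *\<^sub>R v) = c *\<^sub>R (\<i> *s (v :: complex ^ 'k::finite))"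
  by (simp add: vec_eq_iff)

lemma bounded_linear_of_complex_linear:
  assumes "Vector_Spaces.linear (*s) (*s) (A :: complex ^ 'a::finite \<Rightarrow> complex ^ 'b::finite)"
  shows "bounded_linear A"
proof -
  have "linear A"
    using vec.linear_add[OF assms] vec.linear_scale[OF assms] by (intro linearI) (simp_all add: scaleR_eq_smult)
  then show ?thesis by (simp add: linear_conv_bounded_linear)
qed

section \<open>Homogeneity of the dual family and positivity of its Levi form\<close>

context twisted_family
begin

lemma dualfn_scale: "dualfn W e s (c *s x) = (cmod c)\<^sup>2 * dualfn W e s x"
proof -
  have sc: "(c * a) \<bullet> (c * b) = (cmod c)\<^sup>2 * (a \<bullet> b)" for a b
    unfolding cmod_power2 by (simp add: inner_complex_def power2_eq_square algebra_simps)
  have h: "herm W e s (c *s x) = (cmod c)\<^sup>2 * herm W e s x"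
    by (simp add: herm_def sc sum_distrib_left mult_ac)
  have t: "twist W e s (c *s x) = (cmod c)\<^sup>2 * twist W e s x"
    unfolding twist_def vector_smult_component sc by (simp add: algebra_simps)
  show ?thesis
  proof (cases "c = 0")
    case True
    then show ?thesis by (simp add: dualfn_def herm_def twist_def)
  next
    case False
    then show ?thesis by (simp add: dualfn_def h t field_simps power2_eq_square)
  qed
qed

definition dualT :: "real \<Rightarrow> real \<times> (complex ^ 'm) \<times> (complex ^ 'r) \<Rightarrow> real" where
  "dualT W z = dualfn W (fst z) (fst (snd z)) (snd (snd z))"

lemma Ck_on_normx: "Ck_on n (dom W) (\<lambda>z. snd (snd z) \<bullet> snd (snd z))"
  by (intro Ck_on_inner Ck_on_bounded_linear open_dom bounded_linear_compose[OF bounded_linear_snd bounded_linear_snd])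

lemma Ck_on_dualT: "Ck_on n (dom W) (dualT W)"
proof -
  have "Ck_on n (dom W) (\<lambda>z. snd (snd z) \<bullet> snd (snd z) + fst z * pertT W z)"
    by (intro Ck_on_add Ck_on_mult open_dom Ck_on_pertT Ck_on_normx Ck_on_bounded_linear bounded_linear_fst)
  then show ?thesis by (simp add: dualT_def[abs_def] dualfn_eq_pert pertT_def)
qed

lemma second_derivative_dualT:
  assumes "(e, s, x) \<in> dom W"
  shows "second_derivative (dualT W) (e, s, x) (0, \<sigma>, \<xi>) =
    2 * (\<xi> \<bullet> \<xi>) + e * second_derivative (pertT W) (e, s, x) (0, \<sigma>, \<xi>)"
proof -
  let ?N = "\<lambda>z::real \<times> (complex ^ 'm) \<times> (complex ^ 'r). snd (snd z) \<bullet> snd (snd z)"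
  have "second_derivative (dualT W) (e, s, x) (0, \<sigma>, \<xi>) =
      second_derivative (\<lambda>z. ?N z + e * pertT W z) (e, s, x) (0, \<sigma>, \<xi>)"
  proof (rule second_derivative_same_line[OF open_dom assms Ck_on_dualT open_dom assms])
    show "Ck_on n (dom W) (\<lambda>z. ?N z + e * pertT W z)" for n
      by (intro Ck_on_add Ck_on_mult open_dom Ck_on_pertT Ck_on_normx Ck_on_const)
  qed (simp add: dualT_def pertT_def dualfn_eq_pert)
  also have "\<dots> = second_derivative ?N (e, s, x) (0, \<sigma>, \<xi>) + e * second_derivative (pertT W) (e, s, x) (0, \<sigma>, \<xi>)"
    by (rule second_derivative_add_cmult[OF open_dom assms Ck_on_normx Ck_on_pertT])
  also have "second_derivative ?N (e, s, x) (0, \<sigma>, \<xi>) = 2 * (\<xi> \<bullet> \<xi>)"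
  proof (rule second_derivative_eqI[OF open_dom assms Ck_on_normx])
    have "?N ((e, s, x) + t *\<^sub>R (0, \<sigma>, \<xi>)) = x \<bullet> x + 2 * t * (x \<bullet> \<xi>) + t\<^sup>2 * (\<xi> \<bullet> \<xi>)" for t
      by (simp add: inner_add_left inner_add_right inner_commute[of \<xi> x] power2_eq_square algebra_simps)
    moreover have "((\<lambda>t. x \<bullet> x + 2 * t * (x \<bullet> \<xi>) + t\<^sup>2 * (\<xi> \<bullet> \<xi>)) has_real_derivative
        2 * (x \<bullet> \<xi>) + 2 * t * (\<xi> \<bullet> \<xi>)) (at t)" for t
      by (auto intro!: derivative_eq_intros)
    ultimately show "\<forall>\<^sub>F t in nhds 0. ((\<lambda>t. ?N ((e, s, x) + t *\<^sub>R (0, \<sigma>, \<xi>))) has_real_derivative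
        2 * (x \<bullet> \<xi>) + 2 * t * (\<xi> \<bullet> \<xi>)) (at t)" by simp
    show "((\<lambda>t. 2 * (x \<bullet> \<xi>) + 2 * t * (\<xi> \<bullet> \<xi>)) has_real_derivative 2 * (\<xi> \<bullet> \<xi>)) (at 0)"
      by (auto intro!: derivative_eq_intros)
  qed
  finally show ?thesis .
qed

definition levi_dual ::
  "real \<Rightarrow> real \<times> (complex ^ 'm) \<times> (complex ^ 'r) \<Rightarrow> complex ^ 'm \<Rightarrow> complex ^ 'r \<Rightarrow> real" where
  "levi_dual W z \<sigma> \<xi> = (second_derivative (dualT W) z (0, \<sigma>, \<xi>) +
     second_derivative (dualT W) z (0, \<i> *s \<sigma>, \<i> *s \<xi>)) / 4"

lemma levi_dual_eq:
  "(e, s, x) \<in> dom W \<Longrightarrow> levi_dual W (e, s, x) \<sigma> \<xi> = \<xi> \<bullet> \<xi> + e * levi_pert W (e, s, x) \<sigma> \<xi>"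
  by (simp add: levi_dual_def levi_pert_def second_derivative_dualT inner_i_smult field_simps)

lemma levi_dual_scale:
  assumes "(e, s, x) \<in> dom W"
  shows "levi_dual W (e, s, x) (c *\<^sub>R \<sigma>) (c *\<^sub>R \<xi>) = c\<^sup>2 * levi_dual W (e, s, x) \<sigma> \<xi>"
proof -
  show ?thesis
    using second_derivative_scaleR[OF open_dom assms Ck_on_dualT, of c "(0, \<sigma>, \<xi>)"]
      second_derivative_scaleR[OF open_dom assms Ck_on_dualT, of c "(0, \<i> *s \<sigma>, \<i> *s \<xi>)"]
    by (simp add: levi_dual_def i_smult_scaleR field_simps)
qed

text \<open>The scaling (s, x) to (s, c x) multiplies the function by c^2; on directions it scales
  \<xi> and fixes \<sigma>.\<close>

lemma levi_dual_scale_base: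
  assumes "(e, s, x) \<in> dom W" "(e, s, c *\<^sub>R x) \<in> dom W"
  shows "levi_dual W (e, s, c *\<^sub>R x) \<sigma> (c *\<^sub>R \<xi>) = c\<^sup>2 * levi_dual W (e, s, x) \<sigma> \<xi>"
proof -
  have "second_derivative (dualT W) (e, s, c *\<^sub>R x) (0, \<tau>, c *\<^sub>R \<zeta>) =
     c\<^sup>2 * second_derivative (dualT W) (e, s, x) (0, \<tau>, \<zeta>)" for \<tau> \<zeta>
  proof -
    have "second_derivative (dualT W) (e, s, c *\<^sub>R x) (0, \<tau>, c *\<^sub>R \<zeta>) =
        second_derivative (\<lambda>z. c\<^sup>2 * dualT W z) (e, s, x) (0, \<tau>, \<zeta>)"
    proof (rule second_derivative_same_line[OF open_dom assms(2) Ck_on_dualT open_dom assms(1)])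
      show "Ck_on n (dom W) (\<lambda>z. c\<^sup>2 * dualT W z)" for n
        by (intro Ck_on_mult open_dom Ck_on_dualT Ck_on_const)
      have "c *\<^sub>R x + t *\<^sub>R c *\<^sub>R \<zeta> = complex_of_real c *s (x + t *\<^sub>R \<zeta>)" for t
        by (simp add: scaleR_eq_smult[symmetric] algebra_simps)
      then have "dualfn W e (s + t *\<^sub>R \<tau>) (c *\<^sub>R x + t *\<^sub>R c *\<^sub>R \<zeta>) =
          c\<^sup>2 * dualfn W e (s + t *\<^sub>R \<tau>) (x + t *\<^sub>R \<zeta>)" for t
        by (simp only: dualfn_scale norm_of_real power2_abs)
      then show "dualT W ((e, s, c *\<^sub>R x) + t *\<^sub>R (0, \<tau>, c *\<^sub>R \<zeta>)) =
          c\<^sup>2 * dualT W ((e, s, x) + t *\<^sub>R (0, \<tau>, \<zeta>))" for t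
        by (simp add: dualT_def)
    qed
    then show ?thesis using second_derivative_cmult[OF open_dom assms(1) Ck_on_dualT] by simp
  qed
  then show ?thesis by (simp add: levi_dual_def i_smult_scaleR field_simps)
qed

text \<open>Compactness gives positivity for unit vectors x and unit directions. Homogeneity in x
  and in the direction extends it to all nonzero ones.\<close>

lemma exists_params:
  obtains W e where "W \<ge> 0" "0 < e" "e \<le> 1/2"
    "\<And>s x. norm s \<le> 1 \<Longrightarrow> x \<noteq> 0 \<Longrightarrow> dualfn W e s x > 0"
    "\<And>s x \<sigma> \<xi>. norm s \<le> 1 \<Longrightarrow> x \<noteq> 0 \<Longrightarrow> (\<sigma>, \<xi>) \<noteq> 0 \<Longrightarrow> levi_dual W (e, s, x) \<sigma> \<xi> > 0"
proof -
  obtain W where W: "W \<ge> 0"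
    "\<And>s x \<sigma>. norm s \<le> 1 \<Longrightarrow> norm x = 1 \<Longrightarrow> norm \<sigma> = 1 \<Longrightarrow> levi_pert W (0, s, x) \<sigma> 0 > 0"
    using exists_weight by blast
  obtain e where e: "0 < e" "e \<le> 1/2"
    "\<And>s x. norm s \<le> 1 \<Longrightarrow> norm x = 1 \<Longrightarrow> dualfn W e s x > 0"
    "\<And>s x \<sigma> \<xi>. norm s \<le> 1 \<Longrightarrow> norm x = 1 \<Longrightarrow> norm (\<sigma>, \<xi>) = 1 \<Longrightarrow> \<xi> \<bullet> \<xi> + e * levi_pert W (e, s, x) \<sigma> \<xi> > 0"
    using exists_eps[OF W] by blast
  have d: "(e, s, x) \<in> dom W" if "norm s \<le> 1" "x \<noteq> 0" for s x
    using that W(1) e by (intro dom_memI) auto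
  show ?thesis
  proof (rule that[OF W(1) e(1,2)])
    fix s x assume *: "norm (s::complex^'m) \<le> 1" "(x::complex^'r) \<noteq> 0"
    define u where "u = (1 / norm x) *\<^sub>R x"
    have u: "norm u = 1" "x = norm x *\<^sub>R u" using * by (auto simp: u_def)
    then have "x = complex_of_real (norm x) *s u" by (simp add: scaleR_eq_smult)
    then have "dualfn W e s x = (norm x)\<^sup>2 * dualfn W e s u"
      using dualfn_scale[of W e s "complex_of_real (norm x)" u] by simp
    then show "dualfn W e s x > 0" using e(3)[OF *(1) u(1)] * by simp
    fix \<sigma> \<xi> assume nz: "(\<sigma>::complex^'m, \<xi>::complex^'r) \<noteq> 0"
    \<comment> \<open>Rescaling x to unit length also rescales \<xi> but not \<sigma>, so the
      direction is normalized afterwards, by \<open>N\<close>.\<close>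
    define \<xi>' where "\<xi>' = (1 / norm x) *\<^sub>R \<xi>"
    define N where "N = norm (\<sigma>, \<xi>')"
    have "(\<sigma>, \<xi>') \<noteq> 0" using nz * by (auto simp: \<xi>'_def zero_prod_def)
    then have N: "N > 0" by (simp add: N_def)
    have "norm ((1 / N) *\<^sub>R (\<sigma>, \<xi>')) = 1" using N unfolding N_def norm_scaleR by simp
    then have "norm ((1 / N) *\<^sub>R \<sigma>, (1 / N) *\<^sub>R \<xi>') = 1" by simp
    have u0: "u \<noteq> 0" using u(1) by auto
    have "levi_dual W (e, s, x) \<sigma> \<xi> = levi_dual W (e, s, norm x *\<^sub>R u) \<sigma> (norm x *\<^sub>R \<xi>')"
      using u(2) * by (simp add: \<xi>'_def)
    also have "\<dots> = (norm x)\<^sup>2 * levi_dual W (e, s, u) \<sigma> \<xi>'"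
      using u0 * u(2) by (intro levi_dual_scale_base d) auto
    also have "levi_dual W (e, s, u) \<sigma> \<xi>' = levi_dual W (e, s, u) (N *\<^sub>R (1 / N) *\<^sub>R \<sigma>) (N *\<^sub>R (1 / N) *\<^sub>R \<xi>')"
      using N by simp
    also have "\<dots> = N\<^sup>2 * levi_dual W (e, s, u) ((1 / N) *\<^sub>R \<sigma>) ((1 / N) *\<^sub>R \<xi>')"
      using u0 * by (intro levi_dual_scale d) auto
    finally have "levi_dual W (e, s, x) \<sigma> \<xi> =
      (norm x)\<^sup>2 * (N\<^sup>2 * levi_dual W (e, s, u) ((1 / N) *\<^sub>R \<sigma>) ((1 / N) *\<^sub>R \<xi>'))" .
    moreover have "levi_dual W (e, s, u) ((1 / N) *\<^sub>R \<sigma>) ((1 / N) *\<^sub>R \<xi>') > 0"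
      using e(4)[OF *(1) u(1) \<open>norm ((1 / N) *\<^sub>R \<sigma>, (1 / N) *\<^sub>R \<xi>') = 1\<close>]
      by (simp only: levi_dual_eq[OF d[OF *(1) u0]])
    ultimately show "levi_dual W (e, s, x) \<sigma> \<xi> > 0" using N * by simp
  qed
qed

end

section \<open>Pullbacks of the dual family under affine substitutions\<close>

locale twisted_metric = twisted_family j p q \<eta>
  for j :: "'m::finite" and p q :: "'r::finite" and \<eta> +
  fixes W e :: real
  assumes W: "W \<ge> 0" and e: "0 < e" "e \<le> 1/2"
    and dualfn_pos: "\<And>s x. norm s \<le> 1 \<Longrightarrow> x \<noteq> 0 \<Longrightarrow> dualfn W e s x > 0"
    and levi_dual_pos:
      "\<And>s x \<sigma> \<xi>. norm s \<le> 1 \<Longrightarrow> x \<noteq> 0 \<Longrightarrow> (\<sigma>, \<xi>) \<noteq> 0 \<Longrightarrow> levi_dual W (e, s, x) \<sigma> \<xi> > 0"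
begin

lemma in_dom: "norm s \<le> 1 \<Longrightarrow> x \<noteq> 0 \<Longrightarrow> (e, s, x) \<in> dom W"
  using W e by (intro dom_memI) auto

text \<open>The base point \<open>s0\<close> lets one statement serve both cases: \<open>L\<close>
  carries the variable s for the whole family, and has first component 0 for a single fiber. The
  extension required by \<open>smooth_on\<close> lives on the open preimage \<open>V\<close> of
  \<open>dom W\<close>.\<close>

lemma smooth_dualfn:
  fixes L :: "'z::real_normed_vector \<Rightarrow> (complex ^ 'm) \<times> (complex ^ 'r)" and t :: "'z \<Rightarrow> complex"
  assumes "bounded_linear L" "bounded_linear t" "\<And>z. z \<in> S \<Longrightarrow> norm (s0 + fst (L z)) \<le> 1 \<and> snd (L z) \<noteq> 0"
    and f: "\<And>z. z \<in> S \<Longrightarrow> f z = (cmod (t z))\<^sup>2 * dualfn W e (s0 + fst (L z)) (snd (L z))"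
  shows "smooth_on S f"
proof -
  define V where "V = (\<lambda>z. (e, s0, 0) + (0, L z)) -` dom W"
  have L': "bounded_linear (\<lambda>z. (0::real, L z))"
    by (intro bounded_linear_Pair bounded_linear_zero assms(1))
  have "open V" unfolding V_def
    by (rule open_vimage[OF open_dom]) (intro continuous_intros linear_continuous_on L')
  have "Ck_on n V (\<lambda>z. (t z \<bullet> t z) * dualT W ((e, s0, 0) + (0, L z)))" for n
    by (intro Ck_on_mult Ck_on_inner \<open>open V\<close> Ck_on_bounded_linear assms(2)
        Ck_on_affine_compose[OF L' open_dom \<open>open V\<close> _ Ck_on_dualT]) (simp add: V_def)
  moreover have "S \<subseteq> V" using assms(3) in_dom by (auto simp: V_def split: prod.splits) (metis in_dom fst_conv snd_conv prod.collapse plus_prod_def add_0 add.right_neutral)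
  moreover have "(t z \<bullet> t z) * dualT W ((e, s0, 0) + (0, L z)) = f z" if "z \<in> S" for z
    using f[OF that] by (simp add: dualT_def dot_square_norm)
  ultimately show ?thesis unfolding smooth_on_def using \<open>open V\<close> by blast
qed

text \<open>As \<open>L\<close> commutes with multiplication by i, the Levi form of the pullback in
  direction w is \<open>levi_dual\<close> in direction \<open>L w\<close>, which is nonzero by
  injectivity.\<close>

lemma strongly_psh_dualfn:
  fixes L :: "'z::real_normed_vector \<Rightarrow> (complex ^ 'm) \<times> (complex ^ 'r)"
  assumes "bounded_linear L" "open S" "\<And>z. z \<in> S \<Longrightarrow> norm (s0 + fst (L z)) \<le> 1 \<and> snd (L z) \<noteq> 0"
    and f: "\<And>z. z \<in> S \<Longrightarrow> f z = dualfn W e (s0 + fst (L z)) (snd (L z))"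
    and i: "\<And>w. L (sc \<i> w) = (\<i> *s fst (L w), \<i> *s snd (L w))" and inj: "\<And>w. L w = 0 \<Longrightarrow> w = 0"
  shows "strongly_psh_on sc S f"
  unfolding strongly_psh_on_def
proof (intro ballI allI impI)
  fix a w assume a: "a \<in> S" and w: "(w::'z) \<noteq> 0"
  define F where "F = (\<lambda>z. dualT W ((e, s0, 0) + (0, L z)))"
  define V where "V = (\<lambda>z. (e, s0, 0) + (0, L z)) -` dom W"
  have L': "bounded_linear (\<lambda>z. (0::real, L z))"
    by (intro bounded_linear_Pair bounded_linear_zero assms(1))
  have "open V" unfolding V_def
    by (rule open_vimage[OF open_dom]) (intro continuous_intros linear_continuous_on L')
  have CF: "Ck_on n V F" for n
    unfolding F_def by (intro Ck_on_affine_compose[OF L' open_dom \<open>open V\<close> _ Ck_on_dualT]) (simp add: V_def)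
  have d: "(e, s0 + fst (L a), snd (L a)) \<in> dom W" using assms(3)[OF a] by (intro in_dom) auto
  then have aV: "a \<in> V" by (cases "L a") (simp add: V_def)
  have sd: "second_derivative f a v = second_derivative (dualT W) (e, s0 + fst (L a), snd (L a)) (0, L v)" for v
  proof -
    have "second_derivative f a v = second_derivative F a v"
      by (rule second_derivative_cong[OF assms(2) a]) (simp add: F_def dualT_def f)
    also have "\<dots> = second_derivative (dualT W) (e, s0 + fst (L a), snd (L a)) (0, L v)"
    proof (rule second_derivative_same_line[OF \<open>open V\<close> aV CF open_dom d Ck_on_dualT])
      interpret L: bounded_linear L by fact
      show "F (a + t *\<^sub>R v) = dualT W ((e, s0 + fst (L a), snd (L a)) + t *\<^sub>R (0, L v))" for t
        by (simp add: F_def L.add L.scaleR dualT_def add.assoc)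
    qed
    finally show ?thesis .
  qed
  have "levi_form sc f a w = levi_dual W (e, s0 + fst (L a), snd (L a)) (fst (L w)) (snd (L w))"
    by (simp add: levi_form_def levi_dual_def sd i)
  also have "\<dots> > 0" using inj w assms(3)[OF a] by (intro levi_dual_pos) auto
  finally show "levi_form sc f a w > 0" .
qed

end

section \<open>Hyperplanes and metrics on \<open>O(1)\<close> in coordinates\<close>

locale coord_space = vector_space smul
  for smul :: "complex \<Rightarrow> 'v::ab_group_add \<Rightarrow> 'v" +
  fixes \<psi> :: "complex ^ 'r::finite \<Rightarrow> 'v"
  assumes iso: "\<psi> \<in> lin_isos (*s) smul"
begin

lemma bij_iso: "bij \<psi>" using iso by (simp add: lin_isos_def)

lemma linear_iso: "Vector_Spaces.linear (*s) smul \<psi>" using iso by (simp add: lin_isos_def)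

lemma iso_add: "\<psi> (x + y) = \<psi> x + \<psi> y"
  using linear_iso by (simp add: Vector_Spaces.linear_iff)

lemma iso_smul: "\<psi> (c *s x) = smul c (\<psi> x)"
  using linear_iso by (simp add: Vector_Spaces.linear_iff)

lemma inv_iso [simp]: "inv \<psi> (\<psi> x) = x" and iso_inv [simp]: "\<psi> (inv \<psi> v) = v"
  using bij_iso by (auto simp: bij_is_inj bij_is_surj surj_f_inv_f)

lemma inv_add: "inv \<psi> (u + v) = inv \<psi> u + inv \<psi> v"
  by (metis iso_add inv_iso iso_inv)

lemma inv_smul: "inv \<psi> (smul c v) = c *s inv \<psi> v"
  by (metis iso_smul inv_iso iso_inv)

lemma dual_vec_add: "dual_vec \<psi> x (u + v) = dual_vec \<psi> x u + dual_vec \<psi> x v"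
  by (simp add: dual_vec_def inv_add sum.distrib distrib_left)

lemma dual_vec_smul: "dual_vec \<psi> x (smul c v) = c * dual_vec \<psi> x v"
  by (simp add: dual_vec_def inv_smul sum_distrib_left mult_ac)

lemma dual_vec_0: "dual_vec \<psi> x 0 = 0"
  using dual_vec_smul[of x 0 0] by simp

lemma dual_vec_diff: "dual_vec \<psi> x (u - v) = dual_vec \<psi> x u - dual_vec \<psi> x v"
  using dual_vec_add[of x "u - v" v] by simp

lemma dual_vec_iso: "dual_vec \<psi> x (\<psi> y) = (\<Sum>i\<in>UNIV. x $ i * y $ i)"
  by (simp add: dual_vec_def)

lemma dual_vec_axis: "dual_vec \<psi> x (\<psi> (axis i 1)) = x $ i"
  by (simp add: dual_vec_iso axis_def if_distrib cong: if_cong)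

lemma linear_form_eq_dual_vec:
  assumes "\<And>u v. f (u + v) = f u + f v" "\<And>c v. f (smul c v) = c * f v"
  shows "f v = dual_vec \<psi> (\<chi> i. f (\<psi> (axis i 1))) v"
proof -
  define y where "y = inv \<psi> v"
  have "f 0 = 0" using assms(2)[of 0 0] by simp
  then have fs: "f (sum g I) = (\<Sum>i\<in>I. f (g i))" for g and I :: "'r set"
    by (induction I rule: infinite_finite_induct) (auto simp: assms(1))
  have ps: "\<psi> (sum g I) = (\<Sum>i\<in>I. \<psi> (g i))" for g and I :: "'r set"
    using Vector_Spaces.linear.axioms(3)[OF linear_iso]
    by (rule module_hom.sum)
  have "v = \<psi> (\<Sum>i\<in>UNIV. y $ i *s axis i 1)" by (simp add: y_def basis_expansion)
  then have "f v = (\<Sum>i\<in>UNIV. y $ i * f (\<psi> (axis i 1)))"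
    by (simp add: ps fs iso_smul assms(2))
  then show ?thesis by (simp add: dual_vec_def y_def mult.commute)
qed

lemma dual_vec_surj:
  assumes "x \<noteq> 0" obtains v where "dual_vec \<psi> x v = c"
proof -
  obtain k where "x $ k \<noteq> 0" using assms by (metis vec_eq_iff zero_index)
  then have "dual_vec \<psi> x (smul (c / x $ k) (\<psi> (axis k 1))) = c"
    by (simp add: dual_vec_smul dual_vec_axis)
  then show ?thesis using that by blast
qed

section \<open>Hyperplanes and their cosets as level sets of linear forms\<close>

lemma coset_ker: "(+) v ` {u. dual_vec \<psi> x u = 0} = {u. dual_vec \<psi> x u = dual_vec \<psi> x v}"
proof -
  have "u \<in> (+) v ` {u. dual_vec \<psi> x u = 0}" if "dual_vec \<psi> x u = dual_vec \<psi> x v" for u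
    using that by (intro image_eqI[of _ _ "u - v"]) (auto simp: dual_vec_diff)
  then show ?thesis by (auto simp: dual_vec_add)
qed

text \<open>Given a hyperplane P and w outside it, each u lies in c w + P for a unique c, and u to c
  is a linear form with kernel P. Conversely, a kernel together with one vector outside it spans, so
  its dimension is one less than that of the space.\<close>

lemma hyperplanes_eq: "hyperplanes smul = {{v. dual_vec \<psi> x v = 0} |x. x \<noteq> 0}"
proof -
  interpret l: Vector_Spaces.linear "(*s)" smul \<psi> by (rule linear_iso)
  have ind: "independent (\<psi> ` cart_basis)"
    using vec.independent_Basis bij_is_inj[OF bij_iso] by (intro l.independent_injective_image) (auto simp: inj_on_def)
  have "span (\<psi> ` cart_basis) = UNIV"
    using l.span_image[of cart_basis] vec.span_Basis bij_is_surj[OF bij_iso] by simp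
  then interpret fd: finite_dimensional_vector_space smul "\<psi> ` cart_basis"
    by unfold_locales (use ind vec.finite_Basis in auto)
  show ?thesis
  proof (intro set_eqI iffI)
    fix P assume "P \<in> hyperplanes smul"
    then have P: "subspace P" "dim P + 1 = dim UNIV" by (auto simp: hyperplanes_def)
    then obtain w where w: "w \<notin> P" by (metis UNIV_eq_I add_cancel_right_right one_neq_zero)
    have "span P = P" using P(1) span_eq_iff by blast
    then have "w \<notin> span P" using w by (simp only: not_False_eq_True)
    then have "dim (insert w P) = fd.dimension"
      using P(2) by (simp add: fd.dim_insert fd.dimension_def fd.dim_UNIV)
    then have full: "span (insert w P) = UNIV" using fd.dim_eq_full by blast
    have ex: "\<exists>c. u - smul c w \<in> P" for u
      using span_breakdown_eq[of u w P] unfolding full \<open>span P = P\<close> by simp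
    have uni: "c = d" if "u - smul c w \<in> P" "u - smul d w \<in> P" for u c d
    proof (rule ccontr)
      assume "c \<noteq> d"
      have "(u - smul d w) - (u - smul c w) \<in> P" using that P(1) subspace_diff by blast
      then have "smul (c - d) w \<in> P" by (simp add: algebra_simps)
      then have "smul (inverse (c - d)) (smul (c - d) w) \<in> P" using P(1) subspace_scale by blast
      then show False using w \<open>c \<noteq> d\<close> by simp
    qed
    define f where "f u = (THE c. u - smul c w \<in> P)" for u
    have f: "f u = c \<longleftrightarrow> u - smul c w \<in> P" for u c
    proof -
      have "u - smul (f u) w \<in> P"
        unfolding f_def by (rule theI') (use ex[of u] uni[of u] in blast)
      then show ?thesis using uni[of u "f u" c] by blast
    qed
    have f_add: "f (u + v) = f u + f v" for u v
    proof -
      have "(u - smul (f u) w) + (v - smul (f v) w) \<in> P" using f P(1) subspace_add by blast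
      then show ?thesis by (subst f) (simp add: algebra_simps)
    qed
    have f_smul: "f (smul c v) = c * f v" for c v
    proof -
      have "smul c (v - smul (f v) w) \<in> P" using f P(1) subspace_scale by blast
      then show ?thesis by (subst f) (simp add: algebra_simps)
    qed
    define x where "x = (\<chi> i. f (\<psi> (axis i 1)))"
    have fx: "f v = dual_vec \<psi> x v" for v
      unfolding x_def by (rule linear_form_eq_dual_vec[OF f_add f_smul])
    have "f w \<noteq> 0" using f[of w 0] w by simp
    then have "x \<noteq> 0" unfolding fx by (auto simp: dual_vec_def)
    moreover have "P = {v. dual_vec \<psi> x v = 0}" using f[of _ 0] by (auto simp: fx)
    ultimately show "P \<in> {{v. dual_vec \<psi> x v = 0} |x. x \<noteq> 0}" by blast
  next
    fix P assume "P \<in> {{v. dual_vec \<psi> x v = 0} |x. x \<noteq> 0}"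
    then obtain x where x: "x \<noteq> 0" and P: "P = {v. dual_vec \<psi> x v = 0}" by blast
    have sub: "subspace P"
      by (rule subspaceI) (auto simp: P dual_vec_add dual_vec_smul dual_vec_0)
    obtain w where w: "dual_vec \<psi> x w = 1" using dual_vec_surj[OF x] by blast
    have "span (insert w P) = UNIV"
    proof -
      have "u \<in> span (insert w P)" for u
      proof -
        have "u - smul (dual_vec \<psi> x u) w \<in> P" by (simp add: P dual_vec_diff dual_vec_smul w)
        then have "(u - smul (dual_vec \<psi> x u) w) + smul (dual_vec \<psi> x u) w \<in> span (insert w P)"
          by (intro span_add span_scale span_base) auto
        then show ?thesis by simp
      qed
      then show ?thesis by blast
    qed
    then have "dim UNIV = dim (insert w P)" by (metis dim_span)
    also have "\<dots> = dim P + 1"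
    proof -
      have "span P = P" using sub span_eq_iff by blast
      moreover have "w \<notin> P" using w by (simp add: P)
      ultimately have "w \<notin> span P" by (simp only: not_False_eq_True)
      then show ?thesis by (simp add: fd.dim_insert)
    qed
    finally show "P \<in> hyperplanes smul" using sub by (simp add: hyperplanes_def)
  qed
qed

lemma O1_eq: "O1 smul = {{u. dual_vec \<psi> x u = c} |x c. x \<noteq> 0}"
proof (intro set_eqI iffI)
  fix C assume "C \<in> O1 smul"
  then obtain v P where C: "C = (+) v ` P" and "P \<in> hyperplanes smul" unfolding O1_def by blast
  then obtain x where "x \<noteq> 0" "P = {u. dual_vec \<psi> x u = 0}" unfolding hyperplanes_eq by blast
  then show "C \<in> {{u. dual_vec \<psi> x u = c} |x c. x \<noteq> 0}" using C coset_ker by blast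
next
  fix C assume "C \<in> {{u. dual_vec \<psi> x u = c} |x c. x \<noteq> 0}"
  then obtain x c where x: "x \<noteq> 0" and C: "C = {u. dual_vec \<psi> x u = c}" by blast
  obtain v where "dual_vec \<psi> x v = c" using dual_vec_surj[OF x] by blast
  then have "C = (+) v ` {u. dual_vec \<psi> x u = 0}" by (simp add: C coset_ker)
  then show "C \<in> O1 smul" unfolding O1_def hyperplanes_eq using x by blast
qed

text \<open>Equal level sets have kernels with the same direction: the form x' vanishes on the
  kernel of x. Testing it on the vectors x_k e_i - x_i e_k, for a fixed k with x_k nonzero, shows
  that x' is a multiple of x.\<close>

lemma level_set_unique:
  assumes "x \<noteq> 0" "x' \<noteq> 0" "{u. dual_vec \<psi> x u = c} = {u. dual_vec \<psi> x' u = c'}"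
  obtains l where "l \<noteq> 0" "x' = l *s x" "c' = l * c"
proof -
  obtain k where k: "x $ k \<noteq> 0" using assms by (metis vec_eq_iff zero_index)
  obtain v where v: "dual_vec \<psi> x v = c" using dual_vec_surj[OF assms(1)] by blast
  then have v': "dual_vec \<psi> x' v = c'" using assms(3) by blast
  have ker: "dual_vec \<psi> x' u = 0" if "dual_vec \<psi> x u = 0" for u
  proof -
    have "dual_vec \<psi> x (v + u) = c" using v that by (simp add: dual_vec_add)
    then have "dual_vec \<psi> x' (v + u) = c'" using assms(3) by blast
    then show ?thesis using v' by (simp add: dual_vec_add)
  qed
  define l where "l = x' $ k / x $ k"
  have x': "x' = l *s x"
  proof (subst vec_eq_iff, intro allI)
    fix i
    have "dual_vec \<psi> x' (smul (x $ k) (\<psi> (axis i 1)) - smul (x $ i) (\<psi> (axis k 1))) = 0"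
      by (rule ker) (simp add: dual_vec_diff dual_vec_smul dual_vec_axis)
    then show "x' $ i = (l *s x) $ i"
      using k by (simp add: dual_vec_diff dual_vec_smul dual_vec_axis l_def field_simps)
  qed
  have "c' = l * c" using v v' by (simp add: x' dual_vec_def sum_distrib_left[symmetric] mult.assoc)
  moreover have "l \<noteq> 0" using assms(2) x' by auto
  ultimately show ?thesis using that x' by blast
qed

end

text \<open>The metric on \<open>O(1)\<close> whose dual metric is \<open>\<kappa>\<close> in the coordinates given by \<open>\<psi>\<close>: a coset is a level set
  \<open>\<xi> = c\<close> of a linear form, and its squared length is \<open>|c|\<^sup>2 / \<kappa>(\<xi>)\<close>.\<close>

definition O1_of_dual :: "(complex ^ 'r::finite \<Rightarrow> 'v) \<Rightarrow> (complex ^ 'r \<Rightarrow> real) \<Rightarrow> 'v set \<Rightarrow> real" where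
  "O1_of_dual \<psi> \<kappa> C = (SOME y. \<exists>x c. x \<noteq> 0 \<and> C = {u. dual_vec \<psi> x u = c} \<and> y = (cmod c)\<^sup>2 / \<kappa> x)"

section \<open>Metrics on \<open>O(1)\<close> recovered from their duals\<close>

context coord_space
begin

text \<open>The choice in \<open>O1_of_dual\<close> is harmless: any other representation of the
  coset is (l x, l c), and |l|^2 cancels in the quotient by homogeneity.\<close>

lemma O1_of_dual_level:
  assumes "\<And>c x. \<kappa> (c *s x) = (cmod c)\<^sup>2 * \<kappa> x" "x \<noteq> 0"
  shows "O1_of_dual \<psi> \<kappa> {u. dual_vec \<psi> x u = c} = (cmod c)\<^sup>2 / \<kappa> x"
  unfolding O1_of_dual_def
proof (rule some_equality)
  show "\<exists>x' c'. x' \<noteq> 0 \<and> {u. dual_vec \<psi> x u = c} = {u. dual_vec \<psi> x' u = c'} \<and>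
      (cmod c)\<^sup>2 / \<kappa> x = (cmod c')\<^sup>2 / \<kappa> x'"
    using assms(2) by blast
  fix y assume "\<exists>x' c'. x' \<noteq> 0 \<and> {u. dual_vec \<psi> x u = c} = {u. dual_vec \<psi> x' u = c'} \<and> y = (cmod c')\<^sup>2 / \<kappa> x'"
  then obtain x' c' where "x' \<noteq> 0" "{u. dual_vec \<psi> x u = c} = {u. dual_vec \<psi> x' u = c'}"
    and y: "y = (cmod c')\<^sup>2 / \<kappa> x'" by blast
  then obtain l where "l \<noteq> 0" "x' = l *s x" "c' = l * c"
    using level_set_unique[OF assms(2)] by metis
  then show "y = (cmod c)\<^sup>2 / \<kappa> x" by (simp add: y assms(1) norm_mult power_mult_distrib)
qed

lemma O1_metric_of_dual:
  assumes \<kappa>: "\<And>c x. \<kappa> (c *s x) = (cmod c)\<^sup>2 * \<kappa> x" and pos: "\<And>x. x \<noteq> 0 \<Longrightarrow> \<kappa> x > 0"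
    and k: "\<And>C. C \<in> O1 smul \<Longrightarrow> k C = O1_of_dual \<psi> \<kappa> C"
  shows "O1_metric smul k"
  unfolding O1_metric_def
proof
  fix P assume "P \<in> hyperplanes smul"
  then obtain x where x: "x \<noteq> 0" and P: "P = {v. dual_vec \<psi> x v = 0}" unfolding hyperplanes_eq by blast
  let ?\<xi> = "dual_vec \<psi> x"
  \<comment> \<open>The form is constant on each coset of P, so \<open>r\<close> reads off its value
    from an arbitrary element. It identifies V/P with the complex numbers.\<close>
  define r where "r C = ?\<xi> (SOME u. u \<in> C)" for C
  have r: "r ((+) v ` P) = ?\<xi> v" for v
  proof -
    have "(SOME u. u \<in> (+) v ` P) \<in> (+) v ` P" by (rule someI_ex) (auto simp: P coset_ker)
    then show ?thesis by (simp add: r_def P coset_ker)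
  qed
  define g where "g C D = r C * cnj (r D) / complex_of_real (\<kappa> x)" for C D
  have gg: "Re (g ((+) v ` P) ((+) v ` P)) = (cmod (?\<xi> v))\<^sup>2 / \<kappa> x" for v
    unfolding g_def r complex_norm_square[symmetric] by (simp add: of_real_divide[symmetric] del: of_real_divide)
  have kv: "k ((+) v ` P) = (cmod (?\<xi> v))\<^sup>2 / \<kappa> x" for v
  proof -
    have "(+) v ` P \<in> O1 smul" unfolding O1_eq P coset_ker using x by blast
    then show ?thesis using k O1_of_dual_level[OF \<kappa> x] by (simp add: P coset_ker)
  qed
  show "\<exists>g. hermitian_form smul (\<lambda>u v. g ((+) u ` P) ((+) v ` P)) \<and>
     (\<forall>v. (+) v ` P \<noteq> P \<longrightarrow> Re (g ((+) v ` P) ((+) v ` P)) > 0) \<and>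
     (\<forall>v. k ((+) v ` P) = Re (g ((+) v ` P) ((+) v ` P)))"
  proof (intro exI[of _ g] conjI allI impI)
    show "hermitian_form smul (\<lambda>u v. g ((+) u ` P) ((+) v ` P))"
      unfolding hermitian_form_def g_def r
      by (auto simp: dual_vec_add dual_vec_smul add_divide_distrib algebra_simps)
    fix v
    show "k ((+) v ` P) = Re (g ((+) v ` P) ((+) v ` P))" by (simp add: gg kv)
    assume "(+) v ` P \<noteq> P"
    then have "?\<xi> v \<noteq> 0" by (auto simp: P coset_ker)
    then show "Re (g ((+) v ` P) ((+) v ` P)) > 0" using pos[OF x] by (simp add: gg)
  qed
qed

text \<open>The change of coordinates on the dual space from those given by \<open>\<psi>'\<close> to those given by \<open>\<psi>\<close>.\<close>

definition dual_change :: "(complex ^ 'r \<Rightarrow> 'v) \<Rightarrow> complex ^ 'r \<Rightarrow> complex ^ 'r" where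
  "dual_change \<psi>' x = (\<chi> i. dual_vec \<psi>' x (\<psi> (axis i 1)))"

lemma dual_change:
  assumes "\<psi>' \<in> lin_isos (*s) smul"
  shows "dual_vec \<psi>' x v = dual_vec \<psi> (dual_change \<psi>' x) v"
proof -
  interpret c': coord_space smul \<psi>' using assms by unfold_locales
  show ?thesis unfolding dual_change_def
    by (rule linear_form_eq_dual_vec) (auto simp: c'.dual_vec_add c'.dual_vec_smul)
qed

lemma linear_dual_change:
  "Vector_Spaces.linear (*s) (*s) (dual_change \<psi>')"
  unfolding Vector_Spaces.linear_iff
proof (intro conjI allI vec.vector_space_axioms)
  show "dual_change \<psi>' (x + y) = dual_change \<psi>' x + dual_change \<psi>' y" for x y
    by (simp add: dual_change_def dual_vec_def vec_eq_iff sum.distrib distrib_right)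
  show "dual_change \<psi>' (c *s x) = c *s dual_change \<psi>' x" for c x
    by (simp add: dual_change_def dual_vec_def vec_eq_iff sum_distrib_left mult.assoc)
qed

lemma dual_change_eq_0:
  assumes "\<psi>' \<in> lin_isos (*s) smul" "dual_change \<psi>' x = 0" shows "x = 0"
proof -
  interpret c': coord_space smul \<psi>' using assms by unfold_locales
  have "x $ i = 0" for i
    using dual_change[OF assms(1), of x "\<psi>' (axis i 1)"] assms(2)
    by (simp add: c'.dual_vec_axis) (simp add: dual_vec_def)
  then show ?thesis by (simp add: vec_eq_iff)
qed

text \<open>The fiber V/P is one-dimensional, so all quotients in the supremum defining the dual
  metric coincide.\<close>

lemma O1_dual_coord_of_dual:
  assumes \<kappa>: "\<And>c x. \<kappa> (c *s x) = (cmod c)\<^sup>2 * \<kappa> x"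
    and k: "\<And>C. C \<in> O1 smul \<Longrightarrow> k C = O1_of_dual \<psi> \<kappa> C"
    and \<psi>': "\<psi>' \<in> lin_isos (*s) smul" and x: "x \<noteq> 0"
  shows "O1_dual_coord \<psi>' k x t = (cmod t)\<^sup>2 * \<kappa> (dual_change \<psi>' x)"
proof -
  let ?y = "dual_change \<psi>' x"
  have y: "?y \<noteq> 0" using dual_change_eq_0[OF \<psi>'] x by blast
  let ?P = "{v. dual_vec \<psi> ?y v = 0}"
  have "(cmod (t * dual_vec \<psi> ?y v))\<^sup>2 / k ((+) v ` ?P) = (cmod t)\<^sup>2 * \<kappa> ?y" if "v \<in> - ?P" for v
  proof -
    have "(+) v ` ?P \<in> O1 smul" unfolding O1_eq coset_ker using y by blast
    then have "k ((+) v ` ?P) = (cmod (dual_vec \<psi> ?y v))\<^sup>2 / \<kappa> ?y"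
      using k O1_of_dual_level[OF \<kappa> y] by (simp add: coset_ker)
    then show ?thesis using that by (simp add: norm_mult power_mult_distrib)
  qed
  then have "(\<lambda>v. (cmod (t * dual_vec \<psi> ?y v))\<^sup>2 / k ((+) v ` ?P)) ` (- ?P) = (\<lambda>v. (cmod t)\<^sup>2 * \<kappa> ?y) ` (- ?P)"
    by (intro image_cong) auto
  moreover have "- ?P \<noteq> {}"
    using dual_vec_surj[OF y, of 1] by (metis (mono_tags, lifting) ComplI empty_iff mem_Collect_eq zero_neq_one)
  ultimately show ?thesis
    by (simp add: O1_dual_coord_def O1_dual_metric_def dual_change[OF \<psi>'])
qed

end

section \<open>Existence of linear coordinates, and pullback of metrics on
  \<open>O(1)\<close>\<close>

lemma lin_isos_nonempty:
  fixes smul :: "complex \<Rightarrow> 'v::ab_group_add \<Rightarrow> 'v"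
  assumes "vector_space smul" "vector_space.dim smul (UNIV :: 'v set) = CARD('r::finite)"
  shows "\<exists>\<psi>. \<psi> \<in> lin_isos ((*s) :: complex \<Rightarrow> complex ^ 'r \<Rightarrow> complex ^ 'r) smul"
proof -
  interpret vector_space smul by fact
  obtain B where B: "independent B" "UNIV \<subseteq> span B" "card B = dim (UNIV :: 'v set)"
    by (rule basis_exists[of "UNIV :: 'v set"]) (rule that)
  have card: "card B = CARD('r)" using B(3) assms(2) by simp
  then have fin: "finite B" using card_ge_0_finite[of B] zero_less_card_finite by metis
  obtain b where b: "bij_betw b (UNIV :: 'r set) B"
    using finite_same_card_bij[of "UNIV :: 'r set" B] fin card by auto
  define \<psi> where "\<psi> x = (\<Sum>i\<in>UNIV. smul (x $ i) (b i))" for x :: "complex ^ 'r"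
  have lin: "Vector_Spaces.linear (*s) smul \<psi>"
    unfolding Vector_Spaces.linear_iff
  proof (intro conjI allI vec.vector_space_axioms assms(1))
    show "\<psi> (x + y) = \<psi> x + \<psi> y" for x y
      by (simp add: \<psi>_def scale_left_distrib sum.distrib)
    show "\<psi> (c *s x) = smul c (\<psi> x)" for c x
      by (simp add: \<psi>_def scale_sum_right)
  qed
  have eq: "\<psi> x = (\<Sum>v\<in>B. smul (x $ inv b v) v)" for x
  proof -
    have "inv b (b i) = i" for i using b by (simp add: bij_betw_def inv_f_f)
    then show ?thesis
      unfolding \<psi>_def using sum.reindex_bij_betw[OF b, of "\<lambda>v. smul (x $ inv b v) v"] by simp
  qed
  have "inj \<psi>"
  proof (rule injI)
    fix x y assume "\<psi> x = \<psi> y"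
    then have "\<psi> (x - y) = 0" using module_hom.diff[OF Vector_Spaces.linear.axioms(3)[OF lin]] by simp
    then have "(x - y) $ inv b v = 0" if "v \<in> B" for v
      using independentD[OF B(1) fin order_refl _ that, of "\<lambda>v. (x - y) $ inv b v"] unfolding eq by blast
    then have "(x - y) $ i = 0" for i using b by (metis UNIV_I bij_betw_def inv_f_f rangeI)
    then show "x = y" by (simp add: vec_eq_iff)
  qed
  moreover have "surj \<psi>"
  proof -
    have "\<exists>x. v = \<psi> x" for v
    proof -
      have "v \<in> range (\<lambda>u. \<Sum>v\<in>B. smul (u v) v)" using B(2) span_finite[OF fin] by blast
      then obtain u where u: "v = (\<Sum>v\<in>B. smul (u v) v)" by blast
      have "b (inv b w) = w" if "w \<in> B" for w using b that by (metis bij_betw_def f_inv_into_f)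
      then have "\<psi> (\<chi> i. u (b i)) = v" by (simp add: eq u)
      then show ?thesis by metis
    qed
    then show ?thesis by (simp add: surj_def)
  qed
  ultimately show ?thesis using lin by (auto simp: lin_isos_def bij_def)
qed

lemma id_lin_isos: "id \<in> lin_isos ((*s) :: complex \<Rightarrow> complex ^ 'r::finite \<Rightarrow> _) (*s)"
  using vec.linear_id by (simp add: lin_isos_def)

interpretation std: coord_space "(*s) :: complex \<Rightarrow> complex ^ 'r::finite \<Rightarrow> complex ^ 'r" id
  by unfold_locales (rule id_lin_isos)

lemma dual_vec_id: "dual_vec id x y = (\<Sum>i\<in>UNIV. x $ i * y $ i)"
  by (simp add: dual_vec_def)

text \<open>The map \<open>\<phi>\<close> sends the level set of x at c to the level set of
  \<open>A x\<close> at the same c. Pulling back a metric thus amounts to composing its dual with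
  the contragredient change of coordinates \<open>A\<close>.\<close>

lemma (in coord_space) K_pullback_of_dual:
  assumes \<kappa>: "\<And>c x. \<kappa> (c *s x) = (cmod c)\<^sup>2 * \<kappa> x" and \<kappa>': "\<And>c x. \<kappa>' (c *s x) = (cmod c)\<^sup>2 * \<kappa>' x"
    and \<phi>: "\<phi> \<in> lin_isos (*s) smul"
    and A: "\<And>x v. dual_vec \<phi> x v = dual_vec \<psi> (A x) v" "\<And>x. x \<noteq> 0 \<Longrightarrow> A x \<noteq> 0" "\<And>x. \<kappa>' x = \<kappa> (A x)"
    and k: "\<And>C. C \<in> O1 smul \<Longrightarrow> k C = O1_of_dual \<psi> \<kappa> C"
  shows "K_pullback (*s) \<phi> k = restrict (O1_of_dual id \<kappa>') (O1 (*s))"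
proof -
  have "k (\<phi> ` C) = O1_of_dual id \<kappa>' C" if "C \<in> O1 (*s)" for C
  proof -
    obtain x c where x: "x \<noteq> 0" and C: "C = {y. dual_vec id x y = c}" using \<open>C \<in> O1 (*s)\<close> std.O1_eq by blast
    interpret p: coord_space smul \<phi> using \<phi> by unfold_locales
    have "\<phi> ` C = {u. dual_vec \<phi> x u = c}"
    proof (intro set_eqI iffI)
      fix u assume "u \<in> {u. dual_vec \<phi> x u = c}"
      then have "inv \<phi> u \<in> C" by (simp add: C dual_vec_def)
      then show "u \<in> \<phi> ` C" using image_eqI[of u \<phi> "inv \<phi> u"] by simp
    qed (auto simp: C dual_vec_def)
    then have im: "\<phi> ` C = {u. dual_vec \<psi> (A x) u = c}" by (simp add: A(1))
    then have "\<phi> ` C \<in> O1 smul" unfolding O1_eq using A(2)[OF x] by blast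
    then have "k (\<phi> ` C) = (cmod c)\<^sup>2 / \<kappa> (A x)" using k O1_of_dual_level[OF \<kappa> A(2)[OF x]] im by simp
    also have "\<dots> = O1_of_dual id \<kappa>' C" unfolding C using std.O1_of_dual_level[OF \<kappa>' x] A(3)[of x] by metis
    finally show ?thesis .
  qed
  then show ?thesis by (auto simp: K_pullback_def restrict_def)
qed

section \<open>Equivariant maps on symmetric metrics\<close>

lemma dual_metric_comp:
  assumes "bij \<phi>" "\<phi> 0 = 0"
  shows "dual_metric (h \<circ> \<phi>) (\<xi> \<circ> \<phi>) = dual_metric h \<xi>"
proof -
  have "\<phi> ` (- {0}) = - {0}" using assms by (metis bij_image_Compl_eq image_empty image_insert)
  then have "(\<lambda>v. (cmod (\<xi> v))\<^sup>2 / h v) ` (- {0}) = (\<lambda>v. (cmod (\<xi> (\<phi> v)))\<^sup>2 / h (\<phi> v)) ` (- {0})"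
    by (metis (no_types, lifting) image_cong image_image)
  then show ?thesis by (simp add: dual_metric_def)
qed

definition flip :: "'r \<Rightarrow> complex ^ 'r \<Rightarrow> complex ^ 'r::finite" where
  "flip k y = (\<chi> i. if i = k then - y $ i else y $ i)"

definition swap :: "'r \<Rightarrow> 'r \<Rightarrow> complex ^ 'r \<Rightarrow> complex ^ 'r::finite" where
  "swap p q y = (\<chi> i. y $ Transposition.transpose p q i)"

text \<open>Invariance under the two flips makes e_p and e_q orthogonal to each other and to the
  remaining coordinates; the swap gives them equal length. On the p, q plane the dual of h is
  therefore the standard form divided by h(e_p).\<close>

lemma dual_metric_symmetric:
  fixes h :: "complex ^ 'r::finite \<Rightarrow> real"
  assumes "hermitian_metric (*s) h" "p \<noteq> q"
    and flip: "\<And>v. h (flip p v) = h v" "\<And>v. h (flip q v) = h v" and swap: "\<And>v. h (swap p q v) = h v"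
  obtains \<gamma> where "\<gamma> > 0"
    "\<And>x. x \<noteq> 0 \<Longrightarrow> (\<And>i. i \<noteq> p \<Longrightarrow> i \<noteq> q \<Longrightarrow> x $ i = 0) \<Longrightarrow>
       dual_metric h (dual_vec id x) = \<gamma> * ((cmod (x $ p))\<^sup>2 + (cmod (x $ q))\<^sup>2)"
proof -
  obtain g where g: "hermitian_form (*s) g" "\<And>v. v \<noteq> 0 \<Longrightarrow> Re (g v v) > 0" "\<And>v. h v = Re (g v v)"
    using assms(1) unfolding hermitian_metric_def by blast
  have add: "g (u + v) w = g u w + g v w" and sc: "g (c *s u) v = c * g u v" and her: "g v u = cnj (g u v)"
    for u v w c using g(1) unfolding hermitian_form_def by blast+
  have add': "g w (u + v) = g w u + g w v" and sc': "g v (c *s u) = cnj c * g v u" for u v w c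
  proof -
    show "g w (u + v) = g w u + g w v"
      using her[of w "u + v"] her[of w u] her[of w v] add[of u v w] by simp
    show "g v (c *s u) = cnj c * g v u"
      using her[of v "c *s u"] her[of v u] sc[of c u v] by simp
  qed
  have h_sc: "h (c *s v) = (cmod c)\<^sup>2 * h v" for c v
  proof -
    have "g (c *s v) (c *s v) = (c * cnj c) * g v v" by (simp add: sc sc')
    then show ?thesis by (simp add: g(3) complex_norm_square[symmetric])
  qed
  have par: "h (u + v) + h (u + (-1) *s v) = 2 * h u + 2 * h v" for u v
    by (simp only: g(3) add add' sc sc') simp
  define ax where "ax k = (axis k 1 :: complex ^ 'r)" for k
  \<comment> \<open>With y the part of v without its k-th coordinate, h agrees at y + v_k e_k and y
    - v_k e_k, so the parallelogram law yields the orthogonal splitting.\<close>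
  have split: "h v = h (v + (- (v $ k)) *s ax k) + (cmod (v $ k))\<^sup>2 * h (ax k)" if "\<And>v. h (flip k v) = h v" for k v
  proof -
    define y where "y = v + (- (v $ k)) *s ax k"
    have v: "v = y + v $ k *s ax k" by (simp add: y_def vec_eq_iff)
    have "flip k v = y + (-1) *s (v $ k *s ax k)"
      by (simp add: flip_def y_def vec_eq_iff ax_def axis_def)
    then have "h (y + (-1) *s (v $ k *s ax k)) = h v" using that[of v] by simp
    moreover have "h (y + v $ k *s ax k) = h v" using v by simp
    ultimately have "2 * h v = 2 * h y + 2 * ((cmod (v $ k))\<^sup>2 * h (ax k))"
      using par[of y "v $ k *s ax k"] by (simp add: h_sc)
    then show ?thesis by (simp add: y_def)
  qed
  have "swap p q (ax p) = ax q"
    using assms(2) by (auto simp: swap_def ax_def axis_def vec_eq_iff Transposition.transpose_def)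
  then have pq: "h (ax q) = h (ax p)" using swap[of "ax p"] by simp
  have hn: "h v \<ge> 0" for v
    using g(2)[of v] sc[of 0 v v] by (cases "v = 0") (auto simp: g(3))
  have "ax p \<noteq> 0" by (simp add: ax_def axis_eq_0_iff)
  then have c: "h (ax p) > 0" using g(2,3) by simp
  have h2: "h v = h (v + (- (v $ p)) *s ax p + (- (v $ q)) *s ax q) + ((cmod (v $ p))\<^sup>2 + (cmod (v $ q))\<^sup>2) * h (ax p)" for v
  proof -
    have q: "(v + (- (v $ p)) *s ax p) $ q = v $ q" using assms(2) by (simp add: ax_def axis_def)
    show ?thesis
      using split[OF flip(1), of v] split[OF flip(2), of "v + (- (v $ p)) *s ax p"]
      unfolding q pq distrib_right by linarith
  qed
  show ?thesis
  proof (rule that[of "1 / h (ax p)"])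
    show "1 / h (ax p) > 0" using c by simp
    fix x :: "complex ^ 'r" assume x: "x \<noteq> 0" "\<And>i. i \<noteq> p \<Longrightarrow> i \<noteq> q \<Longrightarrow> x $ i = 0"
    define X where "X = (cmod (x $ p))\<^sup>2 + (cmod (x $ q))\<^sup>2"
    have sum2: "(\<Sum>i\<in>UNIV. x $ i * v $ i) = x $ p * v $ p + x $ q * v $ q" for v
    proof -
      have "(\<Sum>i\<in>UNIV. x $ i * v $ i) = (\<Sum>i\<in>{p, q}. x $ i * v $ i)"
        by (rule sum.mono_neutral_right) (auto simp: x(2))
      then show ?thesis using assms(2) by simp
    qed
    have Xpos: "X > 0"
    proof (rule ccontr)
      assume "\<not> X > 0"
      then have "x $ p = 0 \<and> x $ q = 0" unfolding X_def by (simp add: sum_power2_gt_zero_iff)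
      then have "x $ i = 0" for i using x(2) by metis
      then show False using x(1) by (simp add: vec_eq_iff)
    qed
    have le: "(cmod (dual_vec id x v))\<^sup>2 / h v \<le> 1 / h (ax p) * X" if "v \<noteq> 0" for v
    proof -
      have hv: "h v > 0" using g(2,3) that by simp
      have "cmod (x $ p * v $ p + x $ q * v $ q) \<le> cmod (x $ p) * cmod (v $ p) + cmod (x $ q) * cmod (v $ q)"
        by (metis norm_mult norm_triangle_ineq)
      then have "(cmod (dual_vec id x v))\<^sup>2 \<le> (cmod (x $ p) * cmod (v $ p) + cmod (x $ q) * cmod (v $ q))\<^sup>2"
        by (simp add: dual_vec_id sum2 power_mono)
      also have "\<dots> \<le> X * ((cmod (v $ p))\<^sup>2 + (cmod (v $ q))\<^sup>2)"
      proof -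
        have "0 \<le> (cmod (x $ p) * cmod (v $ q) - cmod (x $ q) * cmod (v $ p))\<^sup>2" by simp
        then show ?thesis by (simp add: X_def power2_eq_square algebra_simps)
      qed
      finally have "(cmod (dual_vec id x v))\<^sup>2 * h (ax p) \<le> X * ((cmod (v $ p))\<^sup>2 + (cmod (v $ q))\<^sup>2) * h (ax p)"
        using c by (intro mult_right_mono) auto
      also have "\<dots> \<le> X * h v"
        using h2[of v] hn[of "v + (- (v $ p)) *s ax p + (- (v $ q)) *s ax q"] Xpos by (simp add: mult.assoc)
      finally show ?thesis using hv c by (simp add: field_simps)
    qed
    \<comment> \<open>The conjugate of x is the equality case of Cauchy-Schwarz, so the supremum is
      attained there.\<close>
    define v where "v = (\<chi> i. cnj (x $ i))"
    have v0: "v \<noteq> 0" using x(1) by (auto simp: v_def vec_eq_iff)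
    have "v + (- (v $ p)) *s ax p + (- (v $ q)) *s ax q = 0"
      using assms(2) x(2) by (auto simp: v_def vec_eq_iff ax_def axis_def)
    then have "h v = X * h (ax p)" using h2[of v] h_sc[of 0 0] by (simp add: X_def v_def)
    moreover have "dual_vec id x v = complex_of_real X"
      unfolding dual_vec_id sum2 v_def X_def of_real_add complex_norm_square by simp
    ultimately have at: "(cmod (dual_vec id x v))\<^sup>2 / h v = 1 / h (ax p) * X"
      using Xpos c by (simp add: power2_eq_square)
    have "dual_metric h (dual_vec id x) = 1 / h (ax p) * X"
      unfolding dual_metric_def
      by (rule cSup_eq_maximum) (use at v0 le in \<open>auto intro!: image_eqI[of _ _ v]\<close>)
    then show "dual_metric h (dual_vec id x) = 1 / h (ax p) * ((cmod (x $ p))\<^sup>2 + (cmod (x $ q))\<^sup>2)"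
      by (simp add: X_def)
  qed
qed

section \<open>The fibers of the family as one orbit, and the symmetries of the central
  fiber\<close>

context twisted_metric
begin

lemma dualfn_positively_curved:
  assumes "coord_space smul (\<psi> :: complex ^ 'r \<Rightarrow> 'v::ab_group_add)"
  shows "O1_positively_curved TYPE('r) smul (ball (0 :: complex ^ 'm) 1) (\<lambda>s. O1_of_dual \<psi> (dualfn W e s))"
proof -
  interpret c: coord_space smul \<psi> by fact
  have "O1_metric smul (O1_of_dual \<psi> (dualfn W e s))" if "s \<in> ball 0 1" for s
    by (rule c.O1_metric_of_dual[OF dualfn_scale dualfn_pos]) (use that in auto)
  moreover have "smooth_on (ball (0 :: complex ^ 'm) 1 \<times> (-{0}) \<times> UNIV)
        (\<lambda>(s, x, t). O1_dual_coord \<psi>' (O1_of_dual \<psi> (dualfn W e s)) x t) \<and>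
      strongly_psh_on (prod_scale (*s) (*s)) (ball (0 :: complex ^ 'm) 1 \<times> (-{0}))
        (\<lambda>(s, x). O1_dual_coord \<psi>' (O1_of_dual \<psi> (dualfn W e s)) x 1)"
    if \<psi>': "\<psi>' \<in> lin_isos (*s) smul" for \<psi>' :: "complex ^ 'r \<Rightarrow> 'v"
  proof
    let ?A = "c.dual_change \<psi>'"
    note lin = c.linear_dual_change[of \<psi>']
    note bl = bounded_linear_of_complex_linear[OF lin]
    note nz = c.dual_change_eq_0[OF \<psi>']
    have coord: "O1_dual_coord \<psi>' (O1_of_dual \<psi> (dualfn W e s)) x t = (cmod t)\<^sup>2 * dualfn W e s (?A x)"
      if "x \<noteq> 0" for s x t
      by (rule c.O1_dual_coord_of_dual[OF dualfn_scale refl \<psi>' that])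
    show "smooth_on (ball (0 :: complex ^ 'm) 1 \<times> (-{0}) \<times> UNIV)
        (\<lambda>(s, x, t). O1_dual_coord \<psi>' (O1_of_dual \<psi> (dualfn W e s)) x t)"
    proof (rule smooth_dualfn[where L = "\<lambda>z. (fst z, ?A (fst (snd z)))" and t = "\<lambda>z. snd (snd z)" and ?s0.0 = 0])
      show "bounded_linear (\<lambda>z::(complex ^ 'm) \<times> (complex ^ 'r) \<times> complex. (fst z, ?A (fst (snd z))))"
        by (intro bounded_linear_Pair bounded_linear_fst bounded_linear_compose[OF bl]
            bounded_linear_compose[OF bounded_linear_fst bounded_linear_snd])
      show "bounded_linear (\<lambda>z::(complex ^ 'm) \<times> (complex ^ 'r) \<times> complex. snd (snd z))"
        by (intro bounded_linear_compose[OF bounded_linear_snd bounded_linear_snd])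
    qed (clarsimp simp: coord, use nz in blast, clarsimp, use coord in blast)
    show "strongly_psh_on (prod_scale (*s) (*s)) (ball (0 :: complex ^ 'm) 1 \<times> (-{0}))
        (\<lambda>(s, x). O1_dual_coord \<psi>' (O1_of_dual \<psi> (dualfn W e s)) x 1)"
    proof (rule strongly_psh_dualfn[where L = "\<lambda>z. (fst z, ?A (snd z))" and ?s0.0 = 0])
      show "bounded_linear (\<lambda>z::(complex ^ 'm) \<times> (complex ^ 'r). (fst z, ?A (snd z)))"
        by (intro bounded_linear_Pair bounded_linear_fst bounded_linear_compose[OF bl bounded_linear_snd])
      show "open (ball (0 :: complex ^ 'm) 1 \<times> - {0 :: complex ^ 'r})"
        by (intro open_Times) auto
    qed (clarsimp, use nz in blast, clarsimp, use coord[where t = 1] in fastforce,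
        auto simp: prod_scale_def vec.linear_scale[OF lin] zero_prod_def dest: nz)
  qed
  ultimately show ?thesis unfolding O1_positively_curved_def by blast
qed

text \<open>The restriction of the metric to the fiber over s, in standard coordinates. It is made
  extensional because elements of \<open>K_metrics\<close> are.\<close>

definition fiber_metric :: "complex ^ 'm \<Rightarrow> (complex ^ 'r) set \<Rightarrow> real" where
  "fiber_metric s = restrict (O1_of_dual id (dualfn W e s)) (O1 (*s))"

lemma fiber_metric_K:
  assumes "norm s \<le> 1" shows "fiber_metric s \<in> K_metrics TYPE('r) (*s)"
proof -
  have eq: "fiber_metric s C = O1_of_dual id (dualfn W e s) C" if "C \<in> O1 (*s)" for C
    using that by (simp add: fiber_metric_def)
  have "O1_metric (*s) (fiber_metric s)"
    using assms by (intro std.O1_metric_of_dual[OF dualfn_scale dualfn_pos eq]) auto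
  moreover have "smooth_on ((-{0}) \<times> UNIV) (\<lambda>(x, t). O1_dual_coord \<psi>' (fiber_metric s) x t) \<and>
      strongly_psh_on (*s) (-{0}) (\<lambda>x. O1_dual_coord \<psi>' (fiber_metric s) x 1)"
    if \<psi>': "\<psi>' \<in> lin_isos (*s) (*s)" for \<psi>' :: "complex ^ 'r \<Rightarrow> complex ^ 'r"
  proof
    let ?A = "std.dual_change \<psi>'"
    note lin = std.linear_dual_change[of \<psi>']
    note bl = bounded_linear_of_complex_linear[OF lin]
    note nz = std.dual_change_eq_0[OF \<psi>']
    have coord: "O1_dual_coord \<psi>' (fiber_metric s) x t = (cmod t)\<^sup>2 * dualfn W e s (?A x)"
      if "x \<noteq> 0" for x t
      by (rule std.O1_dual_coord_of_dual[OF dualfn_scale eq \<psi>' that])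
    show "smooth_on ((-{0}) \<times> UNIV) (\<lambda>(x, t). O1_dual_coord \<psi>' (fiber_metric s) x t)"
    proof (rule smooth_dualfn[where L = "\<lambda>z. (0, ?A (fst z))" and t = snd and ?s0.0 = s])
      show "bounded_linear (\<lambda>z::(complex ^ 'r) \<times> complex. (0 :: complex ^ 'm, ?A (fst z)))"
        by (intro bounded_linear_Pair bounded_linear_zero bounded_linear_compose[OF bl bounded_linear_fst])
      show "bounded_linear (snd :: (complex ^ 'r) \<times> complex \<Rightarrow> complex)"
        by (rule bounded_linear_snd)
    qed (clarsimp simp: assms, use nz in blast, clarsimp, use coord in blast)
    show "strongly_psh_on (*s) (-{0}) (\<lambda>x. O1_dual_coord \<psi>' (fiber_metric s) x 1)"
    proof (rule strongly_psh_dualfn[where L = "\<lambda>z. (0, ?A z)" and ?s0.0 = s])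
      show "bounded_linear (\<lambda>z. (0 :: complex ^ 'm, ?A z))"
        by (intro bounded_linear_Pair bounded_linear_zero bl)
    qed (auto simp: assms coord vec.linear_scale[OF lin] zero_prod_def dest: nz)
  qed
  ultimately show ?thesis by (auto simp: K_metrics_def fiber_metric_def)
qed

text \<open>\<open>N\<close> is the transpose of \<open>M\<close>. Pulling back the fiber metric
  over s along the inverse of \<open>N\<close> composes its dual with \<open>M\<close>, which gives
  the fiber metric over s'; equivariance then transports the image under \<Psi>, and with it the
  dual.\<close>

lemma Psi_fiber_metric_orbit:
  fixes M N :: "complex ^ 'r \<Rightarrow> complex ^ 'r"
  assumes \<Psi>: "equivariant \<Psi>" and s: "norm s \<le> 1"
    and N: "N \<in> lin_isos (*s) (*s)" and adj: "\<And>x y. dual_vec id (M x) y = dual_vec id x (N y)"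
    and M: "\<And>x. dualfn W e s' x = dualfn W e s (M x)"
  shows "\<Psi> (fiber_metric s') = \<Psi> (fiber_metric s) \<circ> inv N"
    and "dual_metric (\<Psi> (fiber_metric s')) (dual_vec id x) = dual_metric (\<Psi> (fiber_metric s)) (dual_vec id (M x))"
proof -
  interpret n: coord_space "(*s)" N using N by unfold_locales
  have invN: "inv N \<in> lin_isos (*s) (*s)"
    using n.inv_add n.inv_smul bij_imp_bij_inv[OF n.bij_iso]
    by (simp add: lin_isos_def Vector_Spaces.linear_iff vec.vector_space_axioms)
  have invinv: "inv (inv N) = N" by (rule inv_inv_eq[OF n.bij_iso])
  have "M x \<noteq> 0" if "x \<noteq> 0" for x
  proof
    assume "M x = 0"
    have "x $ i = 0" for i
      using adj[of x "inv N (axis i 1)"] std.dual_vec_axis[of x i] by (simp add: \<open>M x = 0\<close>) (simp add: dual_vec_def)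
    then show False using that by (simp add: vec_eq_iff)
  qed
  moreover have "dual_vec (inv N) x v = dual_vec id (M x) v" for x v
    unfolding adj by (simp add: dual_vec_def invinv)
  ultimately have "K_pullback (*s) (inv N) (fiber_metric s) = fiber_metric s'"
    unfolding fiber_metric_def[of s'] using M
    by (intro std.K_pullback_of_dual[OF dualfn_scale dualfn_scale invN, where A = M]) (auto simp: fiber_metric_def)
  then show 1: "\<Psi> (fiber_metric s') = \<Psi> (fiber_metric s) \<circ> inv N"
    using \<Psi> invN fiber_metric_K[OF s] unfolding equivariant_def by metis
  have "dual_vec id x = dual_vec id (M x) \<circ> inv N" by (simp add: fun_eq_iff adj)
  moreover have "inv N 0 = 0" using n.inv_smul[of 0 0] by simp
  ultimately show "dual_metric (\<Psi> (fiber_metric s')) (dual_vec id x) =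
      dual_metric (\<Psi> (fiber_metric s)) (dual_vec id (M x))"
    using dual_metric_comp[OF bij_imp_bij_inv[OF n.bij_iso]] 1 by metis
qed

lemma dualfn_0: "dualfn W e 0 y =
    y \<bullet> y - e * (1/4 * ((y $ p \<bullet> y $ p - y $ q \<bullet> y $ q)\<^sup>2 * inverse (y \<bullet> y)))"
proof -
  have wt: "wt W e i 0 = 1" for i by (simp add: wt_def mu_def)
  have "herm W e 0 y = y \<bullet> y" by (simp add: herm_def wt inner_vec_def)
  then show ?thesis using plateau[of 0] by (simp add: dualfn_def twist_def wt)
qed

text \<open>The matrix A(s): diagonal weights followed by the rotation by the angle Im s_j in the p,
  q plane. Its transpose for the bilinear pairing is \<open>rot_adj\<close>.\<close>

definition rot :: "complex ^ 'm \<Rightarrow> complex ^ 'r \<Rightarrow> complex ^ 'r" where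
  "rot s x = (\<chi> i. if i = p then cos (Im (s $ j)) *\<^sub>R wt W e p s *\<^sub>R x $ p - sin (Im (s $ j)) *\<^sub>R wt W e q s *\<^sub>R x $ q
     else if i = q then sin (Im (s $ j)) *\<^sub>R wt W e p s *\<^sub>R x $ p + cos (Im (s $ j)) *\<^sub>R wt W e q s *\<^sub>R x $ q
     else wt W e i s *\<^sub>R x $ i)"

definition rot_adj :: "complex ^ 'm \<Rightarrow> complex ^ 'r \<Rightarrow> complex ^ 'r" where
  "rot_adj s y = (\<chi> i. if i = p then wt W e p s *\<^sub>R (cos (Im (s $ j)) *\<^sub>R y $ p + sin (Im (s $ j)) *\<^sub>R y $ q)
     else if i = q then wt W e q s *\<^sub>R (cos (Im (s $ j)) *\<^sub>R y $ q - sin (Im (s $ j)) *\<^sub>R y $ p)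
     else wt W e i s *\<^sub>R y $ i)"

lemma sum_split_pq: "(\<Sum>i\<in>UNIV. f i) = f p + f q + (\<Sum>i\<in>UNIV - {p, q}. f i)" for f :: "'r \<Rightarrow> 'b::comm_monoid_add"
proof -
  have "(\<Sum>i\<in>UNIV. f i) = (\<Sum>i\<in>{p, q}. f i) + (\<Sum>i\<in>UNIV - {p, q}. f i)"
    using sum.subset_diff[of "{p, q}" UNIV f] by (simp add: add.commute)
  then show ?thesis using pq by simp
qed

lemma rot_adj: "dual_vec id (rot s x) y = dual_vec id x (rot_adj s y)"
proof -
  have "(\<Sum>i\<in>UNIV - {p, q}. rot s x $ i * y $ i) = (\<Sum>i\<in>UNIV - {p, q}. x $ i * rot_adj s y $ i)"
    by (intro sum.cong) (auto simp: rot_def rot_adj_def)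
  then show ?thesis
    unfolding dual_vec_id sum_split_pq[of "\<lambda>i. rot s x $ i * y $ i"] sum_split_pq[of "\<lambda>i. x $ i * rot_adj s y $ i"]
    using pq by (simp add: rot_def rot_adj_def scaleR_conv_of_real algebra_simps)
qed

lemma rot_adj_lin_isos:
  assumes "norm s \<le> 1" shows "rot_adj s \<in> lin_isos (*s) (*s)"
proof -
  have w: "wt W e i s \<noteq> 0" for i using wt_pos[OF W _ e(2) assms, of i] e(1) by simp
  have lin: "Vector_Spaces.linear (*s) (*s) (rot_adj s)"
    unfolding Vector_Spaces.linear_iff
    by (auto simp: vec.vector_space_axioms rot_adj_def vec_eq_iff algebra_simps)
  have "inj (rot_adj s)"
  proof (rule injI)
    fix x y assume "rot_adj s x = rot_adj s y"
    then have d: "rot_adj s (x - y) = 0" using vec.linear_diff[OF lin] by simp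
    define z where "z = x - y"
    define c d where "c = cos (Im (s $ j))" and "d = sin (Im (s $ j))"
    have cd: "c * c + d * d = 1" unfolding c_def d_def by (metis cos_squared_eq diff_add_cancel power2_eq_square)
    have "rot_adj s z $ i = 0" for i using d by (simp add: z_def)
    note zi = this[unfolded rot_adj_def, simplified]
    have 1: "c *\<^sub>R z $ p + d *\<^sub>R z $ q = 0" using zi[of p] w[of p] by (simp add: c_def d_def)
    have 2: "c *\<^sub>R z $ q - d *\<^sub>R z $ p = 0" using zi[of q] w[of q] pq by (simp add: c_def d_def)
    have "z $ p = (c * c + d * d) *\<^sub>R z $ p" by (simp add: cd)
    also have "\<dots> = c *\<^sub>R (c *\<^sub>R z $ p + d *\<^sub>R z $ q) - d *\<^sub>R (c *\<^sub>R z $ q - d *\<^sub>R z $ p)"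
      by (simp add: algebra_simps)
    finally have p0: "z $ p = 0" by (simp add: 1 2)
    have "z $ q = (c * c + d * d) *\<^sub>R z $ q" by (simp add: cd)
    also have "\<dots> = d *\<^sub>R (c *\<^sub>R z $ p + d *\<^sub>R z $ q) + c *\<^sub>R (c *\<^sub>R z $ q - d *\<^sub>R z $ p)"
      by (simp add: algebra_simps)
    finally have q0: "z $ q = 0" by (simp add: 1 2)
    have "z $ i = 0" for i using zi[of i] w[of i] p0 q0 by (auto split: if_splits)
    then show "x = y" by (simp add: z_def vec_eq_iff)
  qed
  then show ?thesis
    using lin vec.linear_injective_imp_surjective[OF lin] by (simp add: lin_isos_def bij_def)
qed

text \<open>The bound on s puts |s|^2 on the plateau of the cutoff, so both sides have the factor
  1/4. By the double angle formulas \<open>twist\<close> is the difference |y_p|^2 - |y_q|^2 for y =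
  \<open>rot s x\<close>, and \<open>herm\<close> is |y|^2.\<close>

lemma dualfn_rot:
  assumes "norm s \<le> 1/2" shows "dualfn W e s x = dualfn W e 0 (rot s x)"
proof -
  define c d a b where "c = cos (Im (s $ j))" and "d = sin (Im (s $ j))"
    and "a = wt W e p s *\<^sub>R x $ p" and "b = wt W e q s *\<^sub>R x $ q"
  have cd: "c\<^sup>2 + d\<^sup>2 = 1" unfolding c_def d_def by simp
  have rp: "rot s x $ p = c *\<^sub>R a - d *\<^sub>R b" and rq: "rot s x $ q = d *\<^sub>R a + c *\<^sub>R b"
    using pq by (auto simp: rot_def c_def d_def a_def b_def)
  have np: "(rot s x $ p) \<bullet> (rot s x $ p) = c\<^sup>2 * (a \<bullet> a) + d\<^sup>2 * (b \<bullet> b) - 2 * c * d * (a \<bullet> b)"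
    by (simp add: rp inner_diff_left inner_diff_right inner_commute[of b a] power2_eq_square algebra_simps)
  have nq: "(rot s x $ q) \<bullet> (rot s x $ q) = d\<^sup>2 * (a \<bullet> a) + c\<^sup>2 * (b \<bullet> b) + 2 * c * d * (a \<bullet> b)"
    by (simp add: rq inner_add_left inner_add_right inner_commute[of b a] power2_eq_square algebra_simps)
  have "(\<Sum>i\<in>UNIV - {p, q}. rot s x $ i \<bullet> rot s x $ i) = (\<Sum>i\<in>UNIV - {p, q}. (wt W e i s)\<^sup>2 * (x $ i \<bullet> x $ i))"
    by (intro sum.cong) (auto simp: rot_def power2_eq_square)
  moreover have "rot s x $ p \<bullet> rot s x $ p + rot s x $ q \<bullet> rot s x $ q = (c\<^sup>2 + d\<^sup>2) * (a \<bullet> a) + (c\<^sup>2 + d\<^sup>2) * (b \<bullet> b)"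
    unfolding np nq by (simp add: algebra_simps)
  moreover have "a \<bullet> a = (wt W e p s)\<^sup>2 * (x $ p \<bullet> x $ p)" "b \<bullet> b = (wt W e q s)\<^sup>2 * (x $ q \<bullet> x $ q)"
    by (auto simp: a_def b_def power2_eq_square)
  ultimately have h: "herm W e s x = rot s x \<bullet> rot s x"
    unfolding herm_def inner_vec_def sum_split_pq[of "\<lambda>i. rot s x $ i \<bullet> rot s x $ i"]
      sum_split_pq[of "\<lambda>i. (wt W e i s)\<^sup>2 * (x $ i \<bullet> x $ i)"] cd by simp
  have "twist W e s x = (c\<^sup>2 - d\<^sup>2) * (a \<bullet> a - b \<bullet> b) - 2 * d * c * (2 * (a \<bullet> b))"
    unfolding twist_def cos_double sin_double c_def d_def a_def b_def by (simp add: power2_eq_square)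
  then have t: "twist W e s x = rot s x $ p \<bullet> rot s x $ p - rot s x $ q \<bullet> rot s x $ q"
    unfolding np nq by (simp add: algebra_simps)
  have "(norm s)\<^sup>2 \<le> (1/2)\<^sup>2" using assms by (intro power_mono) auto
  then have \<eta>: "\<eta> (s \<bullet> s) = 1/4" by (intro plateau) (simp add: dot_square_norm power2_eq_square)
  show ?thesis unfolding dualfn_0 unfolding dualfn_def h t \<eta> by (rule refl)
qed

text \<open>Flips and the swap preserve \<open>dualfn W e 0\<close>, in which the difference |x_p|^2
  - |x_q|^2 enters only through its square. They are involutions equal to their transposes, so the
  orbit lemma with s = s' = 0 makes the hermitian metric invariant under them.\<close>

lemma Psi_fiber_metric_0:
  assumes \<Psi>: "equivariant \<Psi>"
  obtains \<gamma> where "\<gamma> > 0"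
    "\<And>x. x \<noteq> 0 \<Longrightarrow> (\<And>i. i \<noteq> p \<Longrightarrow> i \<noteq> q \<Longrightarrow> x $ i = 0) \<Longrightarrow>
       dual_metric (\<Psi> (fiber_metric 0)) (dual_vec id x) = \<gamma> * ((cmod (x $ p))\<^sup>2 + (cmod (x $ q))\<^sup>2)"
proof -
  let ?h = "\<Psi> (fiber_metric 0)"
  have herm: "hermitian_metric (*s) ?h"
    using \<Psi> fiber_metric_K[of 0] unfolding equivariant_def by auto
  have inv: "?h (N v) = ?h v"
    if lin: "Vector_Spaces.linear (*s) (*s) N" and NN: "\<And>y. N (N y) = y"
      and adj: "\<And>x y. dual_vec id (N x) y = dual_vec id x (N y)"
      and K: "\<And>x. dualfn W e 0 (N x) = dualfn W e 0 x" for N v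
  proof -
    have "bij N" using NN by (rule involuntory_imp_bij)
    then have "N \<in> lin_isos (*s) (*s)" using lin by (simp add: lin_isos_def)
    from Psi_fiber_metric_orbit(1)[OF \<Psi> _ this adj, of 0 0] K have "?h = ?h \<circ> inv N" by simp
    moreover have "inv N = N" using NN \<open>bij N\<close> by (metis bij_inv_eq_iff ext)
    ultimately show ?thesis by (metis comp_apply)
  qed
  have flip: "?h (flip k v) = ?h v" for k v
  proof (rule inv)
    show "Vector_Spaces.linear (*s) (*s) (flip k)"
      unfolding Vector_Spaces.linear_iff by (auto simp: vec.vector_space_axioms flip_def vec_eq_iff)
    have i: "flip k x $ i \<bullet> flip k x $ i = x $ i \<bullet> x $ i" for x i by (simp add: flip_def)
    then have "flip k x \<bullet> flip k x = x \<bullet> x" for x by (simp add: inner_vec_def)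
    then show "dualfn W e 0 (flip k x) = dualfn W e 0 x" for x by (simp add: dualfn_0 i)
    show "dual_vec id (flip k x) y = dual_vec id x (flip k y)" for x y
      unfolding dual_vec_id by (intro sum.cong) (auto simp: flip_def)
  qed (simp add: flip_def vec_eq_iff)
  have swap: "?h (swap p q v) = ?h v" for v
  proof (rule inv)
    let ?\<tau> = "Transposition.transpose p q"
    show "Vector_Spaces.linear (*s) (*s) (swap p q)"
      unfolding Vector_Spaces.linear_iff by (auto simp: vec.vector_space_axioms swap_def vec_eq_iff)
    have re: "(\<Sum>i\<in>UNIV. f (?\<tau> i)) = (\<Sum>i\<in>UNIV. f i)" for f :: "'r \<Rightarrow> 'b::comm_monoid_add"
      by (rule sum.reindex_bij_betw) (rule bij_transpose)
    have "swap p q x \<bullet> swap p q x = x \<bullet> x" for x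
      unfolding inner_vec_def using re[of "\<lambda>i. x $ i \<bullet> x $ i"] by (simp add: swap_def)
    then show "dualfn W e 0 (swap p q x) = dualfn W e 0 x" for x
      by (simp add: dualfn_0 swap_def power2_commute)
    show "dual_vec id (swap p q x) y = dual_vec id x (swap p q y)" for x y
      unfolding dual_vec_id using re[of "\<lambda>i. x $ i * y $ ?\<tau> i"] by (simp add: swap_def)
  qed (simp add: swap_def vec_eq_iff)
  show ?thesis using dual_metric_symmetric[OF herm pq flip flip swap] that by blast
qed

end

section \<open>The hermitian metric near the boundary\<close>

context twisted_metric
begin

text \<open>The metric whose dual is \<open>herm\<close>.\<close>

definition outer_metric :: "(complex ^ 'r \<Rightarrow> 'v) \<Rightarrow> complex ^ 'm \<Rightarrow> 'v \<Rightarrow> real" where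
  "outer_metric \<psi> s v = (\<Sum>i\<in>UNIV. (cmod (inv \<psi> v $ i))\<^sup>2 / (wt W e i s)\<^sup>2)"

lemma smooth_outer_metric:
  assumes "coord_space smul (\<psi> :: complex ^ 'r \<Rightarrow> 'v::ab_group_add)" "S \<subseteq> ball 0 1"
  shows "smooth_metric TYPE('r) smul S (outer_metric \<psi>)"
  unfolding smooth_metric_def
proof (intro conjI ballI)
  interpret c: coord_space smul \<psi> by fact
  have w: "wt W e i s > 0" if "norm s \<le> 1" for i s using wt_pos[OF W _ e(2) that] e(1) by simp
  {
    fix s assume "s \<in> S"
    then have s: "norm s \<le> 1" using assms(2) by (force simp: subset_iff)
    define g where "g u v = (\<Sum>i\<in>UNIV. inv \<psi> u $ i * cnj (inv \<psi> v $ i) / complex_of_real ((wt W e i s)\<^sup>2))" for u v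
    have gh: "Re (g v v) = outer_metric \<psi> s v" for v
      unfolding g_def outer_metric_def complex_norm_square[symmetric]
      by (simp add: of_real_divide[symmetric] del: of_real_divide of_real_power)
    show "hermitian_metric smul (outer_metric \<psi> s)"
      unfolding hermitian_metric_def
    proof (intro exI[of _ g] conjI allI impI)
      show "hermitian_form smul g"
        unfolding hermitian_form_def
      proof (intro conjI allI)
        show "g (u + v) w = g u w + g v w" for u v w
          by (simp add: g_def c.inv_add distrib_right add_divide_distrib sum.distrib)
        show "g (smul a u) v = a * g u v" for a u v
          by (simp add: g_def c.inv_smul sum_distrib_left mult.assoc)
        show "g v u = cnj (g u v)" for u v
          by (simp add: g_def mult.commute)
      qed
      fix v :: 'v assume "v \<noteq> 0"
      then have "inv \<psi> v \<noteq> 0" by (metis c.iso_inv c.iso_smul c.scale_zero_left vec.scale_zero_left)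
      then obtain k where k: "inv \<psi> v $ k \<noteq> 0" by (metis vec_eq_iff zero_index)
      have "0 < (cmod (inv \<psi> v $ k))\<^sup>2 / (wt W e k s)\<^sup>2" using k w[OF s, of k] by simp
      also have "\<dots> \<le> outer_metric \<psi> s v" unfolding outer_metric_def by (rule member_le_sum) auto
      finally show "Re (g v v) > 0" by (simp add: gh)
    qed (simp add: gh)
  }
  fix \<psi>' :: "complex ^ 'r \<Rightarrow> 'v" assume \<psi>': "\<psi>' \<in> lin_isos (*s) smul"
  interpret c': coord_space smul \<psi>' using \<psi>' by unfold_locales
  have "Vector_Spaces.linear (*s) (*s) (\<lambda>x. inv \<psi> (\<psi>' x))"
    unfolding Vector_Spaces.linear_iff
    by (simp add: vec.vector_space_axioms c'.iso_add c'.iso_smul c.inv_add c.inv_smul)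
  then have bl: "bounded_linear (\<lambda>x. inv \<psi> (\<psi>' x))" by (rule bounded_linear_of_complex_linear)
  \<comment> \<open>The formula for the metric is smooth over the whole open unit ball, which
    supplies the open extension for any subset \<open>S\<close>.\<close>
  let ?U = "ball 0 1 \<times> (UNIV :: (complex ^ 'r) set)"
  have U: "open ?U" by (intro open_Times) auto
  have wt: "Ck_on n ?U (\<lambda>z. wt W e i (fst z))" for i n
    using Ck_on_affine_compose[of "\<lambda>z. (0, z)" UNIV ?U "(e, 0, 0)", OF _ _ U _ Ck_on_wt[of n W i]]
    by (simp add: bounded_linear_Pair bounded_linear_zero bounded_linear_ident)
  have x: "Ck_on n ?U (\<lambda>z. inv \<psi> (\<psi>' (snd z)) $ i)" for i n
    by (intro Ck_on_bounded_linear U bounded_linear_compose[OF bounded_linear_vec_nth]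
        bounded_linear_compose[OF bl bounded_linear_snd])
  have "Ck_on n ?U (\<lambda>z. \<Sum>i\<in>UNIV. (inv \<psi> (\<psi>' (snd z)) $ i \<bullet> inv \<psi> (\<psi>' (snd z)) $ i) *
      inverse ((wt W e i (fst z))\<^sup>2))" for n
  proof (intro Ck_on_sum Ck_on_mult Ck_on_inner x U Ck_on_inverse Ck_on_power wt)
    show "(wt W e i (fst z))\<^sup>2 \<noteq> 0" if "z \<in> ?U" for i and z
      using w[of "fst z" i] that by (auto simp: less_imp_le)
  qed
  moreover have "(\<Sum>i\<in>UNIV. (inv \<psi> (\<psi>' (snd z)) $ i \<bullet> inv \<psi> (\<psi>' (snd z)) $ i) *
      inverse ((wt W e i (fst z))\<^sup>2)) = (case z of (s, x) \<Rightarrow> outer_metric \<psi> s (\<psi>' x))" for z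
    by (simp add: outer_metric_def case_prod_unfold dot_square_norm divide_inverse)
  ultimately show "smooth_on (S \<times> UNIV) (\<lambda>(s, x). outer_metric \<psi> s (\<psi>' x))"
    unfolding smooth_on_def using U assms(2) by blast
qed

text \<open>Since (3/4)^2 = 9/16 is at least 1/2, the cutoff vanishes and the dual metric is
  \<open>herm\<close>. The weighted Cauchy-Schwarz inequality bounds \<open>outer_metric\<close>
  below by |c|^2 / H on the coset at level c, and equality occurs.\<close>

lemma outer_metric_dual:
  assumes "coord_space smul (\<psi> :: complex ^ 'r \<Rightarrow> 'v::ab_group_add)" "3/4 \<le> norm s" "norm s \<le> 1" "C \<in> O1 smul"
  shows "O1_of_dual \<psi> (dualfn W e s) C = k_of (outer_metric \<psi> s) C"
proof -
  interpret c: coord_space smul \<psi> by fact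
  let ?h = "outer_metric \<psi> s"
  have w: "wt W e i s > 0" for i using wt_pos[OF W _ e(2) assms(3)] e(1) by simp
  obtain x c where x: "x \<noteq> 0" and C: "C = {u. dual_vec \<psi> x u = c}" using assms(4) c.O1_eq by blast
  have "(3/4)\<^sup>2 \<le> (norm s)\<^sup>2" using assms(2) by (intro power_mono) auto
  then have "s \<bullet> s \<ge> 1/2" by (simp add: dot_square_norm power2_eq_square)
  then have K: "dualfn W e s x = herm W e s x" by (simp add: dualfn_def vanish)
  define H where "H = herm W e s x"
  have H: "H > 0" unfolding H_def using w x by (intro herm_pos) (auto simp: less_imp_neq[symmetric])
  have Hsum: "H = (\<Sum>i\<in>UNIV. (wt W e i s * cmod (x $ i))\<^sup>2)"
    by (simp add: H_def herm_def power_mult_distrib dot_square_norm)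
  have "(cmod c)\<^sup>2 / H \<le> ?h u" if "u \<in> C" for u
  proof -
    have "cmod c = cmod (\<Sum>i\<in>UNIV. x $ i * inv \<psi> u $ i)" using that by (simp add: C dual_vec_def)
    also have "\<dots> \<le> (\<Sum>i\<in>UNIV. cmod (x $ i * inv \<psi> u $ i))" by (rule norm_sum)
    also have "\<dots> = (\<Sum>i\<in>UNIV. (wt W e i s * cmod (x $ i)) * (cmod (inv \<psi> u $ i) / wt W e i s))"
      using w by (intro sum.cong) (simp_all add: norm_mult less_imp_neq[symmetric])
    finally have "(cmod c)\<^sup>2 \<le> (\<Sum>i\<in>UNIV. (wt W e i s * cmod (x $ i)) * (cmod (inv \<psi> u $ i) / wt W e i s))\<^sup>2"
      by (intro power_mono) auto
    also have "\<dots> \<le> H * (\<Sum>i\<in>UNIV. (cmod (inv \<psi> u $ i) / wt W e i s)\<^sup>2)"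
      unfolding Hsum by (rule Cauchy_Schwarz_ineq_sum)
    also have "(\<Sum>i\<in>UNIV. (cmod (inv \<psi> u $ i) / wt W e i s)\<^sup>2) = ?h u"
      by (simp add: outer_metric_def power_divide)
    finally show ?thesis using H by (simp add: field_simps)
  qed
  moreover have "(cmod c)\<^sup>2 / H \<in> ?h ` C"
  proof
    \<comment> \<open>The equality case of the weighted inequality, scaled so that the form takes
      the value c.\<close>
    let ?y = "\<chi> i. c * complex_of_real ((wt W e i s)\<^sup>2 / H) * cnj (x $ i)"
    have xx: "x $ i * cnj (x $ i) = (complex_of_real (cmod (x $ i)))\<^sup>2" for i
      using complex_norm_square[of "x $ i"] by simp
    have "dual_vec \<psi> x (\<psi> ?y) = (\<Sum>i\<in>UNIV. c / complex_of_real H * complex_of_real ((wt W e i s * cmod (x $ i))\<^sup>2))"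
      unfolding c.dual_vec_iso
      by (intro sum.cong) (simp_all add: power_mult_distrib mult_ac xx)
    also have "\<dots> = c / complex_of_real H * complex_of_real H"
      unfolding Hsum by (simp add: sum_distrib_left)
    finally show "\<psi> ?y \<in> C" using H by (simp add: C)
    have "?h (\<psi> ?y) = (\<Sum>i\<in>UNIV. (cmod c)\<^sup>2 / H\<^sup>2 * (wt W e i s * cmod (x $ i))\<^sup>2)"
      unfolding outer_metric_def c.inv_iso
    proof (intro sum.cong refl)
      fix i
      show "(cmod (?y $ i))\<^sup>2 / (wt W e i s)\<^sup>2 = (cmod c)\<^sup>2 / H\<^sup>2 * (wt W e i s * cmod (x $ i))\<^sup>2"
        using w[of i] H by (simp add: norm_mult power_mult_distrib power_divide norm_power norm_divide power2_eq_square field_simps)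
    qed
    also have "\<dots> = (cmod c)\<^sup>2 / H\<^sup>2 * H" by (simp only: sum_distrib_left[symmetric] Hsum[symmetric])
    finally show "(cmod c)\<^sup>2 / H = ?h (\<psi> ?y)" using H by (simp add: power2_eq_square)
  qed
  ultimately have "k_of ?h C = (cmod c)\<^sup>2 / H"
    unfolding k_of_def by (intro Least_equality) auto
  moreover have "O1_of_dual \<psi> (dualfn W e s) C = (cmod c)\<^sup>2 / H"
    unfolding C H_def K[symmetric] by (rule c.O1_of_dual_level[OF dualfn_scale x])
  ultimately show ?thesis by simp
qed

text \<open>The submean inequality fails for the dual metric on the disc of radius \<rho> in the s_j
  axis, with the dual vector fixed at e_q. The coordinates \<psi> are given by the same choice as in
  \<open>Psi_V\<close>, so the fibers become the \<open>fiber_metric s\<close> without a further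
  change of coordinates.\<close>

lemma Psi_metric_not_semipositive:
  fixes smul :: "complex \<Rightarrow> 'v::ab_group_add \<Rightarrow> 'v"
    and \<Psi> :: "((complex ^ 'r) set \<Rightarrow> real) \<Rightarrow> (complex ^ 'r \<Rightarrow> real)"
  defines "\<psi> \<equiv> (SOME \<psi>. \<psi> \<in> lin_isos ((*s) :: complex \<Rightarrow> complex ^ 'r \<Rightarrow> complex ^ 'r) smul)"
  assumes "coord_space smul \<psi>" and \<Psi>: "equivariant \<Psi>"
  shows "\<not> semipositively_curved TYPE('r) smul (ball (0 :: complex ^ 'm) (1/2))
    (Psi_metric \<Psi> smul (\<lambda>s. O1_of_dual \<psi> (dualfn W e s)))"
proof
  interpret c: coord_space smul \<psi> by fact
  let ?k = "\<lambda>s. O1_of_dual \<psi> (dualfn W e s)"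
  let ?f = "\<lambda>(s, x). dual_metric (Psi_metric \<Psi> smul ?k s) (dual_vec \<psi> x)"
  assume "semipositively_curved TYPE('r) smul (ball (0 :: complex ^ 'm) (1/2)) (Psi_metric \<Psi> smul ?k)"
  then have psh: "psh_on (prod_scale (*s) (*s)) (ball (0 :: complex ^ 'm) (1/2) \<times> UNIV) ?f"
    using c.iso unfolding semipositively_curved_def by blast
  obtain \<gamma> where \<gamma>: "\<gamma> > 0"
    "\<And>x. x \<noteq> 0 \<Longrightarrow> (\<And>i. i \<noteq> p \<Longrightarrow> i \<noteq> q \<Longrightarrow> x $ i = 0) \<Longrightarrow>
       dual_metric (\<Psi> (fiber_metric 0)) (dual_vec id x) = \<gamma> * ((cmod (x $ p))\<^sup>2 + (cmod (x $ q))\<^sup>2)"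
    using Psi_fiber_metric_0[OF \<Psi>] by blast
  \<comment> \<open>The rotation distributes the length of the weighted vector e_q over the p and q
    components without changing it, so only the weight survives.\<close>
  have val: "?f (s, axis q 1) = \<gamma> * (wt W e q s)\<^sup>2" if "norm s \<le> 1/2" for s
  proof -
    have "K_pullback (*s) \<psi> (restrict (?k s) (O1 smul)) = fiber_metric s"
      unfolding fiber_metric_def
      by (rule c.K_pullback_of_dual[OF dualfn_scale dualfn_scale c.iso, where A = "\<lambda>x. x"]) auto
    then have P: "Psi_metric \<Psi> smul ?k s = \<Psi> (fiber_metric s) \<circ> inv \<psi>"
      by (simp add: Psi_metric_def Psi_V_def \<psi>_def[symmetric] Let_def)
    have "dual_vec \<psi> (axis q 1) = dual_vec id (axis q 1) \<circ> inv \<psi>"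
      by (simp add: fun_eq_iff dual_vec_def)
    moreover have "inv \<psi> 0 = 0" using c.inv_smul[of 0 0] by simp
    ultimately have "?f (s, axis q 1) = dual_metric (\<Psi> (fiber_metric s)) (dual_vec id (axis q 1))"
      using dual_metric_comp[OF bij_imp_bij_inv[OF c.bij_iso]] P by simp
    also have "\<dots> = dual_metric (\<Psi> (fiber_metric 0)) (dual_vec id (rot s (axis q 1)))"
      using that by (intro Psi_fiber_metric_orbit(2)[OF \<Psi> _ rot_adj_lin_isos rot_adj dualfn_rot]) auto
    also have "\<dots> = \<gamma> * ((cmod (rot s (axis q 1) $ p))\<^sup>2 + (cmod (rot s (axis q 1) $ q))\<^sup>2)"
    proof (rule \<gamma>(2))
      have "rot_adj s \<in> lin_isos (*s) (*s)" using that by (intro rot_adj_lin_isos) auto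
      then have "surj (rot_adj s)" by (simp add: lin_isos_def bij_is_surj)
      then obtain y where "rot_adj s y = axis q 1" by (metis surjD)
      then have "dual_vec id (rot s (axis q 1)) y = 1"
        using rot_adj[of s "axis q 1" y] std.dual_vec_axis[of "axis q 1" q] by (simp add: axis_def)
      then show "rot s (axis q 1) \<noteq> 0" by (auto simp: dual_vec_def)
    qed (simp add: rot_def axis_def)
    also have "(cmod (rot s (axis q 1) $ p))\<^sup>2 + (cmod (rot s (axis q 1) $ q))\<^sup>2 =
        (sin (Im (s $ j)))\<^sup>2 * (wt W e q s)\<^sup>2 + (cos (Im (s $ j)))\<^sup>2 * (wt W e q s)\<^sup>2"
      using pq by (simp add: rot_def axis_def power_mult_distrib)
    finally show ?thesis by (simp add: distrib_right[symmetric])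
  qed
  \<comment> \<open>Both \<rho> and W\<rho> are at most 1/5, so W\<rho>^2 \<le> 1/25 < 1/10. Thus
    the quartic term cannot undo the concavity at this radius.\<close>
  define \<rho> where "\<rho> = 1 / (5 * (W + 1))"
  have \<rho>: "0 < \<rho>" "\<rho> \<le> 1/5" using W by (auto simp: \<rho>_def field_simps)
  \<comment> \<open>The constant value of the weight of q on the circle |s_j| = \<rho>: there |s|^2
    and |s_j|^2 are both \<rho>^2, and 1 - 11/10 = -1/10.\<close>
  define b where "b = 1 + e * (\<rho>\<^sup>2 * (W * \<rho>\<^sup>2 - 1/10))"
  have circ: "norm (\<zeta> *s axis j (complex_of_real \<rho>)) = cmod \<zeta> * \<rho>"
    "(\<zeta> *s axis j (complex_of_real \<rho>)) $ j = \<zeta> * \<rho>" for \<zeta>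
  proof -
    have "\<zeta> *s axis j (complex_of_real \<rho>) = axis j (\<zeta> * \<rho>)" by (simp add: vec_eq_iff axis_def)
    then show "norm (\<zeta> *s axis j (complex_of_real \<rho>)) = cmod \<zeta> * \<rho>"
      "(\<zeta> *s axis j (complex_of_real \<rho>)) $ j = \<zeta> * \<rho>"
      using \<rho> by (simp_all add: norm_eq_sqrt_inner[of "axis j _"] inner_axis_axis norm_eq_sqrt_inner[symmetric] norm_mult)
  qed
  have wt_circ: "wt W e q (cis \<theta> *s axis j (complex_of_real \<rho>)) = b" for \<theta>
    unfolding wt_def mu_def dot_square_norm circ
    using \<rho> by (simp add: norm_mult b_def power2_eq_square algebra_simps)
  let ?a = "(0 :: complex ^ 'm, axis q 1 :: complex ^ 'r)"
    and ?w = "(axis j (complex_of_real \<rho>) :: complex ^ 'm, 0 :: complex ^ 'r)"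
  have disc: "?a + prod_scale (*s) (*s) \<zeta> ?w = (\<zeta> *s axis j (complex_of_real \<rho>), axis q 1)" for \<zeta>
    by (simp add: prod_scale_def)
  have "?a + prod_scale (*s) (*s) \<zeta> ?w \<in> ball 0 (1/2) \<times> UNIV" if "cmod \<zeta> \<le> 1" for \<zeta>
  proof -
    have "cmod \<zeta> * \<rho> \<le> 1 * (1/5)" using that \<rho> by (intro mult_mono) auto
    then show ?thesis by (simp add: disc circ)
  qed
  then have "?f ?a \<le> integral {0..2*pi} (\<lambda>\<theta>. ?f (?a + prod_scale (*s) (*s) (cis \<theta>) ?w)) / (2*pi)"
    using psh unfolding psh_on_def by blast
  moreover have "?f (?a + prod_scale (*s) (*s) (cis \<theta>) ?w) = \<gamma> * b\<^sup>2" for \<theta>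
    unfolding disc using val[of "cis \<theta> *s axis j (complex_of_real \<rho>)"] \<rho> by (simp add: circ wt_circ)
  moreover have "?f ?a = \<gamma>" using val[of 0] by (simp add: wt_def mu_def)
  ultimately have "\<gamma> \<le> \<gamma> * b\<^sup>2" by simp
  then have "1 \<le> b\<^sup>2" using \<gamma>(1) by simp
  moreover have "b\<^sup>2 < 1"
  proof -
    have "W * \<rho> \<le> 1/5" using W by (simp add: \<rho>_def field_simps)
    then have "W * \<rho> * \<rho> \<le> 1/5 * (1/5)" using \<rho> W by (intro mult_mono) auto
    then have "\<rho>\<^sup>2 * (W * \<rho>\<^sup>2 - 1/10) < 0" using \<rho> by (intro mult_pos_neg) (auto simp: power2_eq_square mult.assoc)
    then have "b < 1" using e(1) by (simp add: b_def mult_pos_neg)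
    moreover have "b > 0"
    proof -
      have "norm (cis 0 *s axis j (complex_of_real \<rho>)) \<le> 1" unfolding circ using \<rho> by simp
      from wt_pos[OF W _ e(2) this, of q] show ?thesis unfolding wt_circ using e(1) by simp
    qed
    ultimately show ?thesis by (simp add: power_less_one_iff)
  qed
  ultimately show False by simp
qed

end

theorem theorem4p1:
  fixes smul :: "complex \<Rightarrow> 'v::ab_group_add \<Rightarrow> 'v"
  assumes "vector_space smul"
    and "vector_space.dim smul (UNIV :: 'v set) = CARD('r::finite)"
    and "CARD('r) \<ge> 2"
  shows "\<exists>(k :: complex ^ 'm::finite \<Rightarrow> 'v set \<Rightarrow> real) (\<rho> :: real) (\<rho>' :: real).
    0 < \<rho> \<and> \<rho> < \<rho>' \<and> \<rho>' < 1 \<and>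
    O1_positively_curved TYPE('r) smul (ball 0 1) k \<and>
    (\<forall>\<Psi> :: ((complex ^ 'r) set \<Rightarrow> real) \<Rightarrow> (complex ^ 'r \<Rightarrow> real).
       equivariant \<Psi> \<longrightarrow>
       \<not> semipositively_curved TYPE('r) smul (ball 0 \<rho>) (Psi_metric \<Psi> smul k)) \<and>
    (\<exists>h :: complex ^ 'm \<Rightarrow> 'v \<Rightarrow> real.
       smooth_metric TYPE('r) smul (ball 0 1 - ball 0 \<rho>') h \<and>
       (\<forall>s \<in> ball 0 1 - ball 0 \<rho>'. \<forall>C \<in> O1 smul. k s C = k_of (h s) C))"
proof -
  have "\<not> CARD('r) \<le> Suc 0" using assms(3) by simp
  then obtain p q :: 'r where "p \<noteq> q" using card_le_Suc0_iff_eq[of "UNIV :: 'r set"] by auto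
  obtain \<eta> :: "real \<Rightarrow> real" where "\<And>n. Ck_on n UNIV \<eta>"
    "\<And>u. u \<le> 1/4 \<Longrightarrow> \<eta> u = 1/4" "\<And>u. u \<ge> 1/2 \<Longrightarrow> \<eta> u = 0"
    using smooth_cutoff by blast
  \<comment> \<open>Any index of the base coordinates can play the role of j.\<close>
  then interpret twisted_family "undefined :: 'm" p q \<eta>
    using \<open>p \<noteq> q\<close> by unfold_locales
  obtain W e where "W \<ge> 0" "0 < e" "e \<le> 1/2"
    "\<And>s x. norm s \<le> 1 \<Longrightarrow> x \<noteq> 0 \<Longrightarrow> dualfn W e s x > 0"
    "\<And>s x \<sigma> \<xi>. norm s \<le> 1 \<Longrightarrow> x \<noteq> 0 \<Longrightarrow> (\<sigma>, \<xi>) \<noteq> 0 \<Longrightarrow> levi_dual W (e, s, x) \<sigma> \<xi> > 0"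
    using exists_params by blast
  then interpret twisted_metric "undefined :: 'm" p q \<eta> W e
    by unfold_locales
  define \<psi> where "\<psi> = (SOME \<psi>. \<psi> \<in> lin_isos ((*s) :: complex \<Rightarrow> complex ^ 'r \<Rightarrow> complex ^ 'r) smul)"
  have "\<psi> \<in> lin_isos (*s) smul"
    unfolding \<psi>_def by (rule someI_ex[OF lin_isos_nonempty[OF assms(1,2)]])
  then have \<psi>: "coord_space smul \<psi>"
    using assms(1) by (intro coord_space.intro coord_space_axioms.intro)
  \<comment> \<open>The radius 1/2 is that of the plateau of the cutoff; beyond 3/4 the cutoff
    vanishes.\<close>
  show ?thesis
  proof (rule exI[of _ "\<lambda>s. O1_of_dual \<psi> (dualfn W e s)"], rule exI[of _ "1/2"], rule exI[of _ "3/4"],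
      intro exI[of _ "outer_metric \<psi>"] conjI allI impI ballI)
    show "O1_positively_curved TYPE('r) smul (ball 0 1) (\<lambda>s. O1_of_dual \<psi> (dualfn W e s))"
      by (rule dualfn_positively_curved[OF \<psi>])
    show "\<not> semipositively_curved TYPE('r) smul (ball 0 (1/2))
        (Psi_metric \<Psi> smul (\<lambda>s. O1_of_dual \<psi> (dualfn W e s)))" if "equivariant \<Psi>"
      for \<Psi> :: "((complex ^ 'r) set \<Rightarrow> real) \<Rightarrow> (complex ^ 'r \<Rightarrow> real)"
      using Psi_metric_not_semipositive[of smul, folded \<psi>_def, OF \<psi> that] .
    show "smooth_metric TYPE('r) smul (ball 0 1 - ball 0 (3/4)) (outer_metric \<psi>)"
      by (rule smooth_outer_metric[OF \<psi>]) auto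
    show "O1_of_dual \<psi> (dualfn W e s) C = k_of (outer_metric \<psi> s) C"
      if "s \<in> ball 0 1 - ball 0 (3/4)" "C \<in> O1 smul" for s C
      using that by (intro outer_metric_dual[OF \<psi>]) auto
  qed auto
qed

end
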